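(* Let $d \ge 1$, $\alpha \in (0,2)$, let $D \subset \mathbf{R}^d$ be a bounded connected open set, and let $\lambda_1 < \lambda_2$ be the two first eigenvalues, with eigenfunctions $\varphi_1, \varphi_2$, of the semigroup of the symmetric $\alpha$-stable process killed on exiting $D$. Then $$ \lambda_2 - \lambda_1 = \inf_{f \in \mathcal{F}} \frac{\mathcal{A}_{d,-\alpha}}{2} \int_D \int_D \frac{(f(x) - f(y))^2}{|x - y|^{d + \alpha}} \varphi_1(x) \varphi_1(y) \, dx \, dy, $$ where $$ \mathcal{F} = \Big\{f \in L^2(D,\varphi_1^2): \int_D f^2(x) \varphi_1^2(x) \, dx = 1, \ \int_D f(x) \varphi_1^2(x) \, dx = 0\Big\}. $$ Moreover, the infimum is achieved for $f = \varphi_2/\varphi_1$.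
   Context: $X_t$ is the symmetric $\alpha$-stable process in $\mathbf{R}^d$: independent stationary increments and $E^0 e^{i \xi \cdot X_t} = e^{-t|\xi|^\alpha}$. $\tau_D = \inf\{t \ge 0 : X_t \notin D\}$, and $P_t^D f(x) = E^x(f(X_t), \tau_D > t)$, $f \in L^2(D)$, is the semigroup of the process killed on exiting $D$. There is an orthonormal basis $\{\varphi_n\}_{n\ge 1}$ of $L^2(D)$ with $P_t^D \varphi_n = e^{-\lambda_n t}\varphi_n$ and $0 < \lambda_1 < \lambda_2 \le \lambda_3 \le \dots$, $\lambda_n \to \infty$; the $\varphi_n$ are continuous and bounded on $D$, $\lambda_1$ is simple and $\varphi_1$ is chosen strictly positive on $D$. $\mathcal{A}_{d,\gamma} = \Gamma((d - \gamma)/2)/(2^{\gamma} \pi^{d/2} |\Gamma(\gamma/2)|)$, so $\mathcal{A}_{d,-\alpha} = 2^\alpha\Gamma((d+\alpha)/2)/(\pi^{d/2}|\Gamma(-\alpha/2)|)$. $L^2(D,\varphi_1^2)$ is the $L^2$ space with inner product $(f,g) = \int_D f(x) g(x) \varphi_1^2(x)\,dx$. *)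

theory Defs
  imports "HOL-Probability.Probability"
begin

text \<open>
  The process started at the origin, with time index \<open>t \<ge> 0\<close> (values at negative times are
  never used). The process under the law \<open>P\<^sup>x\<close> is \<open>x + X\<close>. The exit time depends on the whole
  path, so the usual cadlag version of the process is taken.
\<close>

locale symmetric_stable_process = prob_space M for M :: "'w measure" +
  fixes X :: "real \<Rightarrow> 'w \<Rightarrow> real ^ 'd" and \<alpha> :: real
  assumes measurable_X: "0 \<le> t \<Longrightarrow> X t \<in> borel_measurable M"
    and start_zero: "AE \<omega> in M. X 0 \<omega> = 0"
    and cadlag: "AE \<omega> in M. (\<forall>t\<ge>0. continuous (at_right t) (\<lambda>s. X s \<omega>)) \<and>
                  (\<forall>t>0. \<exists>l. ((\<lambda>s. X s \<omega>) \<longlongrightarrow> l) (at_left t))"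
    and indep_increments: "\<lbrakk>0 \<le> \<tau> 0; mono \<tau>\<rbrakk> \<Longrightarrow>
          indep_vars (\<lambda>_. borel) (\<lambda>i \<omega>. X (\<tau> (Suc i)) \<omega> - X (\<tau> i) \<omega>) {..<n::nat}"
    and stationary_increments: "\<lbrakk>0 \<le> s; 0 \<le> t\<rbrakk> \<Longrightarrow>
          distr M borel (\<lambda>\<omega>. X (s + t) \<omega> - X s \<omega>) = distr M borel (X t)"
    and char_X: "0 \<le> t \<Longrightarrow>
          (CLINT \<omega>|M. iexp (\<xi> \<bullet> X t \<omega>)) = complex_of_real (exp (- (t * norm \<xi> powr \<alpha>)))"

definition exit_time :: "'a set \<Rightarrow> (real \<Rightarrow> 'a) \<Rightarrow> ereal" where
  "exit_time D p = Inf (ereal ` {t. 0 \<le> t \<and> p t \<notin> D})"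

text \<open>
  The event \<open>{\<tau>\<^sub>D > t}\<close> is in general only measurable with respect to the completed
  sigma-algebra, hence the completion. Only values of \<open>f\<close> on \<open>D\<close> enter, because the path is
  still in \<open>D\<close> at time \<open>t\<close> on this event.
\<close>

definition killed_semigroup ::
    "'w measure \<Rightarrow> (real \<Rightarrow> 'w \<Rightarrow> 'a::euclidean_space) \<Rightarrow> 'a set \<Rightarrow> real \<Rightarrow> ('a \<Rightarrow> real) \<Rightarrow> 'a \<Rightarrow> real"
  where "killed_semigroup M X D t f x =
    (LINT \<omega>|completion M.
       f (x + X t \<omega>) * indicator {\<omega>. ereal t < exit_time D (\<lambda>s. x + X s \<omega>)} \<omega>)"

text \<open>
  Real functions in \<open>L\<^sup>2(D, w dx)\<close>, represented by Borel functions on \<open>D\<close>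
  (each class has a Borel representative); values outside \<open>D\<close> are irrelevant.
\<close>

definition L2_on :: "'a::euclidean_space set \<Rightarrow> ('a \<Rightarrow> real) \<Rightarrow> ('a \<Rightarrow> real) set" where
  "L2_on D w = {f. set_borel_measurable lborel D f \<and>
                   set_integrable lborel D (\<lambda>x. (f x)\<^sup>2 * w x)}"

text \<open>Sequences are indexed from 1; the entry with index 0 is ignored.\<close>

definition orthonormal_basis_L2 :: "'a::euclidean_space set \<Rightarrow> (nat \<Rightarrow> 'a \<Rightarrow> real) \<Rightarrow> bool" where
  "orthonormal_basis_L2 D \<phi> \<longleftrightarrow>
     (\<forall>n\<ge>1. \<phi> n \<in> L2_on D (\<lambda>_. 1)) \<and>
     (\<forall>m\<ge>1. \<forall>n\<ge>1. (LBINT x:D. \<phi> m x * \<phi> n x) = (if m = n then 1 else 0)) \<and>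
     (\<forall>f\<in>L2_on D (\<lambda>_. 1).
        (\<lambda>N. LBINT x:D. (f x - (\<Sum>n=1..N. (LBINT y:D. f y * \<phi> n y) * \<phi> n x))\<^sup>2)
          \<longlonglongrightarrow> 0)"

definition riesz_const :: "nat \<Rightarrow> real \<Rightarrow> real" where
  "riesz_const d \<gamma> =
     Gamma ((real d - \<gamma>) / 2) / (2 powr \<gamma> * pi powr (real d / 2) * \<bar>Gamma (\<gamma> / 2)\<bar>)"

text \<open>
  The weighted energy, with values in \<open>[0,\<infinity>]\<close> since it can be infinite for admissible \<open>f\<close>.
  It is used for \<open>u\<close> positive on \<open>D\<close>, where the integrand is nonnegative; on the diagonal,
  a null set, the integrand is 0.
\<close>

definition energy :: "real \<Rightarrow> (real ^ 'd) set \<Rightarrow> (real ^ 'd \<Rightarrow> real) \<Rightarrow> (real ^ 'd \<Rightarrow> real) \<Rightarrow> ennreal"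
  where "energy \<alpha> D u f =
    ennreal (riesz_const CARD('d) (- \<alpha>) / 2) *
      (\<integral>\<^sup>+x\<in>D. (\<integral>\<^sup>+y\<in>D.
         ennreal ((f x - f y)\<^sup>2 / norm (x - y) powr (real CARD('d) + \<alpha>) * u x * u y)
       \<partial>lborel) \<partial>lborel)"

definition admissible :: "'a::euclidean_space set \<Rightarrow> ('a \<Rightarrow> real) \<Rightarrow> ('a \<Rightarrow> real) set" where
  "admissible D u = {f \<in> L2_on D (\<lambda>x. (u x)\<^sup>2).
     (LBINT x:D. (f x)\<^sup>2 * (u x)\<^sup>2) = 1 \<and> (LBINT x:D. f x * (u x)\<^sup>2) = 0}"

end

theory Submission
  imports Defs
begin

text \<open>
  Write \<open>w\<close> for \<open>\<phi> 1\<close> extended by zero, \<open>\<mu>\<^sub>t\<close> for the law of \<open>X t\<close>, \<open>\<nu>\<close> for the measure with density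
  \<open>A / |z|\<^bsup>d+\<alpha>\<^esup>\<close> (\<open>A\<close> the Riesz constant), and
  \<open>G\<^sub>k(z) = \<integral> (k(x) - k(x+z))\<^sup>2 w(x) w(x+z) dx\<close>, so that the energy of \<open>k\<close> is \<open>1/2 \<integral> G\<^sub>k d\<nu>\<close>.

  The idea is to compare two expressions for the energy at a small time \<open>t\<close>. Expanding the square, and using
  that the killed semigroup is symmetric and multiplies \<open>\<phi> 1\<close> by \<open>exp(-\<lambda>\<^sub>1 t)\<close>, the integral of
  \<open>E[(k(x) - k(x + X\<^sub>t))\<^sup>2 w(x) w(x + X\<^sub>t); alive at t]\<close> over \<open>x\<close> equals
  \<open>2 \<Sum>\<^sub>n (exp(-\<lambda>\<^sub>1 t) - exp(-\<lambda>\<^sub>n t)) c\<^sub>n\<^sup>2\<close>, where \<open>c\<^sub>n\<close> are the coefficients of \<open>k w\<close> in the eigenbasis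
  (lemma \<open>killed_energy\<close>). If \<open>k\<close> is admissible then \<open>c\<^sub>1 = 0\<close> and \<open>\<Sum> c\<^sub>n\<^sup>2 = 1\<close>, so after division by \<open>2 t\<close>
  this is asymptotically at least \<open>\<lambda>\<^sub>2 - \<lambda>\<^sub>1\<close>, and for \<open>k = \<phi>\<^sub>2/\<phi>\<^sub>1\<close> it tends to exactly that number. On the other
  hand the process jumps according to \<open>\<nu>\<close>, so after division by \<open>2 t\<close> the same quantity should tend to the energy of \<open>k\<close>.
  Two inequalities make this precise, and neither needs estimates of a heat kernel.

  For the lower bound the restriction to living paths is dropped, which only increases the integral, to
  \<open>\<integral> G\<^sub>k d\<mu>\<^sub>t\<close>. If \<open>k\<close> is bounded then \<open>G\<^sub>k\<close> is a linear combination of functions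
  \<open>H\<^sub>u(z) = \<integral> (u(x) - u(x+z))\<^sup>2 dx\<close> (lemma \<open>weighted_sqdiff_eq\<close>). Each \<open>H\<^sub>u\<close> is an average of
  \<open>2 (1 - cos(\<xi> \<bullet> z))\<close> over a finite measure in \<open>\<xi>\<close> (lemmas \<open>autocorr_spectral\<close>, \<open>sqdiff_spectral\<close>). The integral of
  \<open>1 - cos(\<xi> \<bullet> z)\<close> is \<open>1 - exp(-t|\<xi>|\<^sup>\<alpha>)\<close> under \<open>\<mu>\<^sub>t\<close> and \<open>|\<xi>|\<^sup>\<alpha>\<close> under \<open>\<nu>\<close> (lemma \<open>levy_symbol\<close>), and
  \<open>(1 - exp(-t|\<xi>|\<^sup>\<alpha>)) / t\<close> increases to \<open>|\<xi>|\<^sup>\<alpha>\<close> as \<open>t\<close> decreases to zero. Hence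
  \<open>\<integral> H\<^sub>u d\<mu>\<^sub>t / t\<close> tends to \<open>\<integral> H\<^sub>u d\<nu>\<close>, and for \<open>k\<close> of finite energy
  \<open>\<integral> G\<^sub>k d\<mu>\<^sub>t / t\<close> tends to \<open>\<integral> G\<^sub>k d\<nu>\<close> (lemma \<open>weighted_limit\<close>). Unbounded \<open>k\<close> are truncated, which does not
  increase the energy (lemma \<open>energy_lower_bound\<close>).

  For the converse at \<open>k = \<phi>\<^sub>2/\<phi>\<^sub>1\<close> everything is restricted to a compact set \<open>K \<subseteq> D\<close>. A path that starts in \<open>K\<close>, leaves \<open>D\<close>
  and is back in \<open>K\<close> at time \<open>t\<close> makes two large displacements, an event of probability \<open>O(t\<^sup>2)\<close>
  (lemma \<open>two_jump_bound\<close>), so here the killing is negligible. Multiplying by \<open>1 - exp(-s|z|\<^sup>2)\<close> removes the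
  singularity of \<open>\<nu>\<close> at the origin, so that the limit \<open>t \<rightarrow> 0\<close> exists without any assumption on the energy
  (lemma \<open>weighted_gauss_limit\<close>); then \<open>s \<rightarrow> \<infinity>\<close> and \<open>K\<close> increases to \<open>D\<close> (lemma \<open>energy_ratio_le\<close>).
\<close>

section \<open>Fourier transforms of Gaussians\<close>

lemma gaussian_fourier_1d:
  fixes s \<xi> :: real
  assumes s: "0 < s"
  shows "has_bochner_integral lborel (\<lambda>x. iexp (\<xi> * x) * complex_of_real (exp (- s * x\<^sup>2)))
           (complex_of_real (sqrt (pi / s) * exp (- \<xi>\<^sup>2 / (4 * s))))"
proof -
  define c where "c = sqrt (2 * s)"
  have c: "0 < c" "c\<^sup>2 = 2 * s" using s by (auto simp: c_def)
  let ?t = "\<xi> / c"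
  interpret P: real_distribution std_normal_distribution by (rule real_dist_normal_dist)
  have 1: "integrable std_normal_distribution (\<lambda>x. iexp (?t * x))"
    by (intro P.integrable_iexp) auto
  have 2: "(CLINT x|std_normal_distribution. iexp (?t * x)) = exp (- (?t^2) / 2)"
    using fun_cong[OF char_std_normal_distribution, of ?t] by (simp only: char_def)
  have A: "has_bochner_integral lborel (\<lambda>x. std_normal_density x *\<^sub>R iexp (?t * x)) (complex_of_real (exp (- (?t^2) / 2)))"
    using 1 2 by (simp add: has_bochner_integral_iff integrable_density integral_density normal_density_nonneg)
  have "has_bochner_integral lborel (\<lambda>x. sqrt (2 * pi) *\<^sub>R (std_normal_density (0 + c * x) *\<^sub>R iexp (?t * (0 + c * x))))
     (sqrt (2 * pi) *\<^sub>R (complex_of_real (exp (- (?t^2) / 2)) /\<^sub>R \<bar>c\<bar>))"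
    by (intro has_bochner_integral_scaleR_right)
       (use A c in \<open>subst (asm) lborel_has_bochner_integral_real_affine_iff[where c=c and t=0], auto\<close>)
  also have "(\<lambda>x. sqrt (2 * pi) *\<^sub>R (std_normal_density (0 + c * x) *\<^sub>R iexp (?t * (0 + c * x))))
      = (\<lambda>x. iexp (\<xi> * x) * complex_of_real (exp (- s * x\<^sup>2)))"
  proof
    fix x
    have "(c * x)\<^sup>2 = 2 * s * x\<^sup>2" using c by (simp add: power_mult_distrib)
    then have "sqrt (2 * pi) * std_normal_density (c * x) = exp (- s * x\<^sup>2)"
      by (simp add: normal_density_def real_sqrt_mult)
    then have "complex_of_real (sqrt (2 * pi) * std_normal_density (c * x)) = complex_of_real (exp (- s * x\<^sup>2))"
      by simp
    then show "sqrt (2 * pi) *\<^sub>R (std_normal_density (0 + c * x) *\<^sub>R iexp (?t * (0 + c * x))) =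
       iexp (\<xi> * x) * complex_of_real (exp (- s * x\<^sup>2))"
      using c by (simp only: scaleR_scaleR) (simp add: scaleR_conv_of_real mult_ac)
  qed
  also have "sqrt (2 * pi) *\<^sub>R (complex_of_real (exp (- (?t^2) / 2)) /\<^sub>R \<bar>c\<bar>) =
     complex_of_real (sqrt (pi / s) * exp (- \<xi>\<^sup>2 / (4 * s)))"
  proof -
    have "sqrt (2 * pi) / c = sqrt (pi / s)" using s unfolding c_def
      by (simp flip: real_sqrt_divide)
    moreover have "- (?t^2) / 2 = - \<xi>\<^sup>2 / (4 * s)" using c s
      by (simp add: power_divide field_simps)
    ultimately show ?thesis using c
      by (simp add: scaleR_conv_of_real field_simps flip: of_real_mult of_real_divide of_real_inverse)
  qed
  finally show ?thesis .
qed

text \<open>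
  The integrand is a product of one-dimensional factors, one for each basis direction.
\<close>

lemma gaussian_fourier_complex:
  fixes \<xi> :: "'a::euclidean_space"
  assumes s: "0 < s"
  shows "has_bochner_integral lborel (\<lambda>z. iexp (\<xi> \<bullet> z) * complex_of_real (exp (- s * (norm z)\<^sup>2)))
           (complex_of_real (sqrt (pi / s) ^ DIM('a) * exp (- (norm \<xi>)\<^sup>2 / (4 * s))))"
proof -
  define F where "F b x = iexp ((\<xi> \<bullet> b) * x) * complex_of_real (exp (- s * x\<^sup>2))" for b :: 'a and x :: real
  have F: "has_bochner_integral lborel (F b) (complex_of_real (sqrt (pi / s) * exp (- (\<xi> \<bullet> b)\<^sup>2 / (4 * s))))" for b
    unfolding F_def by (rule gaussian_fourier_1d[OF s])
  have [measurable]: "F b \<in> borel_measurable borel" for b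
    using F[of b] by (auto simp: has_bochner_integral_iff dest: borel_measurable_integrable)
  interpret product_sigma_finite "\<lambda>_::'a. lborel :: real measure" ..
  let ?T = "\<lambda>f::'a \<Rightarrow> real. \<Sum>b\<in>Basis. f b *\<^sub>R b"
  have eq: "(\<Prod>b\<in>Basis. F b (z \<bullet> b)) = iexp (\<xi> \<bullet> z) * complex_of_real (exp (- s * (norm z)\<^sup>2))" for z
  proof -
    have "(\<Prod>b\<in>Basis. F b (z \<bullet> b)) = (\<Prod>b\<in>Basis. exp (\<i> * complex_of_real ((\<xi> \<bullet> b) * (z \<bullet> b)) + complex_of_real (- s * (z \<bullet> b)\<^sup>2)))"
      unfolding F_def exp_add exp_of_real[symmetric] by simp
    also have "\<dots> = exp (\<Sum>b\<in>Basis. \<i> * complex_of_real ((\<xi> \<bullet> b) * (z \<bullet> b)) + complex_of_real (- s * (z \<bullet> b)\<^sup>2))"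
      by (simp add: exp_sum)
    also have "(\<Sum>b\<in>Basis. \<i> * complex_of_real ((\<xi> \<bullet> b) * (z \<bullet> b)) + complex_of_real (- s * (z \<bullet> b)\<^sup>2))
      = \<i> * complex_of_real (\<Sum>b\<in>Basis. (\<xi> \<bullet> b) * (z \<bullet> b)) + complex_of_real (- s * (\<Sum>b\<in>Basis. (z \<bullet> b)\<^sup>2))"
      by (simp add: sum.distrib sum_distrib_left sum_negf sum_subtractf)
    also have "(\<Sum>b\<in>Basis. (\<xi> \<bullet> b) * (z \<bullet> b)) = \<xi> \<bullet> z" by (simp add: euclidean_inner[of \<xi> z])
    also have "(\<Sum>b\<in>Basis. (z \<bullet> b)\<^sup>2) = (norm z)\<^sup>2"
      unfolding power2_norm_eq_inner euclidean_inner[of z z] by (simp add: power2_eq_square)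
    finally show ?thesis by (simp only: exp_add exp_of_real)
  qed
  have c: "(\<Prod>b\<in>Basis. sqrt (pi / s) * exp (- (\<xi> \<bullet> b)\<^sup>2 / (4 * s))) = sqrt (pi / s) ^ DIM('a) * exp (- (norm \<xi>)\<^sup>2 / (4 * s))"
  proof -
    have "(\<Sum>b\<in>Basis. (\<xi> \<bullet> b)\<^sup>2) = (norm \<xi>)\<^sup>2"
      unfolding power2_norm_eq_inner euclidean_inner[of \<xi> \<xi>] by (simp add: power2_eq_square)
    then have "(\<Sum>b\<in>Basis. - (\<xi> \<bullet> b)\<^sup>2 / (4 * s)) = - (norm \<xi>)\<^sup>2 / (4 * s)"
      by (simp add: sum_negf flip: sum_divide_distrib)
    then show ?thesis by (simp add: prod.distrib flip: exp_sum)
  qed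
  have 1: "integrable (Pi\<^sub>M Basis (\<lambda>_. lborel)) (\<lambda>x. \<Prod>b\<in>Basis. F b (x b))"
    using F by (intro product_integrable_prod) (auto simp: has_bochner_integral_iff)
  have 2: "(\<integral>x. (\<Prod>b\<in>Basis. F b (x b)) \<partial>Pi\<^sub>M Basis (\<lambda>_. lborel)) = (\<Prod>b\<in>Basis. integral\<^sup>L lborel (F b))"
    using F by (intro product_integral_prod) (auto simp: has_bochner_integral_iff)
  have 3: "\<dots> = (\<Prod>b\<in>Basis. complex_of_real (sqrt (pi / s) * exp (- (\<xi> \<bullet> b)\<^sup>2 / (4 * s))))"
    using F by (intro prod.cong) (auto simp: has_bochner_integral_iff)
  have 4: "(\<Prod>b\<in>Basis. F b (?T x \<bullet> b)) = (\<Prod>b\<in>Basis. F b (x b))" for x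
    by (intro prod.cong) auto
  have "has_bochner_integral lborel (\<lambda>z. \<Prod>b\<in>Basis. F b (z \<bullet> b)) (\<Prod>b\<in>Basis. complex_of_real (sqrt (pi / s) * exp (- (\<xi> \<bullet> b)\<^sup>2 / (4 * s))))"
  proof (subst lborel_eq, unfold has_bochner_integral_iff, intro conjI)
    let ?D = "distr (\<Pi>\<^sub>M b\<in>Basis. lborel) borel ?T" and ?f = "\<lambda>z. \<Prod>b\<in>Basis. F b (z \<bullet> b)"
    show "integrable ?D ?f" using 1 by (subst integrable_distr_eq) (simp_all only: 4, measurable)
    show "integral\<^sup>L ?D ?f = (\<Prod>b\<in>Basis. complex_of_real (sqrt (pi / s) * exp (- (\<xi> \<bullet> b)\<^sup>2 / (4 * s))))"
      using 2 3 by (subst integral_distr) (simp_all only: 4, measurable)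
  qed
  then show ?thesis unfolding eq c[symmetric] by simp
qed

lemma gaussian_fourier:
  fixes \<xi> :: "'a::euclidean_space"
  assumes s: "0 < s"
  shows "integrable lborel (\<lambda>z. cos (\<xi> \<bullet> z) * exp (- s * (norm z)\<^sup>2))"
    and "(\<integral>z. cos (\<xi> \<bullet> z) * exp (- s * (norm z)\<^sup>2) \<partial>lborel) = sqrt (pi / s) ^ DIM('a) * exp (- (norm \<xi>)\<^sup>2 / (4 * s))"
proof -
  have Re: "Re (iexp (\<xi> \<bullet> z) * complex_of_real (exp (- s * (norm z)\<^sup>2))) = cos (\<xi> \<bullet> z) * exp (- s * (norm z)\<^sup>2)" for z
    by (simp add: Re_exp)
  show "integrable lborel (\<lambda>z. cos (\<xi> \<bullet> z) * exp (- s * (norm z)\<^sup>2))"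
    and "(\<integral>z. cos (\<xi> \<bullet> z) * exp (- s * (norm z)\<^sup>2) \<partial>lborel) = sqrt (pi / s) ^ DIM('a) * exp (- (norm \<xi>)\<^sup>2 / (4 * s))"
    using has_bochner_integral_Re[OF gaussian_fourier_complex[OF s, of \<xi>]] unfolding Re
    by (auto simp: has_bochner_integral_iff)
qed

lemma gaussian_integral:
  assumes s: "0 < s"
  shows "integrable lborel (\<lambda>z::'a::euclidean_space. exp (- s * (norm z)\<^sup>2))"
    and "(\<integral>z. exp (- s * (norm z)\<^sup>2) \<partial>(lborel::'a measure)) = sqrt (pi / s) ^ DIM('a)"
  using gaussian_fourier[OF s, of 0] by auto

section \<open>The jump measure and its symbol\<close>

lemma nn_integral_Gamma_scaled:
  fixes c p :: real
  assumes "0 < c" "0 < p"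
  shows "(\<integral>\<^sup>+s. ennreal (indicator {0<..} s * (s powr (p - 1) * exp (- s * c))) \<partial>lborel)
         = ennreal (Gamma p * c powr - p)"
proof -
  let ?I = "\<lambda>t::real. indicator {0..} t :: real"
  have "ennreal (Gamma p) = (\<integral>\<^sup>+t. ennreal (?I t * t powr (p - 1) / exp t) \<partial>lborel)"
    by (rule Gamma_conv_nn_integral_real) fact
  also have "\<dots> = ennreal c * (\<integral>\<^sup>+s. ennreal (?I (0 + c * s) * (0 + c * s) powr (p - 1) / exp (0 + c * s)) \<partial>lborel)"
    using assms by (subst nn_integral_real_affine[where c=c and t=0]) auto
  also have "\<dots> = (\<integral>\<^sup>+s. ennreal (c powr p) * ennreal (indicator {0<..} s * (s powr (p - 1) * exp (- s * c))) \<partial>lborel)"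
    unfolding nn_integral_cmult[symmetric]
  proof (subst nn_integral_cmult[symmetric]; (intro nn_integral_cong)?)
    fix s :: real
    have "c * (?I (0 + c * s) * (0 + c * s) powr (p - 1) / exp (0 + c * s)) = c powr p * (indicator {0<..} s * (s powr (p - 1) * exp (- s * c)))"
      using assms by (auto simp: indicator_def powr_mult powr_diff exp_minus field_simps zero_le_mult_iff)
    then show "ennreal c * ennreal (?I (0 + c * s) * (0 + c * s) powr (p - 1) / exp (0 + c * s)) =
      ennreal (c powr p) * ennreal (indicator {0<..} s * (s powr (p - 1) * exp (- s * c)))"
      using assms by (simp flip: ennreal_mult')
  qed simp
  also have "\<dots> = ennreal (c powr p) * (\<integral>\<^sup>+s. ennreal (indicator {0<..} s * (s powr (p - 1) * exp (- s * c))) \<partial>lborel)"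
    by (rule nn_integral_cmult) simp
  finally have *: "ennreal (Gamma p) = \<dots>" .
  have "ennreal (Gamma p * c powr - p) = ennreal (c powr - p) * ennreal (Gamma p)"
    using assms by (subst ennreal_mult'[symmetric]) (auto simp: mult_ac)
  also have "\<dots> = ennreal (c powr - p * c powr p) * (\<integral>\<^sup>+s. ennreal (indicator {0<..} s * (s powr (p - 1) * exp (- s * c))) \<partial>lborel)"
    unfolding * by (subst ennreal_mult) (auto simp: mult_ac)
  also have "c powr - p * c powr p = 1" using assms by (simp flip: powr_add)
  finally show ?thesis by simp
qed

lemma nn_integral_powr_from_0:
  fixes b v :: real
  assumes "0 < b" "0 < v"
  shows "(\<integral>\<^sup>+s. ennreal (indicator {0<..v} s * s powr (b - 1)) \<partial>lborel) = ennreal (v powr b / b)"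
proof -
  have "((\<lambda>s. s powr (b - 1)) has_integral (v powr b / b)) {0..v}"
    using has_integral_powr_from_0[of "b - 1" v] assms by simp
  then have "(\<integral>\<^sup>+s. ennreal (indicator {0..v} s * s powr (b - 1)) \<partial>lborel) = ennreal (v powr b / b)"
    by (intro nn_integral_has_integral_lebesgue) auto
  also have "(\<integral>\<^sup>+s. ennreal (indicator {0..v} s * s powr (b - 1)) \<partial>lborel) =
     (\<integral>\<^sup>+s. ennreal (indicator {0<..v} s * s powr (b - 1)) \<partial>lborel)"
    by (intro nn_integral_cong) (auto simp: indicator_def)
  finally show ?thesis by simp
qed

text \<open>
  Writing \<open>1 - exp (- a / s)\<close> as the integral of \<open>a exp (- a v)\<close> over \<open>0 \<le> v \<le> 1 / s\<close> and exchanging the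
  integrals leaves a Gamma integral.
\<close>

lemma nn_integral_powr_one_minus_exp:
  fixes a b :: real
  assumes a: "0 < a" and b: "0 < b" "b < 1"
  shows "(\<integral>\<^sup>+s. ennreal (indicator {0<..} s * (s powr (b - 1) * (1 - exp (- a / s)))) \<partial>lborel)
         = ennreal (Gamma (1 - b) / b * a powr b)"
proof -
  let ?f = "\<lambda>s v::real. ennreal (indicator {(s, v). 0 < s \<and> 0 < v \<and> s * v \<le> 1} (s, v) * (s powr (b - 1) * (a * exp (- v * a))))"
  have e: "(\<integral>\<^sup>+v. ennreal (indicator {0<..} v * (v powr ((1 - b) - 1) * exp (- v * a))) \<partial>lborel)
      = ennreal (Gamma (1 - b) * a powr - (1 - b))"
    using a b by (intro nn_integral_Gamma_scaled) auto
  have m[measurable]: "(\<lambda>(s, v). ?f s v) \<in> borel_measurable (borel \<Otimes>\<^sub>M borel)"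
    by measurable
  have "(\<integral>\<^sup>+s. ennreal (indicator {0<..} s * (s powr (b - 1) * (1 - exp (- a / s)))) \<partial>lborel) = (\<integral>\<^sup>+s. \<integral>\<^sup>+v. ?f s v \<partial>lborel \<partial>lborel)"
  proof (intro nn_integral_cong)
    fix s :: real
    show "ennreal (indicator {0<..} s * (s powr (b - 1) * (1 - exp (- a / s)))) = (\<integral>\<^sup>+v. ?f s v \<partial>lborel)"
    proof (cases "0 < s")
      case True
      have "(\<integral>\<^sup>+v. ennreal (a * exp (- v * a)) * indicator {0..1/s} v \<partial>lborel) = ennreal (- exp (- (1/s) * a) - (- exp (- 0 * a)))"
        using True a
        by (intro nn_integral_FTC_Icc) (auto intro!: derivative_eq_intros simp flip: has_real_derivative_iff_has_vector_derivative)
      then have e: "(\<integral>\<^sup>+v. ennreal (a * exp (- v * a)) * indicator {0..1/s} v \<partial>lborel) = ennreal (1 - exp (- a / s))" by simp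
      have "(\<integral>\<^sup>+v. ?f s v \<partial>lborel) = (\<integral>\<^sup>+v. ennreal (s powr (b - 1)) * (ennreal (a * exp (- v * a)) * indicator {0..1/s} v) \<partial>lborel)"
      proof (intro nn_integral_cong_AE, use AE_lborel_singleton[of "0::real"] in eventually_elim)
        fix v :: real assume "v \<noteq> 0"
        then show "?f s v = ennreal (s powr (b - 1)) * (ennreal (a * exp (- v * a)) * indicator {0..1/s} v)"
          using True a by (auto simp: indicator_def field_simps simp flip: ennreal_mult')
      qed
      also have "\<dots> = ennreal (s powr (b - 1)) * ennreal (1 - exp (- a / s))"
        unfolding e[symmetric] by (rule nn_integral_cmult) measurable
      finally show ?thesis using True a by (simp flip: ennreal_mult')
    qed auto
  qed
  also have "\<dots> = (\<integral>\<^sup>+v. \<integral>\<^sup>+s. ?f s v \<partial>lborel \<partial>lborel)"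
    by (rule lborel_pair.Fubini') simp
  also have "\<dots> = (\<integral>\<^sup>+v. ennreal (a / b) * ennreal (indicator {0<..} v * (v powr ((1 - b) - 1) * exp (- v * a))) \<partial>lborel)"
  proof (intro nn_integral_cong)
    fix v :: real
    show "(\<integral>\<^sup>+s. ?f s v \<partial>lborel) = ennreal (a / b) * ennreal (indicator {0<..} v * (v powr ((1 - b) - 1) * exp (- v * a)))"
    proof (cases "0 < v")
      case True
      have "(\<integral>\<^sup>+s. ?f s v \<partial>lborel) = (\<integral>\<^sup>+s. ennreal (a * exp (- v * a)) * ennreal (indicator {0<..1/v} s * s powr (b - 1)) \<partial>lborel)"
        using True a by (intro nn_integral_cong) (auto simp: indicator_def field_simps simp flip: ennreal_mult')
      also have "\<dots> = ennreal (a * exp (- v * a)) * ennreal ((1/v) powr b / b)"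
        using True b by (subst nn_integral_cmult) (auto simp: nn_integral_powr_from_0)
      finally show ?thesis using True a b
        by (simp add: powr_divide powr_minus field_simps flip: ennreal_mult')
    qed auto
  qed
  also have "\<dots> = ennreal (a / b) * ennreal (Gamma (1 - b) * a powr - (1 - b))"
    using e by (simp add: nn_integral_cmult)
  also have "\<dots> = ennreal (Gamma (1 - b) / b * (a * a powr (b - 1)))"
    using a b by (simp flip: ennreal_mult' add: mult_ac)
  also have "a * a powr (b - 1) = a powr b" using a by (simp add: powr_diff)
  finally show ?thesis .
qed

definition levy_measure :: "real \<Rightarrow> 'a::euclidean_space measure" where
  "levy_measure \<alpha> = density lborel
     (\<lambda>z. ennreal (riesz_const DIM('a) (- \<alpha>) / norm z powr (real DIM('a) + \<alpha>)))"

lemma sets_levy_measure[simp, measurable_cong]: "sets (levy_measure \<alpha>) = sets borel"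
  by (simp add: levy_measure_def)

lemma riesz_const_nonneg: "0 < \<alpha> \<Longrightarrow> 0 \<le> riesz_const d (- \<alpha>)"
  by (auto simp: riesz_const_def intro!: divide_nonneg_nonneg mult_nonneg_nonneg Gamma_real_nonneg)

text \<open>
  The constants in front of the integrals in the proof of \<open>levy_symbol\<close> cancel against the Riesz constant,
  because \<open>\<bar>\<Gamma>(-\<alpha>/2)\<bar> = \<Gamma>(1 - \<alpha>/2) / (\<alpha>/2)\<close>.
\<close>

lemma riesz_const_levy:
  assumes "0 < \<alpha>" "\<alpha> < 2" "0 < d"
  shows "riesz_const d (- \<alpha>) * (pi powr (real d / 2) / Gamma ((real d + \<alpha>) / 2)) * (Gamma (1 - \<alpha> / 2) / (\<alpha> / 2)) = 2 powr \<alpha>"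
proof -
  have "Gamma (- (\<alpha> / 2) + 1) = - (\<alpha> / 2) * Gamma (- (\<alpha> / 2))"
  proof (rule Gamma_plus1, rule notI)
    assume "- (\<alpha> / 2) \<in> \<int>\<^sub>\<le>\<^sub>0"
    then obtain n where n: "- (\<alpha> / 2) = of_int n" by (auto elim!: nonpos_Ints_cases)
    with assms have "of_int n < (0::real)" "of_int (-1) < (of_int n :: real)" by linarith+
    then show False unfolding of_int_less_iff of_int_less_0_iff by linarith
  qed
  moreover have "0 < Gamma (1 - \<alpha> / 2)" using assms by (intro Gamma_real_pos) auto
  moreover have "0 < Gamma ((real d + \<alpha>) / 2)" using assms by (intro Gamma_real_pos) auto
  moreover have "Gamma (1 - \<alpha> / 2) / (\<alpha> / 2) = \<bar>Gamma (- \<alpha> / 2)\<bar>"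
  proof -
    have "\<bar>Gamma (1 - \<alpha> / 2)\<bar> = \<bar>\<alpha> / 2\<bar> * \<bar>Gamma (- \<alpha> / 2)\<bar>"
      using calculation(1) by (simp add: abs_mult)
    with calculation(2) assms show ?thesis by (simp add: field_simps)
  qed
  moreover from this calculation(2) assms have "\<bar>Gamma (- \<alpha> / 2)\<bar> > 0" by (metis divide_pos_pos zero_less_divide_iff zero_less_numeral)
  ultimately show ?thesis
    by (simp add: riesz_const_def powr_minus field_simps)
qed

lemma sqrt_power_eq_powr:
  assumes "0 < (x::real)"
  shows "sqrt x ^ n = x powr (real n / 2)"
proof -
  have "sqrt x ^ n = sqrt x powr real n" using assms by (simp add: powr_realpow)
  also have "\<dots> = (x powr (1/2)) powr real n" using assms by (simp only: powr_half_sqrt)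
  finally show ?thesis by (simp add: powr_powr)
qed

text \<open>
  This is what fixes the Riesz constant. Subordination avoids any use of rotation invariance: \<open>|z|\<^bsup>-d-\<alpha>\<^esup>\<close> is a
  mixture of the Gaussians \<open>exp (- s |z|\<^sup>2)\<close>, and for each of them the integral of \<open>1 - cos (\<xi> \<bullet> z)\<close> is explicit.
  What remains is a one-dimensional integral in \<open>s\<close>.
\<close>

theorem levy_symbol:
  fixes \<xi> :: "'a::euclidean_space"
  assumes \<alpha>: "0 < \<alpha>" "\<alpha> < 2"
  shows "(\<integral>\<^sup>+z. ennreal (1 - cos (\<xi> \<bullet> z)) \<partial>levy_measure \<alpha>) = ennreal (norm \<xi> powr \<alpha>)"
proof (cases "\<xi> = 0")
  case True then show ?thesis by simp
next
  case False
  let ?d = "DIM('a)"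
  define p where "p = (real ?d + \<alpha>) / 2"
  define A where "A = riesz_const ?d (- \<alpha>)"
  have p: "0 < p" using \<alpha> by (auto simp: p_def)
  have A: "0 \<le> A" using \<alpha> by (simp add: A_def riesz_const_nonneg)
  have e: "(\<integral>\<^sup>+s. ennreal (indicator {0<..} s * (s powr (\<alpha>/2 - 1) * (1 - exp (- ((norm \<xi>)\<^sup>2 / 4) / s)))) \<partial>lborel)
      = ennreal (Gamma (1 - \<alpha> / 2) / (\<alpha> / 2) * ((norm \<xi>)\<^sup>2 / 4) powr (\<alpha> / 2))"
    using False \<alpha> by (intro nn_integral_powr_one_minus_exp) auto
  have Gp: "0 < Gamma p" using p by (rule Gamma_real_pos)
  let ?g = "\<lambda>z s. ennreal ((1 - cos (\<xi> \<bullet> z)) * (indicator {0<..} s * (s powr (p - 1) * exp (- s * (norm z)\<^sup>2))))"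
  have "(\<integral>\<^sup>+z. ennreal (1 - cos (\<xi> \<bullet> z)) \<partial>levy_measure \<alpha>) =
        (\<integral>\<^sup>+z. ennreal (A / norm z powr (real ?d + \<alpha>)) * ennreal (1 - cos (\<xi> \<bullet> z)) \<partial>lborel)"
    unfolding levy_measure_def A_def by (subst nn_integral_density) auto
  also have "\<dots> = (\<integral>\<^sup>+z. ennreal (A / Gamma p) * (\<integral>\<^sup>+s. ?g z s \<partial>lborel) \<partial>lborel)"
  proof (intro nn_integral_cong_AE, use AE_lborel_singleton[of "0::'a"] in eventually_elim)
    fix z :: 'a assume z: "z \<noteq> 0"
    have "(\<integral>\<^sup>+s. ?g z s \<partial>lborel) = ennreal (1 - cos (\<xi> \<bullet> z)) *
       (\<integral>\<^sup>+s. ennreal (indicator {0<..} s * (s powr (p - 1) * exp (- s * (norm z)\<^sup>2))) \<partial>lborel)"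
      by (subst nn_integral_cmult[symmetric]) (auto simp: ennreal_mult')
    also have "\<dots> = ennreal ((1 - cos (\<xi> \<bullet> z)) * (Gamma p * ((norm z)\<^sup>2) powr - p))"
      using z p by (subst nn_integral_Gamma_scaled) (auto simp: ennreal_mult' simp del: powr_minus)
    also have "((norm z)\<^sup>2) powr - p = 1 / norm z powr (real ?d + \<alpha>)"
    proof -
      have "((norm z)\<^sup>2) powr - p = norm z powr (2 * - p)"
        using z by (simp only: powr_powr[symmetric]) simp
      also have "2 * - p = - (real ?d + \<alpha>)" by (simp add: p_def field_simps)
      finally show ?thesis by (simp only: powr_minus_divide)
    qed
    finally show "ennreal (A / norm z powr (real ?d + \<alpha>)) * ennreal (1 - cos (\<xi> \<bullet> z)) = ennreal (A / Gamma p) * (\<integral>\<^sup>+s. ?g z s \<partial>lborel)"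
      using A Gp by (simp add: mult_ac flip: ennreal_mult')
  qed
  also have "\<dots> = ennreal (A / Gamma p) * (\<integral>\<^sup>+z. \<integral>\<^sup>+s. ?g z s \<partial>lborel \<partial>lborel)"
    by (intro nn_integral_cmult) measurable
  also have "(\<integral>\<^sup>+z. \<integral>\<^sup>+s. ?g z s \<partial>lborel \<partial>lborel) = (\<integral>\<^sup>+s. \<integral>\<^sup>+z. ?g z s \<partial>lborel \<partial>lborel)"
    by (rule lborel_pair.Fubini') measurable
  also have "\<dots> = (\<integral>\<^sup>+s. ennreal (pi powr (real ?d / 2)) * ennreal (indicator {0<..} s * (s powr (\<alpha>/2 - 1) * (1 - exp (- ((norm \<xi>)\<^sup>2 / 4) / s)))) \<partial>lborel)"
  proof (intro nn_integral_cong)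
    fix s :: real
    show "(\<integral>\<^sup>+z. ?g z s \<partial>lborel) = ennreal (pi powr (real ?d / 2)) * ennreal (indicator {0<..} s * (s powr (\<alpha>/2 - 1) * (1 - exp (- ((norm \<xi>)\<^sup>2 / 4) / s))))"
    proof (cases "0 < s")
      case True
      have eq: "(1 - cos (\<xi> \<bullet> z)) * exp (- s * (norm z)\<^sup>2) = exp (- s * (norm z)\<^sup>2) - cos (\<xi> \<bullet> z) * exp (- s * (norm z)\<^sup>2)" for z
        by (simp add: algebra_simps)
      have i: "integrable lborel (\<lambda>z. (1 - cos (\<xi> \<bullet> z)) * exp (- s * (norm z)\<^sup>2))"
        unfolding eq using gaussian_fourier[OF True, of \<xi>] gaussian_integral[OF True] by auto
      have "(\<integral>\<^sup>+z. ?g z s \<partial>lborel) = ennreal (s powr (p - 1)) * (\<integral>\<^sup>+z. ennreal ((1 - cos (\<xi> \<bullet> z)) * exp (- s * (norm z)\<^sup>2)) \<partial>lborel)"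
        using True by (subst nn_integral_cmult[symmetric]) (auto simp: mult_ac simp flip: ennreal_mult')
      also have "(\<integral>\<^sup>+z. ennreal ((1 - cos (\<xi> \<bullet> z)) * exp (- s * (norm z)\<^sup>2)) \<partial>lborel) = ennreal (\<integral>z. (1 - cos (\<xi> \<bullet> z)) * exp (- s * (norm z)\<^sup>2) \<partial>lborel)"
        by (intro nn_integral_eq_integral i) auto
      also have "(\<integral>z. (1 - cos (\<xi> \<bullet> z)) * exp (- s * (norm z)\<^sup>2) \<partial>lborel) = sqrt (pi / s) ^ ?d * (1 - exp (- (norm \<xi>)\<^sup>2 / (4 * s)))"
        unfolding eq using gaussian_fourier[OF True, of \<xi>] gaussian_integral[OF True, where 'a='a]
        by (simp add: algebra_simps)
      also have "sqrt (pi / s) ^ ?d = pi powr (real ?d / 2) * s powr - (real ?d / 2)"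
        using True by (simp add: sqrt_power_eq_powr powr_divide powr_minus_divide)
      also have "ennreal (s powr (p - 1)) * ennreal (pi powr (real ?d / 2) * s powr - (real ?d / 2) * (1 - exp (- (norm \<xi>)\<^sup>2 / (4 * s)))) =
        ennreal (pi powr (real ?d / 2) * ((s powr (p - 1) * s powr - (real ?d / 2)) * (1 - exp (- (norm \<xi>)\<^sup>2 / (4 * s)))))"
        by (simp flip: ennreal_mult' add: mult_ac)
      also have "s powr (p - 1) * s powr - (real ?d / 2) = s powr (\<alpha> / 2 - 1)"
        unfolding powr_add[symmetric] by (simp add: p_def add_divide_distrib)
      finally show ?thesis using True by (simp flip: ennreal_mult')
    qed auto
  qed
  also have "\<dots> = ennreal (pi powr (real ?d / 2)) * ennreal (Gamma (1 - \<alpha> / 2) / (\<alpha> / 2) * ((norm \<xi>)\<^sup>2 / 4) powr (\<alpha> / 2))"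
    unfolding e[symmetric] by (rule nn_integral_cmult) measurable
  also have "((norm \<xi>)\<^sup>2 / 4) powr (\<alpha> / 2) = norm \<xi> powr \<alpha> / 2 powr \<alpha>"
  proof -
    have "(norm \<xi>)\<^sup>2 / 4 = (norm \<xi> / 2)\<^sup>2" by (simp add: power2_eq_square)
    then show ?thesis using False by (simp add: powr_powr powr_divide flip: powr_numeral)
  qed
  also have "ennreal (A / Gamma p) * (ennreal (pi powr (real ?d / 2)) * ennreal (Gamma (1 - \<alpha> / 2) / (\<alpha> / 2) * (norm \<xi> powr \<alpha> / 2 powr \<alpha>))) =
     ennreal ((A * (pi powr (real ?d / 2) / Gamma p) * (Gamma (1 - \<alpha> / 2) / (\<alpha> / 2))) * (norm \<xi> powr \<alpha> / 2 powr \<alpha>))"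
    using A Gp by (simp flip: ennreal_mult' add: mult_ac)
  also have "A * (pi powr (real ?d / 2) / Gamma p) * (Gamma (1 - \<alpha> / 2) / (\<alpha> / 2)) = 2 powr \<alpha>"
    unfolding A_def p_def using \<alpha> by (intro riesz_const_levy) auto
  finally show ?thesis by simp
qed

section \<open>Autocorrelations\<close>

lemma lborel_integral_translate:
  fixes f :: "'a::euclidean_space \<Rightarrow> 'b::{banach, second_countable_topology}"
  assumes "f \<in> borel_measurable borel"
  shows "(\<integral>x. f (x + z) \<partial>lborel) = (\<integral>x. f x \<partial>lborel)"
proof -
  have "(\<integral>x. f x \<partial>lborel) = (\<integral>x. f x \<partial>distr lborel borel ((+) z))"
    by (simp add: lborel_distr_plus)
  also have "\<dots> = (\<integral>x. f (z + x) \<partial>lborel)"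
    using assms by (intro integral_distr) auto
  finally show ?thesis by (simp add: add.commute)
qed

lemma lborel_integrable_translate:
  fixes f :: "'a::euclidean_space \<Rightarrow> 'b::{banach, second_countable_topology}"
  assumes "integrable lborel f"
  shows "integrable lborel (\<lambda>x. f (x + z))"
proof -
  have "integrable (distr lborel borel ((+) z)) f"
    using assms by (simp add: lborel_distr_plus)
  then have "integrable lborel (\<lambda>x. f (z + x))"
    using assms by (subst (asm) integrable_distr_eq) auto
  then show ?thesis by (simp add: add.commute)
qed

lemma lborel_nn_integral_translate:
  fixes f :: "'a::euclidean_space \<Rightarrow> ennreal"
  assumes "f \<in> borel_measurable borel"
  shows "(\<integral>\<^sup>+x. f (x + z) \<partial>lborel) = (\<integral>\<^sup>+x. f x \<partial>lborel)"
proof -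
  have "(\<integral>\<^sup>+x. f x \<partial>lborel) = (\<integral>\<^sup>+x. f x \<partial>distr lborel borel ((+) z))"
    by (simp add: lborel_distr_plus)
  also have "\<dots> = (\<integral>\<^sup>+x. f (z + x) \<partial>lborel)"
    using assms by (intro nn_integral_distr) auto
  finally show ?thesis by (simp add: add.commute)
qed

lemma lborel_integral_scale:
  fixes f :: "'a::euclidean_space \<Rightarrow> real"
  assumes f: "f \<in> borel_measurable borel" and c: "0 < c"
  shows "(\<integral>x. f x \<partial>lborel) = c ^ DIM('a) * (\<integral>x. f (c *\<^sub>R x) \<partial>lborel)"
proof -
  have "(\<integral>x. f x \<partial>lborel) = (\<integral>x. f x \<partial>density (distr lborel borel (\<lambda>x::'a. 0 + c *\<^sub>R x)) (\<lambda>_. ennreal (\<bar>c\<bar> ^ DIM('a))))"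
    using lborel_affine[of c "0::'a"] c by (metis ennreal_power abs_ge_zero less_irrefl)
  also have "\<dots> = c ^ DIM('a) * (\<integral>x. f (c *\<^sub>R x) \<partial>lborel)"
    using f c by (subst integral_density) (auto simp: integral_distr)
  finally show ?thesis .
qed

text \<open>
  The class of test functions. Discontinuous functions have to be allowed, because eigenfunctions are cut off by the
  indicators of \<open>D\<close> and of its compact subsets.
\<close>

definition bounded_support_fun :: "('a::euclidean_space \<Rightarrow> real) \<Rightarrow> bool" where
  "bounded_support_fun u \<longleftrightarrow>
     u \<in> borel_measurable borel \<and> (\<exists>B. \<forall>x. \<bar>u x\<bar> \<le> B) \<and> (\<exists>r. \<forall>x. u x \<noteq> 0 \<longrightarrow> norm x \<le> r)"

lemma bounded_support_fun_measurable[measurable_dest]: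
  "bounded_support_fun u \<Longrightarrow> u \<in> borel_measurable borel"
  by (simp add: bounded_support_fun_def)

lemma bounded_support_funE:
  assumes "bounded_support_fun u"
  obtains B r where "0 \<le> B" "\<And>x. \<bar>u x\<bar> \<le> B" "0 \<le> r" "\<And>x. r < norm x \<Longrightarrow> u x = 0"
proof -
  obtain B r where B: "\<And>x. \<bar>u x\<bar> \<le> B" and r: "\<And>x. u x \<noteq> 0 \<Longrightarrow> norm x \<le> r"
    using assms by (auto simp: bounded_support_fun_def)
  show ?thesis
  proof (rule that[of B "max 0 r"])
    show "0 \<le> B" using B[of undefined] by linarith
    show "u x = 0" if "max 0 r < norm x" for x using r[of x] that by force
  qed (use B in auto)
qed

lemma bounded_support_fun_integrable:
  fixes u :: "'a::euclidean_space \<Rightarrow> real"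
  assumes "bounded_support_fun u"
  shows "integrable lborel u"
proof -
  obtain B r where *: "0 \<le> B" "\<And>x. \<bar>u x\<bar> \<le> B" "0 \<le> r" "\<And>x. r < norm x \<Longrightarrow> u x = 0"
    using bounded_support_funE[OF assms] by blast
  show ?thesis
    using * assms emeasure_lborel_cball_finite[of "0::'a" r]
    by (intro integrableI_bounded_set[of "cball 0 r" _ _ B]) (auto simp: not_le)
qed

lemma bounded_support_fun_mult_bounded:
  assumes u: "bounded_support_fun u" and v: "v \<in> borel_measurable borel" "\<And>x. u x \<noteq> 0 \<Longrightarrow> \<bar>v x\<bar> \<le> C"
  shows "bounded_support_fun (\<lambda>x. u x * v x)"
proof -
  obtain B r where *: "0 \<le> B" "\<And>x. \<bar>u x\<bar> \<le> B" "0 \<le> r" "\<And>x. r < norm x \<Longrightarrow> u x = 0"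
    using bounded_support_funE[OF u] by blast
  have "\<bar>u x * v x\<bar> \<le> B * \<bar>C\<bar>" for x
  proof (cases "u x = 0")
    case False
    with v(2)[of x] show ?thesis unfolding abs_mult by (intro mult_mono) (use * in auto)
  qed (use * in auto)
  moreover have "u x * v x \<noteq> 0 \<longrightarrow> norm x \<le> r" for x using *(4)[of x] by (cases "norm x \<le> r") auto
  ultimately show ?thesis using u v by (auto simp: bounded_support_fun_def)
qed

lemma bounded_support_fun_mult:
  assumes "bounded_support_fun u" "bounded_support_fun v"
  shows "bounded_support_fun (\<lambda>x. u x * v x)"
proof -
  obtain C where "\<And>x. \<bar>v x\<bar> \<le> C" using bounded_support_funE[OF assms(2)] by blast
  with assms show ?thesis by (intro bounded_support_fun_mult_bounded[of u v C]) auto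
qed

lemma bounded_support_fun_add:
  assumes u: "bounded_support_fun u" and v: "bounded_support_fun v"
  shows "bounded_support_fun (\<lambda>x. u x + v x)"
proof -
  obtain B r where *: "0 \<le> B" "\<And>x. \<bar>u x\<bar> \<le> B" "0 \<le> r" "\<And>x. r < norm x \<Longrightarrow> u x = 0"
    using bounded_support_funE[OF u] by blast
  obtain C s where **: "0 \<le> C" "\<And>x. \<bar>v x\<bar> \<le> C" "0 \<le> s" "\<And>x. s < norm x \<Longrightarrow> v x = 0"
    using bounded_support_funE[OF v] by blast
  have "\<bar>u x + v x\<bar> \<le> B + C" for x using *(2)[of x] **(2)[of x] by linarith
  moreover have "u x + v x \<noteq> 0 \<longrightarrow> norm x \<le> max r s" for x using *(4)[of x] **(4)[of x] by force
  ultimately show ?thesis using u v unfolding bounded_support_fun_def by (intro conjI) (auto intro!: exI)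
qed

lemma bounded_support_fun_minus:
  "bounded_support_fun u \<Longrightarrow> bounded_support_fun (\<lambda>x. - u x)"
  by (auto simp: bounded_support_fun_def)

lemma bounded_support_fun_diff:
  assumes u: "bounded_support_fun u" and v: "bounded_support_fun v"
  shows "bounded_support_fun (\<lambda>x. u x - v x)"
  using bounded_support_fun_add[OF u bounded_support_fun_minus[OF v]] by simp

lemma bounded_support_fun_translate:
  assumes u: "bounded_support_fun u"
  shows "bounded_support_fun (\<lambda>x. u (x + z))"
proof -
  obtain B r where *: "0 \<le> B" "\<And>x. \<bar>u x\<bar> \<le> B" "0 \<le> r" "\<And>x. r < norm x \<Longrightarrow> u x = 0"
    using bounded_support_funE[OF u] by blast
  have "u (x + z) \<noteq> 0 \<longrightarrow> norm x \<le> r + norm z" for x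
    using *(4)[of "x + z"] norm_triangle_ineq4[of "x + z" z] by (cases "norm (x + z) \<le> r") auto
  with * u show ?thesis by (auto simp: bounded_support_fun_def)
qed

lemma bounded_support_fun_pair:
  assumes u: "bounded_support_fun (u :: 'a::euclidean_space \<Rightarrow> real)" and v: "bounded_support_fun (v :: 'a \<Rightarrow> real)"
  shows "bounded_support_fun (\<lambda>(x, w). u x * v (x + w))"
proof -
  obtain B r where *: "0 \<le> B" "\<And>x. \<bar>u x\<bar> \<le> B" "0 \<le> r" "\<And>x. r < norm x \<Longrightarrow> u x = 0"
    using bounded_support_funE[OF u] by blast
  obtain C s where **: "0 \<le> C" "\<And>x. \<bar>v x\<bar> \<le> C" "0 \<le> s" "\<And>x. s < norm x \<Longrightarrow> v x = 0"
    using bounded_support_funE[OF v] by blast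
  note [measurable] = u[THEN bounded_support_fun_measurable] v[THEN bounded_support_fun_measurable]
  have "\<bar>u x * v (x + w)\<bar> \<le> B * C" for x w
    unfolding abs_mult by (intro mult_mono) (use * ** in auto)
  moreover have "norm (x, w) \<le> r + (r + s)" if "u x * v (x + w) \<noteq> 0" for x w
  proof -
    have "norm x \<le> r" "norm (x + w) \<le> s" using that *(4)[of x] **(4)[of "x + w"] by force+
    moreover have "norm (x, w) \<le> norm x + norm w" by (rule norm_Pair_le)
    moreover have "norm w \<le> norm (x + w) + norm x" using norm_triangle_ineq4[of "x + w" x] by simp
    ultimately show ?thesis by linarith
  qed
  moreover have "(\<lambda>(x, w). u x * v (x + w)) \<in> borel_measurable borel"
    unfolding borel_prod[symmetric] by measurable
  ultimately show ?thesis unfolding bounded_support_fun_def by auto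
qed

text \<open>
  A positive definite function of \<open>z\<close>, hence a Fourier transform by Bochner's theorem.
\<close>

definition autocorr :: "('a::euclidean_space \<Rightarrow> real) \<Rightarrow> 'a \<Rightarrow> real" where
  "autocorr u z = (\<integral>x. u x * u (x + z) \<partial>lborel)"

lemma autocorr_minus:
  assumes "bounded_support_fun u"
  shows "autocorr u (- z) = autocorr u z"
proof -
  note [measurable] = assms[THEN bounded_support_fun_measurable]
  have "autocorr u (- z) = (\<integral>x. u (x + z) * u (x + z - z) \<partial>lborel)"
    unfolding autocorr_def using lborel_integral_translate[of "\<lambda>x. u x * u (x - z)" z] by simp
  then show ?thesis by (simp add: autocorr_def mult.commute[of "u _" "u (_ + z)"])
qed

text \<open>
  A measurable function is almost everywhere a limit of continuous ones. Clamping these and cutting them off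
  outside a ball makes the convergence dominated.
\<close>

lemma bounded_continuous_L1_approx:
  fixes u :: "'a::euclidean_space \<Rightarrow> real"
  assumes u: "bounded_support_fun u" and e: "0 < e"
  obtains g C where "continuous_on UNIV g" "\<And>x. \<bar>g x\<bar> \<le> C" "integrable lborel g" "(\<integral>x. \<bar>u x - g x\<bar> \<partial>lborel) < e"
proof -
  obtain B r where *: "0 \<le> B" "\<And>x. \<bar>u x\<bar> \<le> B" "0 \<le> r" "\<And>x. r < norm x \<Longrightarrow> u x = 0"
    using bounded_support_funE[OF u] by blast
  have "u \<in> borel_measurable lebesgue" using u by (auto intro: measurable_completion)
  then have "u measurable_on UNIV"
    by (intro lebesgue_measurable_imp_measurable_on) auto
  then obtain N g where N: "negligible N" and g: "\<And>n. continuous_on UNIV (g n)"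
    and lim: "\<And>x. x \<notin> N \<Longrightarrow> (\<lambda>n::nat. g n x) \<longlonglongrightarrow> u x"
    by (auto simp: measurable_on_def)
  \<comment> \<open>the cut-off is \<open>1\<close> on a ball containing the support of \<open>u\<close> and \<open>0\<close> off a larger ball\<close>
  define h where "h n x = max 0 (min 1 (r + 1 - norm x)) * max (- B) (min B (g n x))" for n x
  have hc: "continuous_on UNIV (h n)" for n
    unfolding h_def using g[of n] by (intro continuous_intros) auto
  have hB: "\<bar>h n x\<bar> \<le> B" for n x
  proof -
    have "\<bar>max 0 (min 1 (r + 1 - norm x))\<bar> * \<bar>max (- B) (min B (g n x))\<bar> \<le> 1 * B"
      by (intro mult_mono) (use * in auto)
    then show ?thesis by (simp add: h_def abs_mult)
  qed
  have h0: "h n x = 0" if "r + 1 < norm x" for n x using that by (simp add: h_def)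
  have hm[measurable]: "h n \<in> borel_measurable borel" for n
    using hc by (rule borel_measurable_continuous_onI)
  have bs: "bounded_support_fun (h n)" for n
    unfolding bounded_support_fun_def
    by (intro conjI exI[of _ B] exI[of _ "r + 1"] allI hm hB) (metis h0 not_le)
  note [measurable] = u[THEN bounded_support_fun_measurable]
  have "(\<lambda>n. \<integral>x. \<bar>u x - h n x\<bar> \<partial>lborel) \<longlonglongrightarrow> (\<integral>x. 0 \<partial>(lborel :: 'a measure))"
  proof (rule integral_dominated_convergence[where w="\<lambda>x. 2 * B * indicator (cball 0 (r + 1)) x"])
    show "integrable lborel (\<lambda>x::'a. 2 * B * indicator (cball 0 (r + 1)) x :: real)"
      using emeasure_lborel_cball_finite[of "0::'a" "r + 1"] by (intro integrable_mult_right integrable_real_indicator) auto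
    show "AE x in lborel. norm \<bar>u x - h n x\<bar> \<le> 2 * B * indicator (cball 0 (r + 1)) x" for n
    proof (intro AE_I2)
      fix x :: 'a
      show "norm \<bar>u x - h n x\<bar> \<le> 2 * B * indicator (cball 0 (r + 1)) x"
        using *(2)[of x] hB[of n x] h0[of x n] *(4)[of x] by (cases "norm x \<le> r + 1") auto
    qed
    have "AE x in lebesgue. x \<notin> N"
      using N by (intro AE_not_in) (simp add: negligible_iff_null_sets)
    then have "AE x in lborel. x \<notin> N" by (simp only: AE_completion_iff)
    then show "AE x in lborel. (\<lambda>n. \<bar>u x - h n x\<bar>) \<longlonglongrightarrow> 0"
    proof eventually_elim
      fix x assume "x \<notin> N"
      have "(\<lambda>n. \<bar>u x - h n x\<bar>) \<longlonglongrightarrow> \<bar>u x - max 0 (min 1 (r + 1 - norm x)) * max (- B) (min B (u x))\<bar>"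
        unfolding h_def using lim[OF \<open>x \<notin> N\<close>] by (intro tendsto_intros)
      also have "u x - max 0 (min 1 (r + 1 - norm x)) * max (- B) (min B (u x)) = 0"
        using *(2)[of x] *(4)[of x] by (cases "norm x \<le> r") (auto simp: max_def min_def)
      finally show "(\<lambda>n. \<bar>u x - h n x\<bar>) \<longlonglongrightarrow> 0" by simp
    qed
  qed measurable
  then have "eventually (\<lambda>n. (\<integral>x. \<bar>u x - h n x\<bar> \<partial>lborel) < e) sequentially"
    using e by (intro order_tendstoD) auto
  then obtain n where "(\<integral>x. \<bar>u x - h n x\<bar> \<partial>lborel) < e" by (auto simp: eventually_sequentially)
  with hc hB bs show ?thesis by (intro that[of "h n" B]) (auto intro: bounded_support_fun_integrable)
qed

text \<open>
  Translating a bounded continuous \<open>g\<close> is continuous under the integral against \<open>u\<close>, and replacing one factor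
  \<open>u\<close> by a continuous \<open>L\<^sup>1\<close> approximation changes the correlation uniformly little.
\<close>

lemma continuous_autocorr:
  fixes u :: "'a::euclidean_space \<Rightarrow> real"
  assumes u: "bounded_support_fun u"
  shows "continuous_on UNIV (autocorr u)"
proof -
  obtain B r where *: "0 \<le> B" "\<And>x. \<bar>u x\<bar> \<le> B" "0 \<le> r" "\<And>x. r < norm x \<Longrightarrow> u x = 0"
    using bounded_support_funE[OF u] by blast
  note [measurable] = u[THEN bounded_support_fun_measurable]
  note iu = bounded_support_fun_integrable[OF u]
  have "\<exists>g. continuous_on UNIV g \<and> (\<exists>C. \<forall>x. \<bar>g x\<bar> \<le> C) \<and> integrable lborel g \<and> (\<integral>x. \<bar>u x - g x\<bar> \<partial>lborel) < 1 / real (Suc n)" for n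
    by (rule bounded_continuous_L1_approx[OF u, of "1 / real (Suc n)"]) (simp, blast)
  then obtain g where g: "\<And>n. continuous_on UNIV (g n)" "\<And>n. \<exists>C. \<forall>x. \<bar>g n x\<bar> \<le> C"
     "\<And>n. integrable lborel (g n)" "\<And>n::nat. (\<integral>x. \<bar>u x - g n x\<bar> \<partial>lborel) < 1 / real (Suc n)"
    by metis
  have gm[measurable]: "g n \<in> borel_measurable borel" for n
    using g(1) by (rule borel_measurable_continuous_onI)
  define R where "R n z = (\<integral>x. u x * g n (x + z) \<partial>lborel)" for n z
  have Rc: "continuous_on UNIV (R n)" for n
  proof -
    obtain C where C: "\<And>x. \<bar>g n x\<bar> \<le> C" using g(2) by blast
    show ?thesis
      unfolding continuous_on_eq_continuous_within
    proof (intro ballI, unfold R_def, rule continuous_within_sequentiallyI)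
      fix a :: 'a and X :: "nat \<Rightarrow> 'a" assume X: "X \<longlonglongrightarrow> a"
      show "(\<lambda>k. \<integral>x. u x * g n (x + X k) \<partial>lborel) \<longlonglongrightarrow> (\<integral>x. u x * g n (x + a) \<partial>lborel)"
      proof (rule integral_dominated_convergence[where w="\<lambda>x. \<bar>u x\<bar> * C"])
        show "AE x in lborel. (\<lambda>k. u x * g n (x + X k)) \<longlonglongrightarrow> u x * g n (x + a)"
          using g(1)[of n] X by (intro AE_I2 tendsto_intros continuous_on_tendsto_compose[of UNIV "g n"]) auto
        show "AE x in lborel. norm (u x * g n (x + X k)) \<le> \<bar>u x\<bar> * C" for k
          using C by (intro AE_I2) (auto simp: abs_mult intro: mult_left_mono)
      qed (use iu in auto)
    qed
  qed
  have "uniform_limit UNIV R (autocorr u) sequentially"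
  proof (rule uniform_limitI)
    fix e :: real assume "0 < e"
    obtain n0 where "inverse (real (Suc n0)) < e / (B + 1)"
      using reals_Archimedean[of "e / (B + 1)"] \<open>0 < e\<close> * by auto
    then have "(B + 1) * inverse (real (Suc n0)) < e" using * by (simp add: field_simps)
    moreover have "B * inverse (real (Suc n0)) \<le> (B + 1) * inverse (real (Suc n0))"
      by (intro mult_right_mono) auto
    ultimately have n0: "B / real (Suc n0) < e" unfolding divide_inverse by linarith
    show "\<forall>\<^sub>F n in sequentially. \<forall>z\<in>UNIV. dist (R n z) (autocorr u z) < e"
    proof (intro eventually_sequentiallyI[of n0] ballI)
      fix n z assume "n0 \<le> n"
      obtain C where C: "\<And>x. \<bar>g n x\<bar> \<le> C" using g(2) by blast
      have i1: "integrable lborel (\<lambda>x. u x * g n (x + z))"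
      proof (rule Bochner_Integration.integrable_bound[of _ "\<lambda>x. C * \<bar>u x\<bar>"])
        have "norm (u x * g n (x + z)) \<le> norm (C * \<bar>u x\<bar>)" for x
          using C[of "x + z"] by (simp add: abs_mult mult.commute[of "\<bar>u x\<bar>"] mult_right_mono order_trans[OF _ abs_ge_self])
        then show "AE x in lborel. norm (u x * g n (x + z)) \<le> norm (C * \<bar>u x\<bar>)" by simp
      qed (use iu in auto)
      have i2: "integrable lborel (\<lambda>x. u x * u (x + z))"
        by (intro bounded_support_fun_integrable bounded_support_fun_mult bounded_support_fun_translate u)
      have i3: "integrable lborel (\<lambda>x. \<bar>u (x + z) - g n (x + z)\<bar>)"
        using lborel_integrable_translate[of "\<lambda>x. \<bar>u x - g n x\<bar>" z] iu g(3)[of n] by auto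
      have "dist (R n z) (autocorr u z) = \<bar>\<integral>x. u x * (g n (x + z) - u (x + z)) \<partial>lborel\<bar>"
        unfolding R_def autocorr_def dist_real_def using i1 i2 by (simp add: right_diff_distrib)
      also have "\<dots> \<le> (\<integral>x. B * \<bar>u (x + z) - g n (x + z)\<bar> \<partial>lborel)"
      proof (rule order_trans[OF integral_abs_bound], rule integral_mono)
        show "integrable lborel (\<lambda>x. \<bar>u x * (g n (x + z) - u (x + z))\<bar>)"
          using i1 i2 by (intro integrable_abs) (simp add: right_diff_distrib)
        show "integrable lborel (\<lambda>x. B * \<bar>u (x + z) - g n (x + z)\<bar>)" using i3 by simp
        show "\<bar>u x * (g n (x + z) - u (x + z))\<bar> \<le> B * \<bar>u (x + z) - g n (x + z)\<bar>" for x
          unfolding abs_mult by (intro mult_mono) (use * in auto)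
      qed
      also have "\<dots> = B * (\<integral>x. \<bar>u x - g n x\<bar> \<partial>lborel)"
        by (simp add: lborel_integral_translate[of "\<lambda>x. \<bar>u x - g n x\<bar>" z])
      also have "\<dots> \<le> B * (1 / real (Suc n))"
        using g(4)[of n] * by (intro mult_left_mono) auto
      also have "\<dots> \<le> B / real (Suc n0)"
        using * \<open>n0 \<le> n\<close> by (auto intro!: divide_left_mono)
      finally show "dist (R n z) (autocorr u z) < e" using n0 by linarith
    qed
  qed
  then show ?thesis
    by (rule uniform_limit_theorem[rotated]) (use Rc in auto)
qed

text \<open>
  The inequality \<open>2|a b| \<le> a\<^sup>2 + b\<^sup>2\<close>, integrated.
\<close>

lemma autocorr_bounded:
  assumes u: "bounded_support_fun u"
  shows "\<bar>autocorr u z\<bar> \<le> autocorr u 0"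
proof -
  note [measurable] = u[THEN bounded_support_fun_measurable]
  have i: "integrable lborel (\<lambda>x. u (x + a) * u (x + b))" for a b
    by (intro bounded_support_fun_integrable bounded_support_fun_mult bounded_support_fun_translate u)
  have i0: "integrable lborel (\<lambda>x. u x * u x)" "integrable lborel (\<lambda>x. u x * u (x + z))"
     "integrable lborel (\<lambda>x. u (x + z) * u (x + z))"
    using i[of 0 0] i[of 0 z] i[of z z] by auto
  have "2 * \<bar>autocorr u z\<bar> \<le> (\<integral>x. u x * u x \<partial>lborel) + (\<integral>x. u (x + z) * u (x + z) \<partial>lborel)"
  proof (rule order_trans)
    have "2 * \<bar>autocorr u z\<bar> \<le> 2 * (\<integral>x. \<bar>u x * u (x + z)\<bar> \<partial>lborel)"
      by (simp add: autocorr_def)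
    also have "\<dots> = (\<integral>x. 2 * \<bar>u x * u (x + z)\<bar> \<partial>lborel)" by simp
    also have "\<dots> \<le> (\<integral>x. u x * u x + u (x + z) * u (x + z) \<partial>lborel)"
    proof (rule integral_mono)
      fix x
      show "2 * \<bar>u x * u (x + z)\<bar> \<le> u x * u x + u (x + z) * u (x + z)"
        using sum_squares_bound[of "\<bar>u x\<bar>" "\<bar>u (x + z)\<bar>"] by (simp add: abs_mult power2_eq_square)
    qed (use i0 in auto)
    finally show "2 * \<bar>autocorr u z\<bar> \<le> (\<integral>x. u x * u x + u (x + z) * u (x + z) \<partial>lborel)" .
  qed (use i0 in simp)
  also have "(\<integral>x. u (x + z) * u (x + z) \<partial>lborel) = (\<integral>x. u x * u x \<partial>lborel)"
    by (intro lborel_integral_translate) auto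
  finally show ?thesis by (simp add: autocorr_def)
qed

section \<open>Spectral measures of autocorrelations\<close>

lemma measurable_autocorr[measurable (raw)]:
  assumes "bounded_support_fun u" "f \<in> borel_measurable M"
  shows "(\<lambda>x. autocorr u (f x)) \<in> borel_measurable M"
  using borel_measurable_continuous_onI[OF continuous_autocorr[OF assms(1)]] assms(2)
  by (rule measurable_compose_rev)

lemma lborel_integral_uminus:
  fixes f :: "'a::euclidean_space \<Rightarrow> real"
  assumes f: "f \<in> borel_measurable borel"
  shows "(\<integral>x. f (- x) \<partial>lborel) = (\<integral>x. f x \<partial>lborel)"
proof -
  have "lborel = distr lborel borel (uminus :: 'a \<Rightarrow> 'a)"
    using lborel_affine[of "-1" "0::'a"] by (simp add: density_1)
  then have "(\<integral>x. f x \<partial>lborel) = (\<integral>x. f x \<partial>distr lborel borel (uminus :: 'a \<Rightarrow> 'a))"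
    by (rule arg_cong)
  also have "\<dots> = (\<integral>x. f (- x) \<partial>lborel)" using f by (intro integral_distr) auto
  finally show ?thesis by simp
qed

lemma autocorr_integrable:
  assumes u: "bounded_support_fun u"
  shows "integrable lborel (autocorr u)"
proof -
  have "integrable (lborel \<Otimes>\<^sub>M lborel) (\<lambda>(x, w). u x * u (x + w))"
    unfolding lborel_prod by (intro bounded_support_fun_integrable bounded_support_fun_pair u)
  from lborel_pair.integrable_snd[OF this] show ?thesis by (simp add: autocorr_def[abs_def])
qed

text \<open>
  The squared modulus of the Fourier transform of \<open>u\<close>, written with real integrals.
\<close>

definition fourier_sq :: "('a::euclidean_space \<Rightarrow> real) \<Rightarrow> 'a \<Rightarrow> real" where
  "fourier_sq u \<xi> = (\<integral>x. u x * cos (\<xi> \<bullet> x) \<partial>lborel)\<^sup>2 + (\<integral>x. u x * sin (\<xi> \<bullet> x) \<partial>lborel)\<^sup>2"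

lemma measurable_fourier_sq[measurable]:
  assumes [measurable]: "u \<in> borel_measurable borel"
  shows "fourier_sq u \<in> borel_measurable borel"
  unfolding fourier_sq_def by measurable

lemma fourier_sq_eq:
  assumes u: "bounded_support_fun u"
  shows "fourier_sq u \<xi> = (\<integral>w. autocorr u w * cos (\<xi> \<bullet> w) \<partial>lborel)"
proof -
  note [measurable] = u[THEN bounded_support_fun_measurable]
  let ?C = "\<integral>x. u x * cos (\<xi> \<bullet> x) \<partial>lborel" and ?S = "\<integral>x. u x * sin (\<xi> \<bullet> x) \<partial>lborel"
  have i: "integrable lborel (\<lambda>x. u x * cos (\<xi> \<bullet> x))" "integrable lborel (\<lambda>x. u x * sin (\<xi> \<bullet> x))"
    by (intro bounded_support_fun_integrable bounded_support_fun_mult_bounded[where C=1] u; simp)+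
  have bs: "bounded_support_fun (\<lambda>p. (case p of (x, w) \<Rightarrow> u x * u (x + w)) * cos (\<xi> \<bullet> snd p))"
    by (rule bounded_support_fun_mult_bounded[where C=1])
       (auto intro!: bounded_support_fun_pair u simp: borel_prod[symmetric])
  have int: "integrable (lborel \<Otimes>\<^sub>M lborel) (\<lambda>(x, w). u x * u (x + w) * cos (\<xi> \<bullet> w))"
    using bounded_support_fun_integrable[OF bs] unfolding lborel_prod by (simp add: case_prod_beta')
  have "(\<integral>w. autocorr u w * cos (\<xi> \<bullet> w) \<partial>lborel) = (\<integral>w. \<integral>x. u x * u (x + w) * cos (\<xi> \<bullet> w) \<partial>lborel \<partial>lborel)"
    by (simp add: autocorr_def)
  also have "\<dots> = (\<integral>x. \<integral>w. u x * u (x + w) * cos (\<xi> \<bullet> w) \<partial>lborel \<partial>lborel)"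
    by (rule lborel_pair.Fubini_integral[OF int])
  also have "\<dots> = (\<integral>x. u x * cos (\<xi> \<bullet> x) * ?C + u x * sin (\<xi> \<bullet> x) * ?S \<partial>lborel)"
  proof (intro Bochner_Integration.integral_cong refl)
    fix x
    have "(\<integral>w. u x * u (x + w) * cos (\<xi> \<bullet> w) \<partial>lborel) = (\<integral>w. u x * (u (w + x) * cos (\<xi> \<bullet> (w + x - x))) \<partial>lborel)"
      by (simp add: add.commute mult.assoc)
    also have "\<dots> = u x * (\<integral>w. u w * cos (\<xi> \<bullet> (w - x)) \<partial>lborel)"
      using lborel_integral_translate[of "\<lambda>w. u w * cos (\<xi> \<bullet> (w - x))" x] by simp
    also have "(\<integral>w. u w * cos (\<xi> \<bullet> (w - x)) \<partial>lborel) = (\<integral>w. cos (\<xi> \<bullet> x) * (u w * cos (\<xi> \<bullet> w)) + sin (\<xi> \<bullet> x) * (u w * sin (\<xi> \<bullet> w)) \<partial>lborel)"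
      by (simp add: inner_diff_right cos_diff algebra_simps)
    also have "\<dots> = cos (\<xi> \<bullet> x) * ?C + sin (\<xi> \<bullet> x) * ?S" using i by simp
    finally show "(\<integral>w. u x * u (x + w) * cos (\<xi> \<bullet> w) \<partial>lborel) = u x * cos (\<xi> \<bullet> x) * ?C + u x * sin (\<xi> \<bullet> x) * ?S"
      by (simp add: algebra_simps)
  qed
  also have "\<dots> = fourier_sq u \<xi>" using i by (simp add: fourier_sq_def power2_eq_square)
  finally show ?thesis by simp
qed

text \<open>
  The Gaussian factor makes the integral over frequencies absolutely convergent and turns it, by Fubini, into a
  Gaussian average of the autocorrelation around \<open>z\<close>. The width of this average shrinks as \<open>s \<rightarrow> 0\<close>.
\<close>

lemma fourier_sq_gaussian:
  fixes u :: "'a::euclidean_space \<Rightarrow> real"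
  assumes u: "bounded_support_fun u" and s: "0 < s"
  shows "integrable lborel (\<lambda>\<xi>. fourier_sq u \<xi> * cos (\<xi> \<bullet> z) * exp (- s * (norm \<xi>)\<^sup>2))"
    and "(\<integral>\<xi>. fourier_sq u \<xi> * cos (\<xi> \<bullet> z) * exp (- s * (norm \<xi>)\<^sup>2) \<partial>lborel)
       = (2 * sqrt pi) ^ DIM('a) * (\<integral>v. autocorr u (z + (2 * sqrt s) *\<^sub>R v) * exp (- (norm v)\<^sup>2) \<partial>lborel)"
proof -
  note [measurable] = u[THEN bounded_support_fun_measurable]
  have R[measurable]: "autocorr u \<in> borel_measurable borel"
    using autocorr_integrable[OF u] by auto
  have ig: "integrable (lborel \<Otimes>\<^sub>M lborel) (\<lambda>(w, \<xi>). autocorr u w * exp (- s * (norm (\<xi>::'a))\<^sup>2))"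
  proof (rule lborel_pair.Fubini_integrable)
    show "integrable lborel (\<lambda>x. \<integral>y. norm (case (x, y::'a) of (w, \<xi>) \<Rightarrow> autocorr u w * exp (- s * (norm \<xi>)\<^sup>2)) \<partial>lborel)"
      using autocorr_integrable[OF u] by (simp add: abs_mult)
  qed (use gaussian_integral(1)[OF s, where 'a='a] in auto)
  have int: "integrable (lborel \<Otimes>\<^sub>M lborel) (\<lambda>(w, \<xi>). autocorr u w * (cos (\<xi> \<bullet> w) * cos (\<xi> \<bullet> z) * exp (- s * (norm \<xi>)\<^sup>2)))"
  proof (rule Bochner_Integration.integrable_bound[OF ig])
    have "\<bar>cos a * cos b\<bar> \<le> 1" for a b :: real unfolding abs_mult by (intro mult_le_one) auto
    then show "AE x in lborel \<Otimes>\<^sub>M lborel. norm (case x of (w, \<xi>) \<Rightarrow> autocorr u w * (cos (\<xi> \<bullet> w) * cos (\<xi> \<bullet> z) * exp (- s * (norm \<xi>)\<^sup>2)))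
       \<le> norm (case x of (w, \<xi>) \<Rightarrow> autocorr u w * exp (- s * (norm \<xi>)\<^sup>2))"
      by (intro AE_I2) (auto simp: abs_mult intro!: mult_left_mono mult_left_le_one_le mult_le_one)
  qed measurable
  have eq: "(\<integral>w. autocorr u w * (cos (\<xi> \<bullet> w) * cos (\<xi> \<bullet> z) * exp (- s * (norm \<xi>)\<^sup>2)) \<partial>lborel) = fourier_sq u \<xi> * cos (\<xi> \<bullet> z) * exp (- s * (norm \<xi>)\<^sup>2)" for \<xi>
    by (simp add: fourier_sq_eq[OF u] mult_ac flip: integral_mult_right_zero integral_mult_left_zero)
  show "integrable lborel (\<lambda>\<xi>. fourier_sq u \<xi> * cos (\<xi> \<bullet> z) * exp (- s * (norm \<xi>)\<^sup>2))"
    using lborel_pair.integrable_snd[OF int] by (simp only: prod.case eq)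
  define g where "g v = sqrt (pi / s) ^ DIM('a) * exp (- (norm v)\<^sup>2 / (4 * s))" for v :: 'a
  have [measurable]: "g \<in> borel_measurable borel" unfolding g_def by measurable
  have gb: "\<bar>g v\<bar> \<le> sqrt (pi / s) ^ DIM('a)" for v
    unfolding g_def abs_mult using s by (auto intro!: mult_right_le_one_le)
  have gi: "integrable lborel (\<lambda>w. autocorr u w * g (h w))" if [measurable]: "h \<in> borel_measurable borel" for h
    by (rule Bochner_Integration.integrable_bound[OF integrable_mult_right[OF autocorr_integrable[OF u], of "sqrt (pi / s) ^ DIM('a)"]])
       (auto simp: abs_mult mult.commute[of "\<bar>autocorr u _\<bar>"] s intro!: AE_I2 mult_right_mono order_trans[OF gb])
  have "(\<integral>\<xi>. fourier_sq u \<xi> * cos (\<xi> \<bullet> z) * exp (- s * (norm \<xi>)\<^sup>2) \<partial>lborel) =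
     (\<integral>\<xi>. \<integral>w. autocorr u w * (cos (\<xi> \<bullet> w) * cos (\<xi> \<bullet> z) * exp (- s * (norm \<xi>)\<^sup>2)) \<partial>lborel \<partial>lborel)"
    by (simp only: eq)
  also have "\<dots> = (\<integral>w. \<integral>\<xi>. autocorr u w * (cos (\<xi> \<bullet> w) * cos (\<xi> \<bullet> z) * exp (- s * (norm \<xi>)\<^sup>2)) \<partial>lborel \<partial>lborel)"
    by (rule lborel_pair.Fubini_integral[OF int])
  also have "\<dots> = (\<integral>w. (autocorr u w * g (w - z) + autocorr u w * g (w + z)) / 2 \<partial>lborel)"
  proof (intro Bochner_Integration.integral_cong refl)
    fix w
    have "(\<integral>\<xi>. cos (\<xi> \<bullet> w) * cos (\<xi> \<bullet> z) * exp (- s * (norm \<xi>)\<^sup>2) \<partial>lborel) =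
      (\<integral>\<xi>. (cos ((w - z) \<bullet> \<xi>) * exp (- s * (norm \<xi>)\<^sup>2) + cos ((w + z) \<bullet> \<xi>) * exp (- s * (norm \<xi>)\<^sup>2)) / 2 \<partial>lborel)"
      by (intro Bochner_Integration.integral_cong refl)
         (simp add: cos_times_cos inner_diff_right inner_add_right inner_commute[of _ "_ :: 'a"] inner_commute algebra_simps add_divide_distrib)
    also have "\<dots> = (g (w - z) + g (w + z)) / 2"
      using gaussian_fourier[OF s, of "w - z"] gaussian_fourier[OF s, of "w + z"] by (simp add: g_def)
    finally have e: "(\<integral>\<xi>. cos (\<xi> \<bullet> w) * cos (\<xi> \<bullet> z) * exp (- s * (norm \<xi>)\<^sup>2) \<partial>lborel) = (g (w - z) + g (w + z)) / 2" .
    show "(\<integral>\<xi>. autocorr u w * (cos (\<xi> \<bullet> w) * cos (\<xi> \<bullet> z) * exp (- s * (norm \<xi>)\<^sup>2)) \<partial>lborel) =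
       (autocorr u w * g (w - z) + autocorr u w * g (w + z)) / 2"
      unfolding integral_mult_right_zero e by (simp only: distrib_left[symmetric] times_divide_eq_right)
  qed
  also have "\<dots> = ((\<integral>w. autocorr u w * g (w - z) \<partial>lborel) + (\<integral>w. autocorr u w * g (w + z) \<partial>lborel)) / 2"
    by (simp add: gi)
  \<comment> \<open>The autocorrelation is even, so both halves of the product formula for cosines contribute equally.\<close>
  also have "(\<integral>w. autocorr u w * g (w + z) \<partial>lborel) = (\<integral>w. autocorr u (- w) * g (- w + z) \<partial>lborel)"
    by (intro lborel_integral_uminus[symmetric]) measurable
  also have "\<dots> = (\<integral>w. autocorr u w * g (w - z) \<partial>lborel)"
    by (simp add: autocorr_minus[OF u] g_def norm_minus_commute)
  also have "((\<integral>w. autocorr u w * g (w - z) \<partial>lborel) + (\<integral>w. autocorr u w * g (w - z) \<partial>lborel)) / 2 = (\<integral>w. autocorr u w * g (w - z) \<partial>lborel)"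
    by simp
  also have "\<dots> = (\<integral>w. autocorr u (w + z) * g w \<partial>lborel)"
    using lborel_integral_translate[of "\<lambda>w. autocorr u w * g (w - z)" z] by simp
  also have "\<dots> = (2 * sqrt s) ^ DIM('a) * (\<integral>v. autocorr u ((2 * sqrt s) *\<^sub>R v + z) * g ((2 * sqrt s) *\<^sub>R v) \<partial>lborel)"
    using s by (intro lborel_integral_scale) auto
  also have "(\<lambda>v. autocorr u ((2 * sqrt s) *\<^sub>R v + z) * g ((2 * sqrt s) *\<^sub>R v)) =
      (\<lambda>v. sqrt (pi / s) ^ DIM('a) * (autocorr u (z + (2 * sqrt s) *\<^sub>R v) * exp (- (norm v)\<^sup>2)))"
    using s by (auto simp: g_def power_mult_distrib add.commute)
  also have "(2 * sqrt s) ^ DIM('a) * (\<integral>v. sqrt (pi / s) ^ DIM('a) * (autocorr u (z + (2 * sqrt s) *\<^sub>R v) * exp (- (norm v)\<^sup>2)) \<partial>lborel) =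
     (2 * sqrt s * sqrt (pi / s)) ^ DIM('a) * (\<integral>v. autocorr u (z + (2 * sqrt s) *\<^sub>R v) * exp (- (norm v)\<^sup>2) \<partial>lborel)"
    by (simp add: power_mult_distrib)
  also have "2 * sqrt s * sqrt (pi / s) = 2 * sqrt pi" using s by (simp add: real_sqrt_divide)
  finally show "(\<integral>\<xi>. fourier_sq u \<xi> * cos (\<xi> \<bullet> z) * exp (- s * (norm \<xi>)\<^sup>2) \<partial>lborel)
       = (2 * sqrt pi) ^ DIM('a) * (\<integral>v. autocorr u (z + (2 * sqrt s) *\<^sub>R v) * exp (- (norm v)\<^sup>2) \<partial>lborel)" .
qed

text \<open>
  Letting \<open>s \<rightarrow> 0\<close> in \<open>fourier_sq_gaussian\<close>. At \<open>z = 0\<close> monotone convergence shows that the squared Fourier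
  transform is integrable; this then dominates the integrals for all other \<open>z\<close>.
\<close>

lemma fourier_sq_inversion:
  fixes u :: "'a::euclidean_space \<Rightarrow> real"
  assumes u: "bounded_support_fun u"
  shows "integrable lborel (fourier_sq u)"
    and "(\<integral>\<xi>. fourier_sq u \<xi> * cos (\<xi> \<bullet> z) \<partial>lborel) = (2 * pi) ^ DIM('a) * autocorr u z"
proof -
  note [measurable] = u[THEN bounded_support_fun_measurable]
  have R[measurable]: "autocorr u \<in> borel_measurable borel"
    using autocorr_integrable[OF u] by auto
  \<comment> \<open>parameters of the Gaussian regularisation, decreasing so that the Gaussian factors increase\<close>
  define s where "s n = 1 / real (Suc n)" for n
  have s: "0 < s n" for n by (simp add: s_def)
  have s0: "s \<longlonglongrightarrow> 0" unfolding s_def by (rule LIMSEQ_inverse_real_of_nat[unfolded inverse_eq_divide])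
  have gi: "integrable lborel (\<lambda>v::'a. exp (- (norm v)\<^sup>2))" "(\<integral>v. exp (- (norm v)\<^sup>2) \<partial>(lborel::'a measure)) = sqrt pi ^ DIM('a)"
    using gaussian_integral[of 1, where 'a='a] by auto
  let ?I = "\<lambda>z n. \<integral>\<xi>. fourier_sq u \<xi> * cos (\<xi> \<bullet> z) * exp (- s n * (norm \<xi>)\<^sup>2) \<partial>lborel"
  have lim: "?I z \<longlonglongrightarrow> (2 * pi) ^ DIM('a) * autocorr u z" for z
  proof -
    have "(\<lambda>n. \<integral>v. autocorr u (z + (2 * sqrt (s n)) *\<^sub>R v) * exp (- (norm v)\<^sup>2) \<partial>lborel) \<longlonglongrightarrow> (\<integral>v. autocorr u z * exp (- (norm v)\<^sup>2) \<partial>(lborel::'a measure))"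
    proof (rule integral_dominated_convergence[where w="\<lambda>v. autocorr u 0 * exp (- (norm v)\<^sup>2)"])
      show "integrable lborel (\<lambda>v::'a. autocorr u 0 * exp (- (norm v)\<^sup>2))" using gi by auto
      show "AE v in lborel. norm (autocorr u (z + (2 * sqrt (s n)) *\<^sub>R v) * exp (- (norm v)\<^sup>2)) \<le> autocorr u 0 * exp (- (norm v)\<^sup>2)" for n
        by (intro AE_I2) (auto simp: abs_mult autocorr_bounded[OF u])
      show "AE v in lborel. (\<lambda>n. autocorr u (z + (2 * sqrt (s n)) *\<^sub>R v) * exp (- (norm v)\<^sup>2)) \<longlonglongrightarrow> autocorr u z * exp (- (norm v)\<^sup>2)"
      proof (intro AE_I2 tendsto_mult_right)
        fix v :: 'a
        have "(\<lambda>n. z + (2 * sqrt (s n)) *\<^sub>R v) \<longlonglongrightarrow> z + (2 * sqrt 0) *\<^sub>R v"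
          by (intro tendsto_intros s0)
        then show "(\<lambda>n. autocorr u (z + (2 * sqrt (s n)) *\<^sub>R v)) \<longlonglongrightarrow> autocorr u z"
          by (intro continuous_on_tendsto_compose[OF continuous_autocorr[OF u]]) auto
      qed
    qed measurable
    then have "(\<lambda>n. (2 * sqrt pi) ^ DIM('a) * (\<integral>v. autocorr u (z + (2 * sqrt (s n)) *\<^sub>R v) * exp (- (norm v)\<^sup>2) \<partial>lborel)) \<longlonglongrightarrow> (2 * sqrt pi) ^ DIM('a) * (autocorr u z * sqrt pi ^ DIM('a))"
      by (intro tendsto_mult_left) (simp add: gi)
    also have "(2 * sqrt pi) ^ DIM('a) * (autocorr u z * sqrt pi ^ DIM('a)) = (2 * sqrt pi * sqrt pi) ^ DIM('a) * autocorr u z"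
      by (simp only: power_mult_distrib mult_ac)
    also have "2 * sqrt pi * sqrt pi = 2 * pi" by simp
    finally show ?thesis by (simp only: fourier_sq_gaussian(2)[OF u s])
  qed
  show int: "integrable lborel (fourier_sq u)"
  proof (rule integrable_monotone_convergence)
    show "integrable lborel (\<lambda>\<xi>. fourier_sq u \<xi> * exp (- s n * (norm \<xi>)\<^sup>2))" for n
      using fourier_sq_gaussian(1)[OF u s, of 0] by simp
    show "(\<lambda>n. \<integral>\<xi>. fourier_sq u \<xi> * exp (- s n * (norm \<xi>)\<^sup>2) \<partial>lborel) \<longlonglongrightarrow> (2 * pi) ^ DIM('a) * autocorr u 0"
      using lim[of 0] by simp
    show "AE \<xi> in lborel. mono (\<lambda>n. fourier_sq u \<xi> * exp (- s n * (norm \<xi>)\<^sup>2))"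
    proof (intro AE_I2 monoI mult_left_mono)
      fix \<xi> :: 'a and m n :: nat assume "m \<le> n"
      then have "s n \<le> s m" by (simp add: s_def frac_le)
      then show "exp (- s m * (norm \<xi>)\<^sup>2) \<le> exp (- s n * (norm \<xi>)\<^sup>2)" by (simp add: mult_right_mono)
    qed (simp add: fourier_sq_def)
    show "AE \<xi> in lborel. (\<lambda>n. fourier_sq u \<xi> * exp (- s n * (norm \<xi>)\<^sup>2)) \<longlonglongrightarrow> fourier_sq u \<xi>"
    proof (intro AE_I2)
      fix \<xi> :: 'a
      have "(\<lambda>n. fourier_sq u \<xi> * exp (- s n * (norm \<xi>)\<^sup>2)) \<longlonglongrightarrow> fourier_sq u \<xi> * exp (- 0 * (norm \<xi>)\<^sup>2)"
        by (intro tendsto_intros s0)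
      then show "(\<lambda>n. fourier_sq u \<xi> * exp (- s n * (norm \<xi>)\<^sup>2)) \<longlonglongrightarrow> fourier_sq u \<xi>" by simp
    qed
  qed measurable
  have "?I z \<longlonglongrightarrow> (\<integral>\<xi>. fourier_sq u \<xi> * cos (\<xi> \<bullet> z) \<partial>lborel)"
  proof (rule integral_dominated_convergence[OF _ _ int])
    show "AE \<xi> in lborel. norm (fourier_sq u \<xi> * cos (\<xi> \<bullet> z) * exp (- s n * (norm \<xi>)\<^sup>2)) \<le> fourier_sq u \<xi>" for n
    proof (intro AE_I2)
      fix \<xi> :: 'a
      have "0 \<le> fourier_sq u \<xi>" by (simp add: fourier_sq_def)
      moreover have "\<bar>cos (\<xi> \<bullet> z)\<bar> * exp (- s n * (norm \<xi>)\<^sup>2) \<le> 1" using s[of n] by (intro mult_le_one) auto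
      ultimately have "fourier_sq u \<xi> * (\<bar>cos (\<xi> \<bullet> z)\<bar> * exp (- s n * (norm \<xi>)\<^sup>2)) \<le> fourier_sq u \<xi> * 1"
        by (intro mult_left_mono)
      with \<open>0 \<le> fourier_sq u \<xi>\<close> show "norm (fourier_sq u \<xi> * cos (\<xi> \<bullet> z) * exp (- s n * (norm \<xi>)\<^sup>2)) \<le> fourier_sq u \<xi>"
        by (simp add: abs_mult mult_ac)
    qed
    show "AE \<xi> in lborel. (\<lambda>n. fourier_sq u \<xi> * cos (\<xi> \<bullet> z) * exp (- s n * (norm \<xi>)\<^sup>2)) \<longlonglongrightarrow> fourier_sq u \<xi> * cos (\<xi> \<bullet> z)"
    proof (intro AE_I2)
      fix \<xi> :: 'a
      have "(\<lambda>n. fourier_sq u \<xi> * cos (\<xi> \<bullet> z) * exp (- s n * (norm \<xi>)\<^sup>2)) \<longlonglongrightarrow> fourier_sq u \<xi> * cos (\<xi> \<bullet> z) * exp (- 0 * (norm \<xi>)\<^sup>2)"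
        by (intro tendsto_intros s0)
      then show "(\<lambda>n. fourier_sq u \<xi> * cos (\<xi> \<bullet> z) * exp (- s n * (norm \<xi>)\<^sup>2)) \<longlonglongrightarrow> fourier_sq u \<xi> * cos (\<xi> \<bullet> z)" by simp
    qed
  qed measurable
  with lim[of z] show "(\<integral>\<xi>. fourier_sq u \<xi> * cos (\<xi> \<bullet> z) \<partial>lborel) = (2 * pi) ^ DIM('a) * autocorr u z"
    using LIMSEQ_unique by blast
qed

definition spectral_measure :: "('a::euclidean_space \<Rightarrow> real) \<Rightarrow> 'a measure" where
  "spectral_measure u = density lborel (\<lambda>\<xi>. ennreal (fourier_sq u \<xi> / (2 * pi) ^ DIM('a)))"

lemma sets_spectral_measure[simp, measurable_cong]: "sets (spectral_measure u) = sets borel"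
  by (simp add: spectral_measure_def)

lemma finite_spectral_measure:
  fixes u :: "'a::euclidean_space \<Rightarrow> real"
  assumes u: "bounded_support_fun u"
  shows "finite_measure (spectral_measure u)"
proof (rule finite_measureI)
  note [measurable] = u[THEN bounded_support_fun_measurable]
  have "emeasure (spectral_measure u) (space (spectral_measure u)) = (\<integral>\<^sup>+\<xi>. ennreal (fourier_sq u \<xi> / (2 * pi) ^ DIM('a)) \<partial>lborel)"
    by (simp add: spectral_measure_def emeasure_density)
  also have "\<dots> < \<infinity>"
    using integrable_divide_zero[OF fourier_sq_inversion(1)[OF u], of "(2 * pi) ^ DIM('a)"]
    by (subst nn_integral_eq_integral) (auto simp: fourier_sq_def)
  finally show "emeasure (spectral_measure u) (space (spectral_measure u)) \<noteq> \<infinity>" by simp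
qed

text \<open>
  Bochner's theorem for autocorrelations, in explicit form. Since the identity holds at every point \<open>z\<close>, and
  not only almost everywhere, it can be integrated against laws that are not known to have a density.
\<close>

theorem autocorr_spectral:
  assumes u: "bounded_support_fun u"
  shows "autocorr u z = (\<integral>\<xi>. cos (\<xi> \<bullet> z) \<partial>spectral_measure u)"
proof -
  note [measurable] = u[THEN bounded_support_fun_measurable]
  show ?thesis
    unfolding spectral_measure_def using fourier_sq_inversion(2)[OF u, of z]
    by (subst integral_density) (auto simp: fourier_sq_def)
qed

section \<open>Quadratic increments under a symmetric measure\<close>

lemma sigma_finite_levy_measure: "sigma_finite_measure (levy_measure \<alpha>)"
  unfolding levy_measure_def
  by (subst sigma_finite_measure.sigma_finite_iff_density_finite[OF sigma_finite_lborel]) auto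

text \<open>
  The function \<open>H\<^sub>u\<close> of the introduction.
\<close>

definition sqdiff :: "('a::euclidean_space \<Rightarrow> real) \<Rightarrow> 'a \<Rightarrow> real" where
  "sqdiff u z = (\<integral>x. (u x - u (x + z))\<^sup>2 \<partial>lborel)"

lemma sqdiff_nonneg: "0 \<le> sqdiff u z"
  by (simp add: sqdiff_def)

lemma sqdiff_autocorr:
  assumes u: "bounded_support_fun u"
  shows "sqdiff u z = 2 * (autocorr u 0 - autocorr u z)"
proof -
  note [measurable] = u[THEN bounded_support_fun_measurable]
  have i: "integrable lborel (\<lambda>x. u (x + a) * u (x + b))" for a b
    by (intro bounded_support_fun_integrable bounded_support_fun_mult bounded_support_fun_translate u)
  have i0: "integrable lborel (\<lambda>x. u x * u x)" "integrable lborel (\<lambda>x. u x * u (x + z))"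
     "integrable lborel (\<lambda>x. u (x + z) * u (x + z))"
    using i[of 0 0] i[of 0 z] i[of z z] by auto
  have "sqdiff u z = (\<integral>x. u x * u x + u (x + z) * u (x + z) - 2 * (u x * u (x + z)) \<partial>lborel)"
    unfolding sqdiff_def by (intro Bochner_Integration.integral_cong refl) (simp add: power2_eq_square algebra_simps)
  also have "\<dots> = (\<integral>x. u x * u x \<partial>lborel) + (\<integral>x. u (x + z) * u (x + z) \<partial>lborel) - 2 * (\<integral>x. u x * u (x + z) \<partial>lborel)"
    using i0 by simp
  also have "(\<integral>x. u (x + z) * u (x + z) \<partial>lborel) = (\<integral>x. u x * u x \<partial>lborel)"
    using lborel_integral_translate[of "\<lambda>x. u x * u x" z] by simp
  finally show ?thesis by (simp add: autocorr_def)
qed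

lemma sqdiff_spectral:
  assumes u: "bounded_support_fun u"
  shows "ennreal (sqdiff u z) = (\<integral>\<^sup>+\<xi>. ennreal (2 * (1 - cos (\<xi> \<bullet> z))) \<partial>spectral_measure u)"
proof -
  interpret finite_measure "spectral_measure u" by (rule finite_spectral_measure[OF u])
  have i: "integrable (spectral_measure u) (\<lambda>\<xi>. cos (\<xi> \<bullet> y))" for y
    by (rule integrable_const_bound[where B=1]) auto
  have "(\<integral>\<^sup>+\<xi>. ennreal (2 * (1 - cos (\<xi> \<bullet> z))) \<partial>spectral_measure u) = ennreal (\<integral>\<xi>. 2 * (1 - cos (\<xi> \<bullet> z)) \<partial>spectral_measure u)"
    by (intro nn_integral_eq_integral Bochner_Integration.integrable_diff integrable_mult_right i) auto
  also have "(\<integral>\<xi>. 2 * (1 - cos (\<xi> \<bullet> z)) \<partial>spectral_measure u) = sqdiff u z"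
    unfolding sqdiff_autocorr[OF u] autocorr_spectral[OF u] using i[of z] i[of 0] by simp
  finally show ?thesis by simp
qed

lemma measurable_sqdiff[measurable (raw)]:
  assumes "bounded_support_fun u" "f \<in> borel_measurable M"
  shows "(\<lambda>x. sqdiff u (f x)) \<in> borel_measurable M"
  unfolding sqdiff_autocorr[OF assms(1)] using assms by measurable

lemma sqdiff_bounded:
  assumes u: "bounded_support_fun u"
  shows "sqdiff u z \<le> 4 * autocorr u 0"
  using autocorr_bounded[OF u, of z] by (simp add: sqdiff_autocorr[OF u])

text \<open>
  The centred Gaussian law whose characteristic function is \<open>exp (- s |z|\<^sup>2)\<close>. Averaging \<open>1 - cos (\<eta> \<bullet> z)\<close> over
  it yields the weight \<open>1 - exp (- s |z|\<^sup>2)\<close>.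
\<close>

definition gauss_law :: "real \<Rightarrow> 'a::euclidean_space measure" where
  "gauss_law s = density lborel (\<lambda>\<eta>. ennreal (exp (- (1 / (4 * s)) * (norm \<eta>)\<^sup>2) / sqrt (4 * pi * s) ^ DIM('a)))"

lemma sets_gauss_law[simp, measurable_cong]: "sets (gauss_law s) = sets borel"
  by (simp add: gauss_law_def)

lemma gauss_law_cos:
  fixes z :: "'a::euclidean_space"
  assumes s: "0 < s"
  shows "integrable (gauss_law s) (\<lambda>\<eta>. cos (\<eta> \<bullet> z))" and "(\<integral>\<eta>. cos (\<eta> \<bullet> z) \<partial>gauss_law s) = exp (- s * (norm z)\<^sup>2)"
proof -
  have s4: "0 < 1 / (4 * s)" using s by simp
  have *: "sqrt (pi / (1 / (4 * s))) = sqrt (4 * pi * s)" "(norm z)\<^sup>2 / (4 * (1 / (4 * s))) = s * (norm z)\<^sup>2"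
    using s by (simp_all add: field_simps)
  note g = gaussian_fourier[OF s4, of z, unfolded *]
  show "integrable (gauss_law s) (\<lambda>\<eta>. cos (\<eta> \<bullet> z))" and "(\<integral>\<eta>. cos (\<eta> \<bullet> z) \<partial>gauss_law s) = exp (- s * (norm z)\<^sup>2)"
    unfolding gauss_law_def using s g
    by (auto simp: integrable_density integral_density mult.commute inner_commute *)
qed

lemma prob_space_gauss_law:
  assumes s: "0 < s"
  shows "prob_space (gauss_law s :: 'a::euclidean_space measure)"
proof
  let ?G = "gauss_law s :: 'a measure"
  have "integrable ?G (\<lambda>_. 1::real)" "(\<integral>_. (1::real) \<partial>?G) = 1"
    using gauss_law_cos[OF s, of 0] by auto
  then have "(\<integral>\<^sup>+_. ennreal 1 \<partial>?G) = 1"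
    by (subst nn_integral_eq_integral) auto
  then show "emeasure ?G (space ?G) = 1" by simp
qed

text \<open>
  The power is at most \<open>1 + |\<eta>|\<^sup>2\<close>, which is absorbed by half of the Gaussian exponent.
\<close>

lemma gauss_law_powr_finite:
  assumes s: "0 < s" and \<alpha>: "0 < \<alpha>" "\<alpha> < 2"
  shows "(\<integral>\<^sup>+\<eta>. ennreal (norm \<eta> powr \<alpha>) \<partial>(gauss_law s :: 'a::euclidean_space measure)) < \<infinity>"
proof -
  \<comment> \<open>half of the coefficient \<open>1 / (4 s)\<close> in the Gaussian density\<close>
  define b where "b = 1 / (8 * s)"
  have b: "0 < b" "1 / (4 * s) = b + b" using s by (auto simp: b_def field_simps)
  have le: "norm \<eta> powr \<alpha> * (exp (- (1 / (4 * s)) * (norm \<eta>)\<^sup>2)) \<le> (1 + 1 / b) * exp (- b * (norm \<eta>)\<^sup>2)" for \<eta> :: 'a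
  proof -
    have "norm \<eta> powr \<alpha> \<le> 1 + (norm \<eta>)\<^sup>2"
    proof (cases "norm \<eta> \<le> 1")
      case True
      then have "norm \<eta> powr \<alpha> \<le> 1" using \<alpha> by (intro powr_le1) auto
      then show ?thesis by (simp add: add_increasing2)
    next
      case False
      then have "norm \<eta> powr \<alpha> \<le> norm \<eta> powr 2" using \<alpha> by (intro powr_mono) auto
      then show ?thesis using False by simp
    qed
    moreover have "b * (norm \<eta>)\<^sup>2 \<le> exp (b * (norm \<eta>)\<^sup>2)"
      using exp_ge_add_one_self[of "b * (norm \<eta>)\<^sup>2"] by linarith
    then have "(norm \<eta>)\<^sup>2 \<le> (1 / b) * exp (b * (norm \<eta>)\<^sup>2)" using b by (simp add: field_simps)
    moreover have "1 \<le> exp (b * (norm \<eta>)\<^sup>2)" using b by simp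
    ultimately have "norm \<eta> powr \<alpha> \<le> (1 + 1 / b) * exp (b * (norm \<eta>)\<^sup>2)"
      unfolding distrib_right by linarith
    then have "norm \<eta> powr \<alpha> * exp (- (1 / (4 * s)) * (norm \<eta>)\<^sup>2) \<le> (1 + 1 / b) * exp (b * (norm \<eta>)\<^sup>2) * exp (- (1 / (4 * s)) * (norm \<eta>)\<^sup>2)"
      by (intro mult_right_mono) auto
    also have "\<dots> = (1 + 1 / b) * exp (- b * (norm \<eta>)\<^sup>2)"
      unfolding mult.assoc exp_add[symmetric] b(2) by (simp add: algebra_simps)
    finally show ?thesis .
  qed
  let ?c = "sqrt (4 * pi * s) ^ DIM('a)"
  have c: "0 < ?c" using s by simp
  have "(\<integral>\<^sup>+\<eta>. ennreal (norm \<eta> powr \<alpha>) \<partial>(gauss_law s :: 'a measure)) =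
      (\<integral>\<^sup>+\<eta>. ennreal (exp (- (1 / (4 * s)) * (norm \<eta>)\<^sup>2) / ?c) * ennreal (norm \<eta> powr \<alpha>) \<partial>(lborel::'a measure))"
    unfolding gauss_law_def by (subst nn_integral_density) auto
  also have "\<dots> \<le> (\<integral>\<^sup>+\<eta>. ennreal (1 / ?c * ((1 + 1 / b) * exp (- b * (norm \<eta>)\<^sup>2))) \<partial>(lborel::'a measure))"
  proof (intro nn_integral_mono)
    fix \<eta> :: 'a
    have "exp (- (1 / (4 * s)) * (norm \<eta>)\<^sup>2) / ?c * norm \<eta> powr \<alpha> \<le> 1 / ?c * ((1 + 1 / b) * exp (- b * (norm \<eta>)\<^sup>2))"
      using mult_left_mono[OF le[of \<eta>], of "1 / ?c"] c by (simp add: mult_ac)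
    then show "ennreal (exp (- (1 / (4 * s)) * (norm \<eta>)\<^sup>2) / ?c) * ennreal (norm \<eta> powr \<alpha>) \<le> ennreal (1 / ?c * ((1 + 1 / b) * exp (- b * (norm \<eta>)\<^sup>2)))"
      by (subst ennreal_mult''[symmetric, OF powr_ge_zero]) (rule ennreal_leI)
  qed
  also have "\<dots> < \<infinity>"
    using gaussian_integral(1)[OF b(1), where 'a='a] b c
    by (subst nn_integral_eq_integral) auto
  finally show ?thesis .
qed

text \<open>
  Two kinds of measure have this structure: the law of the process at a fixed time, with
  \<open>\<Psi> \<xi> = 1 - exp (- t |\<xi>|\<^sup>\<alpha>)\<close>, and the jump measure, with \<open>\<Psi> \<xi> = |\<xi>|\<^sup>\<alpha>\<close>. Passing to the limit \<open>t \<rightarrow> 0\<close> then becomes a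
  statement about \<open>\<Psi>\<close> alone.
\<close>

locale symmetric_exponent = sigma_finite_measure \<Lambda> for \<Lambda> :: "'a::euclidean_space measure" +
  fixes \<Psi> :: "'a \<Rightarrow> real"
  assumes sets_Lambda[simp, measurable_cong]: "sets \<Lambda> = sets borel"
    and Psi_nonneg: "0 \<le> \<Psi> \<xi>"
    and Psi_measurable[measurable]: "\<Psi> \<in> borel_measurable borel"
    and exponent: "(\<integral>\<^sup>+z. ennreal (1 - cos (\<xi> \<bullet> z)) \<partial>\<Lambda>) = ennreal (\<Psi> \<xi>)"
begin

lemma nn_integral_sqdiff:
  assumes u: "bounded_support_fun u"
  shows "(\<integral>\<^sup>+z. ennreal (sqdiff u z) \<partial>\<Lambda>) = (\<integral>\<^sup>+\<xi>. ennreal (2 * \<Psi> \<xi>) \<partial>spectral_measure u)"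
proof -
  interpret m: finite_measure "spectral_measure u" by (rule finite_spectral_measure[OF u])
  interpret P: pair_sigma_finite "spectral_measure u" \<Lambda> ..
  have "(\<integral>\<^sup>+z. ennreal (sqdiff u z) \<partial>\<Lambda>) = (\<integral>\<^sup>+z. \<integral>\<^sup>+\<xi>. ennreal (2 * (1 - cos (\<xi> \<bullet> z))) \<partial>spectral_measure u \<partial>\<Lambda>)"
    by (simp only: sqdiff_spectral[OF u])
  also have "\<dots> = (\<integral>\<^sup>+\<xi>. \<integral>\<^sup>+z. ennreal (2 * (1 - cos (\<xi> \<bullet> z))) \<partial>\<Lambda> \<partial>spectral_measure u)"
    by (rule P.Fubini') measurable
  also have "\<dots> = (\<integral>\<^sup>+\<xi>. ennreal (2 * \<Psi> \<xi>) \<partial>spectral_measure u)"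
  proof (intro nn_integral_cong)
    fix \<xi>
    have "(\<integral>\<^sup>+z. ennreal (2 * (1 - cos (\<xi> \<bullet> z))) \<partial>\<Lambda>) = (\<integral>\<^sup>+z. ennreal 2 * ennreal (1 - cos (\<xi> \<bullet> z)) \<partial>\<Lambda>)"
      by (intro nn_integral_cong) (rule ennreal_mult', simp)
    also have "\<dots> = ennreal 2 * (\<integral>\<^sup>+z. ennreal (1 - cos (\<xi> \<bullet> z)) \<partial>\<Lambda>)"
      by (rule nn_integral_cmult) measurable
    finally show "(\<integral>\<^sup>+z. ennreal (2 * (1 - cos (\<xi> \<bullet> z))) \<partial>\<Lambda>) = ennreal (2 * \<Psi> \<xi>)"
      unfolding exponent by (simp add: ennreal_mult')
  qed
  finally show ?thesis .
qed

lemma gauss_one_minus: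
  assumes s: "0 < s"
  shows "ennreal (1 - exp (- s * (norm (z::'a))\<^sup>2)) = (\<integral>\<^sup>+\<eta>. ennreal (1 - cos (\<eta> \<bullet> z)) \<partial>gauss_law s)"
proof -
  interpret prob_space "gauss_law s :: 'a measure" by (rule prob_space_gauss_law[OF s])
  show ?thesis using gauss_law_cos[OF s, of z]
    by (subst nn_integral_eq_integral) (auto simp: prob_space)
qed

lemma nn_integral_gauss:
  assumes s: "0 < s"
  shows "(\<integral>\<^sup>+z. ennreal (1 - exp (- s * (norm z)\<^sup>2)) \<partial>\<Lambda>) = (\<integral>\<^sup>+\<eta>. ennreal (\<Psi> \<eta>) \<partial>gauss_law s)"
proof -
  interpret m: prob_space "gauss_law s :: 'a measure" by (rule prob_space_gauss_law[OF s])
  interpret P: pair_sigma_finite "gauss_law s :: 'a measure" \<Lambda> ..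
  have "(\<integral>\<^sup>+z. ennreal (1 - exp (- s * (norm z)\<^sup>2)) \<partial>\<Lambda>) = (\<integral>\<^sup>+z. \<integral>\<^sup>+\<eta>. ennreal (1 - cos (\<eta> \<bullet> z)) \<partial>gauss_law s \<partial>\<Lambda>)"
    by (simp only: gauss_one_minus[OF s])
  also have "\<dots> = (\<integral>\<^sup>+\<eta>. \<integral>\<^sup>+z. ennreal (1 - cos (\<eta> \<bullet> z)) \<partial>\<Lambda> \<partial>gauss_law s)"
    by (rule P.Fubini') measurable
  finally show ?thesis by (simp only: exponent)
qed

text \<open>
  The symmetric second difference of \<open>\<Psi>\<close>. It remains bounded in \<open>\<xi>\<close> although \<open>\<Psi>\<close> itself may not be, because it is
  the integral of \<open>(1 - cos (\<xi> \<bullet> z)) (1 - cos (\<eta> \<bullet> z))\<close>.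
\<close>

definition second_diff :: "'a \<Rightarrow> 'a \<Rightarrow> real" where
  "second_diff \<xi> \<eta> = \<Psi> \<xi> + \<Psi> \<eta> - \<Psi> (\<xi> + \<eta>) / 2 - \<Psi> (\<xi> - \<eta>) / 2"

lemma second_diff_integral:
  shows "(\<integral>\<^sup>+z. ennreal ((1 - cos (\<xi> \<bullet> z)) * (1 - cos (\<eta> \<bullet> z))) \<partial>\<Lambda>) = ennreal (second_diff \<xi> \<eta>)"
    and "0 \<le> second_diff \<xi> \<eta>" and "second_diff \<xi> \<eta> \<le> 2 * \<Psi> \<eta>"
proof -
  have i: "integrable \<Lambda> (\<lambda>z. 1 - cos (\<xi> \<bullet> z))" "(\<integral>z. 1 - cos (\<xi> \<bullet> z) \<partial>\<Lambda>) = \<Psi> \<xi>" for \<xi>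
  proof -
    show *: "integrable \<Lambda> (\<lambda>z. 1 - cos (\<xi> \<bullet> z))"
      by (rule integrableI_nn_integral_finite[OF _ _ exponent]) auto
    show "(\<integral>z. 1 - cos (\<xi> \<bullet> z) \<partial>\<Lambda>) = \<Psi> \<xi>"
      using exponent[of \<xi>] by (intro integral_eq_nn_integral[THEN trans]) (auto simp: Psi_nonneg)
  qed
  have eq: "(1 - cos (\<xi> \<bullet> z)) * (1 - cos (\<eta> \<bullet> z)) =
    (1 - cos (\<xi> \<bullet> z)) + (1 - cos (\<eta> \<bullet> z)) - (1 - cos ((\<xi> + \<eta>) \<bullet> z)) / 2 - (1 - cos ((\<xi> - \<eta>) \<bullet> z)) / 2" for z
    by (simp add: inner_add_left inner_diff_left cos_add cos_diff field_simps)
  have int: "integrable \<Lambda> (\<lambda>z. (1 - cos (\<xi> \<bullet> z)) * (1 - cos (\<eta> \<bullet> z)))"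
    unfolding eq by (intro Bochner_Integration.integrable_diff Bochner_Integration.integrable_add integrable_divide_zero i)
  have val: "(\<integral>z. (1 - cos (\<xi> \<bullet> z)) * (1 - cos (\<eta> \<bullet> z)) \<partial>\<Lambda>) = second_diff \<xi> \<eta>"
    unfolding eq second_diff_def
    by (simp only: Bochner_Integration.integral_diff Bochner_Integration.integral_add integral_divide_zero i
      Bochner_Integration.integrable_diff Bochner_Integration.integrable_add integrable_divide_zero)
  show "(\<integral>\<^sup>+z. ennreal ((1 - cos (\<xi> \<bullet> z)) * (1 - cos (\<eta> \<bullet> z))) \<partial>\<Lambda>) = ennreal (second_diff \<xi> \<eta>)"
    using int by (subst nn_integral_eq_integral) (auto simp: val)
  show "0 \<le> second_diff \<xi> \<eta>" unfolding val[symmetric] by (intro integral_nonneg_AE) auto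
  have "second_diff \<xi> \<eta> \<le> (\<integral>z. 2 * (1 - cos (\<eta> \<bullet> z)) \<partial>\<Lambda>)"
    unfolding val[symmetric]
  proof (rule integral_mono[OF int])
    show "integrable \<Lambda> (\<lambda>z. 2 * (1 - cos (\<eta> \<bullet> z)))" by (intro integrable_mult_right i)
    show "(1 - cos (\<xi> \<bullet> z)) * (1 - cos (\<eta> \<bullet> z)) \<le> 2 * (1 - cos (\<eta> \<bullet> z))" for z
      using cos_ge_minus_one[of "\<xi> \<bullet> z"] by (intro mult_right_mono) auto
  qed
  then show "second_diff \<xi> \<eta> \<le> 2 * \<Psi> \<eta>" by (simp only: integral_mult_right_zero i)
qed

lemma measurable_second_diff[measurable]: "(\<lambda>(\<xi>, \<eta>). second_diff \<xi> \<eta>) \<in> borel_measurable (borel \<Otimes>\<^sub>M borel)"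
  unfolding second_diff_def by measurable

lemma nn_integral_sqdiff_gauss:
  assumes u: "bounded_support_fun u" and s: "0 < s"
  shows "(\<integral>\<^sup>+z. ennreal (sqdiff u z * (1 - exp (- s * (norm z)\<^sup>2))) \<partial>\<Lambda>) =
         (\<integral>\<^sup>+p. ennreal (2 * second_diff (fst p) (snd p)) \<partial>(spectral_measure u \<Otimes>\<^sub>M gauss_law s))"
proof -
  interpret m: finite_measure "spectral_measure u" by (rule finite_spectral_measure[OF u])
  interpret k: prob_space "gauss_law s :: 'a measure" by (rule prob_space_gauss_law[OF s])
  interpret P: pair_sigma_finite "spectral_measure u \<Otimes>\<^sub>M (gauss_law s :: 'a measure)" \<Lambda>
    by (intro pair_sigma_finite.intro sigma_finite_pair_measure m.sigma_finite_measure_axioms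
          k.sigma_finite_measure_axioms sigma_finite_measure_axioms)
  note [measurable] = u[THEN bounded_support_fun_measurable]
  have "(\<integral>\<^sup>+z. ennreal (sqdiff u z * (1 - exp (- s * (norm z)\<^sup>2))) \<partial>\<Lambda>) =
    (\<integral>\<^sup>+z. \<integral>\<^sup>+p. ennreal (2 * ((1 - cos (fst p \<bullet> z)) * (1 - cos (snd p \<bullet> z)))) \<partial>(spectral_measure u \<Otimes>\<^sub>M gauss_law s) \<partial>\<Lambda>)"
  proof (intro nn_integral_cong)
    fix z
    have "(\<integral>\<^sup>+p. ennreal (2 * ((1 - cos (fst p \<bullet> z)) * (1 - cos (snd p \<bullet> z)))) \<partial>(spectral_measure u \<Otimes>\<^sub>M gauss_law s)) =
      (\<integral>\<^sup>+\<xi>. \<integral>\<^sup>+\<eta>. ennreal (2 * ((1 - cos (\<xi> \<bullet> z)) * (1 - cos (\<eta> \<bullet> z)))) \<partial>gauss_law s \<partial>spectral_measure u)"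
      by (subst k.nn_integral_fst[symmetric]) auto
    also have "\<dots> = (\<integral>\<^sup>+\<xi>. ennreal (2 * (1 - cos (\<xi> \<bullet> z))) * (\<integral>\<^sup>+\<eta>. ennreal (1 - cos (\<eta> \<bullet> z)) \<partial>gauss_law s) \<partial>spectral_measure u)"
    proof (intro nn_integral_cong)
      fix \<xi>
      have "(\<integral>\<^sup>+\<eta>. ennreal (2 * ((1 - cos (\<xi> \<bullet> z)) * (1 - cos (\<eta> \<bullet> z)))) \<partial>gauss_law s) =
        (\<integral>\<^sup>+\<eta>. ennreal (2 * (1 - cos (\<xi> \<bullet> z))) * ennreal (1 - cos (\<eta> \<bullet> z)) \<partial>gauss_law s)"
        unfolding mult.assoc[symmetric] by (intro nn_integral_cong ennreal_mult') simp
      also have "\<dots> = ennreal (2 * (1 - cos (\<xi> \<bullet> z))) * (\<integral>\<^sup>+\<eta>. ennreal (1 - cos (\<eta> \<bullet> z)) \<partial>gauss_law s)"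
        by (rule nn_integral_cmult) measurable
      finally show "(\<integral>\<^sup>+\<eta>. ennreal (2 * ((1 - cos (\<xi> \<bullet> z)) * (1 - cos (\<eta> \<bullet> z)))) \<partial>gauss_law s) =
        ennreal (2 * (1 - cos (\<xi> \<bullet> z))) * (\<integral>\<^sup>+\<eta>. ennreal (1 - cos (\<eta> \<bullet> z)) \<partial>gauss_law s)" .
    qed
    also have "\<dots> = (\<integral>\<^sup>+\<xi>. ennreal (2 * (1 - cos (\<xi> \<bullet> z))) \<partial>spectral_measure u) * ennreal (1 - exp (- s * (norm z)\<^sup>2))"
      unfolding gauss_one_minus[OF s] by (rule nn_integral_multc) measurable
    also have "\<dots> = ennreal (sqdiff u z * (1 - exp (- s * (norm z)\<^sup>2)))"
      unfolding sqdiff_spectral[OF u, symmetric] using s by (intro ennreal_mult'[symmetric] sqdiff_nonneg)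
    finally show "ennreal (sqdiff u z * (1 - exp (- s * (norm z)\<^sup>2))) =
      (\<integral>\<^sup>+p. ennreal (2 * ((1 - cos (fst p \<bullet> z)) * (1 - cos (snd p \<bullet> z)))) \<partial>(spectral_measure u \<Otimes>\<^sub>M gauss_law s))" by simp
  qed
  also have "\<dots> = (\<integral>\<^sup>+p. \<integral>\<^sup>+z. ennreal (2 * ((1 - cos (fst p \<bullet> z)) * (1 - cos (snd p \<bullet> z)))) \<partial>\<Lambda> \<partial>(spectral_measure u \<Otimes>\<^sub>M gauss_law s))"
    by (rule P.Fubini') measurable
  also have "\<dots> = (\<integral>\<^sup>+p. ennreal (2 * second_diff (fst p) (snd p)) \<partial>(spectral_measure u \<Otimes>\<^sub>M gauss_law s))"
  proof (intro nn_integral_cong)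
    fix p :: "'a \<times> 'a"
    have "(\<integral>\<^sup>+z. ennreal (2 * ((1 - cos (fst p \<bullet> z)) * (1 - cos (snd p \<bullet> z)))) \<partial>\<Lambda>) =
      (\<integral>\<^sup>+z. ennreal 2 * ennreal ((1 - cos (fst p \<bullet> z)) * (1 - cos (snd p \<bullet> z))) \<partial>\<Lambda>)"
      by (intro nn_integral_cong) (rule ennreal_mult', simp)
    also have "\<dots> = ennreal 2 * ennreal (second_diff (fst p) (snd p))"
      unfolding second_diff_integral(1)[symmetric] by (rule nn_integral_cmult) measurable
    finally show "(\<integral>\<^sup>+z. ennreal (2 * ((1 - cos (fst p \<bullet> z)) * (1 - cos (snd p \<bullet> z)))) \<partial>\<Lambda>) = ennreal (2 * second_diff (fst p) (snd p))"
      by (simp add: ennreal_mult')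
  qed
  finally show ?thesis .
qed

end

section \<open>Small-time asymptotics of stable laws\<close>

text \<open>
  Only the real part of the characteristic function is recorded; what is used of the law are the integrals of
  \<open>1 - cos (\<xi> \<bullet> z)\<close>.
\<close>

definition stable_law :: "real \<Rightarrow> real \<Rightarrow> 'a::euclidean_space measure \<Rightarrow> bool" where
  "stable_law \<alpha> t \<mu> \<longleftrightarrow> prob_space \<mu> \<and> sets \<mu> = sets borel \<and>
     (\<forall>\<xi>. (\<integral>z. cos (\<xi> \<bullet> z) \<partial>\<mu>) = exp (- (t * norm \<xi> powr \<alpha>)))"

lemma stable_law_exponent:
  assumes \<mu>: "stable_law \<alpha> t \<mu>" and t: "0 \<le> t"
  shows "symmetric_exponent \<mu> (\<lambda>\<xi>. 1 - exp (- (t * norm \<xi> powr \<alpha>)))"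
proof -
  interpret prob_space \<mu> using \<mu> by (simp add: stable_law_def)
  have [measurable_cong]: "sets \<mu> = sets borel" using \<mu> by (simp add: stable_law_def)
  show ?thesis
  proof
    fix \<xi>
    have i: "integrable \<mu> (\<lambda>z. cos (\<xi> \<bullet> z))" by (rule integrable_const_bound[where B=1]) auto
    then have "(\<integral>\<^sup>+z. ennreal (1 - cos (\<xi> \<bullet> z)) \<partial>\<mu>) = ennreal (\<integral>z. 1 - cos (\<xi> \<bullet> z) \<partial>\<mu>)"
      by (intro nn_integral_eq_integral) auto
    also have "(\<integral>z. 1 - cos (\<xi> \<bullet> z) \<partial>\<mu>) = 1 - exp (- (t * norm \<xi> powr \<alpha>))"
      using i \<mu> by (simp add: prob_space stable_law_def)
    finally show "(\<integral>\<^sup>+z. ennreal (1 - cos (\<xi> \<bullet> z)) \<partial>\<mu>) = ennreal (1 - exp (- (t * norm \<xi> powr \<alpha>)))" .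
  qed (use \<mu> t in \<open>auto simp: stable_law_def\<close>)
qed

lemma levy_measure_exponent:
  assumes "0 < \<alpha>" "\<alpha> < 2"
  shows "symmetric_exponent (levy_measure \<alpha>) (\<lambda>\<xi>. norm \<xi> powr \<alpha>)"
proof -
  interpret sigma_finite_measure "levy_measure \<alpha>" by (rule sigma_finite_levy_measure)
  show ?thesis by standard (use assms levy_symbol in auto)
qed

text \<open>
  Averaging the characteristic function over a Gaussian bounds the integral of \<open>1 - exp (- |z|\<^sup>2)\<close> by a multiple of
  \<open>t\<close>, and that function is bounded below for \<open>|z| \<ge> r\<close>.
\<close>

lemma stable_law_tail:
  assumes \<alpha>: "0 < \<alpha>" "\<alpha> < 2" and r: "0 < r"
  obtains C where "0 \<le> C" "\<And>t (\<mu> :: 'a::euclidean_space measure). 0 \<le> t \<Longrightarrow> stable_law \<alpha> t \<mu> \<Longrightarrow> measure \<mu> {z. r \<le> norm z} \<le> C * t"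
proof -
  define K where "K = enn2real (\<integral>\<^sup>+\<eta>. ennreal (norm \<eta> powr \<alpha>) \<partial>(gauss_law 1 :: 'a measure))"
  have K: "(\<integral>\<^sup>+\<eta>. ennreal (norm \<eta> powr \<alpha>) \<partial>(gauss_law 1 :: 'a measure)) = ennreal K" "0 \<le> K"
    unfolding K_def using gauss_law_powr_finite[of 1 \<alpha>, where 'a='a] \<alpha> by (auto simp: less_top)
  define c where "c = 1 - exp (- r\<^sup>2)"
  have c: "0 < c" using r by (simp add: c_def)
  show thesis
  proof (rule that[of "K / c"])
    show "0 \<le> K / c" using K c by simp
    fix t and \<mu> :: "'a measure" assume t: "0 \<le> t" and \<mu>: "stable_law \<alpha> t \<mu>"
    interpret prob_space \<mu> using \<mu> by (simp add: stable_law_def)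
    interpret symmetric_exponent \<mu> "\<lambda>\<xi>. 1 - exp (- (t * norm \<xi> powr \<alpha>))" by (rule stable_law_exponent[OF \<mu> t])
    have [measurable]: "{z. r \<le> norm z} \<in> sets \<mu>" by simp
    have "ennreal (c * measure \<mu> {z. r \<le> norm z}) = (\<integral>\<^sup>+z. ennreal c * indicator {z. r \<le> norm z} z \<partial>\<mu>)"
      using c by (subst nn_integral_cmult_indicator) (auto simp: emeasure_eq_measure ennreal_mult')
    also have "\<dots> \<le> (\<integral>\<^sup>+z. ennreal (1 - exp (- 1 * (norm z)\<^sup>2)) \<partial>\<mu>)"
    proof (intro nn_integral_mono)
      fix z :: 'a
      have "r \<le> norm z \<Longrightarrow> r\<^sup>2 \<le> (norm z)\<^sup>2" using r by (intro power_mono) auto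
      then show "ennreal c * indicator {z. r \<le> norm z} z \<le> ennreal (1 - exp (- 1 * (norm z)\<^sup>2))"
        by (auto simp: c_def indicator_def intro!: ennreal_leI)
    qed
    also have "\<dots> = (\<integral>\<^sup>+\<eta>. ennreal (1 - exp (- (t * norm \<eta> powr \<alpha>))) \<partial>(gauss_law 1 :: 'a measure))"
      by (rule nn_integral_gauss) simp
    also have "\<dots> \<le> (\<integral>\<^sup>+\<eta>. ennreal t * ennreal (norm \<eta> powr \<alpha>) \<partial>(gauss_law 1 :: 'a measure))"
    proof (intro nn_integral_mono)
      fix \<eta> :: 'a
      show "ennreal (1 - exp (- (t * norm \<eta> powr \<alpha>))) \<le> ennreal t * ennreal (norm \<eta> powr \<alpha>)"
        using t exp_ge_add_one_self[of "- (t * norm \<eta> powr \<alpha>)"]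
        by (subst ennreal_mult'[symmetric]) (auto intro!: ennreal_leI)
    qed
    also have "\<dots> = ennreal (t * K)"
      using t K by (subst nn_integral_cmult) (auto simp: ennreal_mult')
    finally have "c * measure \<mu> {z. r \<le> norm z} \<le> t * K"
      using t K by (subst (asm) ennreal_le_iff) auto
    then show "measure \<mu> {z. r \<le> norm z} \<le> K / c * t"
      using c by (simp add: field_simps)
  qed
qed

locale stable_small_time =
  fixes \<alpha> :: real and t :: "nat \<Rightarrow> real" and \<mu> :: "nat \<Rightarrow> 'a::euclidean_space measure"
  assumes \<alpha>: "0 < \<alpha>" "\<alpha> < 2"
    and t_pos: "0 < t n" and t_lim: "t \<longlonglongrightarrow> 0"
    and law: "stable_law \<alpha> (t n) (\<mu> n)"
begin

text \<open>
  The symbol of \<open>(I - P\<^sub>t) / t\<close> for the free semigroup at \<open>t = t n\<close>; it stays below its limit \<open>|\<xi>|\<^sup>\<alpha>\<close>.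
\<close>

definition approx_symbol :: "nat \<Rightarrow> 'a \<Rightarrow> real" where
  "approx_symbol n \<xi> = (1 - exp (- (t n * norm \<xi> powr \<alpha>))) / t n"

lemma approx_symbol_nonneg: "0 \<le> approx_symbol n \<xi>"
  using t_pos[of n] by (simp add: approx_symbol_def)

lemma approx_symbol_le: "approx_symbol n \<xi> \<le> norm \<xi> powr \<alpha>"
  using t_pos[of n] exp_ge_add_one_self[of "- (t n * norm \<xi> powr \<alpha>)"]
  by (simp add: approx_symbol_def field_simps)

lemma approx_symbol_lim: "(\<lambda>n. approx_symbol n \<xi>) \<longlonglongrightarrow> norm \<xi> powr \<alpha>"
proof -
  let ?x = "norm \<xi> powr \<alpha>"
  have "((\<lambda>s. exp (- (s * ?x))) has_real_derivative - ?x) (at 0)"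
    by (auto intro!: derivative_eq_intros)
  then have "((\<lambda>h. (exp (- (h * ?x)) - 1) / h) \<longlongrightarrow> - ?x) (at 0)"
    by (simp add: DERIV_def)
  then have "((\<lambda>h. - ((exp (- (h * ?x)) - 1) / h)) \<longlongrightarrow> - (- ?x)) (at 0)"
    by (rule tendsto_minus)
  then have *: "((\<lambda>h. (1 - exp (- (h * ?x))) / h) \<longlongrightarrow> ?x) (at 0)"
    by (simp add: minus_divide_left)
  have "filterlim t (at 0) sequentially"
    using t_lim t_pos by (auto simp: filterlim_at less_imp_neq[symmetric])
  from filterlim_compose[OF * this] show ?thesis by (simp add: approx_symbol_def)
qed

lemma measurable_approx_symbol[measurable]: "approx_symbol n \<in> borel_measurable borel"
  unfolding approx_symbol_def by measurable

lemma exponent_n: "symmetric_exponent (\<mu> n) (\<lambda>\<xi>. t n * approx_symbol n \<xi>)"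
  using stable_law_exponent[OF law[of n]] t_pos[of n]
  by (simp add: approx_symbol_def less_imp_le less_imp_neq[symmetric])

lemma exponent_levy: "symmetric_exponent (levy_measure \<alpha>) (\<lambda>\<xi>. norm \<xi> powr \<alpha>)"
  by (rule levy_measure_exponent[OF \<alpha>])

lemma nn_integral_sqdiff_n:
  assumes u: "bounded_support_fun u"
  shows "(\<integral>\<^sup>+z. ennreal (sqdiff u z) \<partial>\<mu> n) = ennreal (t n) * (\<integral>\<^sup>+\<xi>. ennreal (2 * approx_symbol n \<xi>) \<partial>spectral_measure u)"
proof -
  interpret symmetric_exponent "\<mu> n" "\<lambda>\<xi>. t n * approx_symbol n \<xi>" by (rule exponent_n)
  have "(\<integral>\<^sup>+z. ennreal (sqdiff u z) \<partial>\<mu> n) = (\<integral>\<^sup>+\<xi>. ennreal (t n) * ennreal (2 * approx_symbol n \<xi>) \<partial>spectral_measure u)"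
    unfolding nn_integral_sqdiff[OF u] using t_pos[of n] approx_symbol_nonneg
    by (intro nn_integral_cong) (simp add: mult_ac flip: ennreal_mult')
  also have "\<dots> = ennreal (t n) * (\<integral>\<^sup>+\<xi>. ennreal (2 * approx_symbol n \<xi>) \<partial>spectral_measure u)"
    by (rule nn_integral_cmult) measurable
  finally show ?thesis .
qed

text \<open>
  Fatou's lemma on the frequency side. It is used to see that the ground state has finite energy.
\<close>

lemma sqdiff_levy_le:
  assumes u: "bounded_support_fun u" and le: "\<And>n. (\<integral>\<^sup>+z. ennreal (sqdiff u z) \<partial>\<mu> n) \<le> ennreal (t n * C)" and C: "0 \<le> C"
  shows "(\<integral>\<^sup>+z. ennreal (sqdiff u z) \<partial>levy_measure \<alpha>) \<le> ennreal C"
proof -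
  interpret L: symmetric_exponent "levy_measure \<alpha>" "\<lambda>\<xi>. norm \<xi> powr \<alpha>" by (rule exponent_levy)
  have "(\<integral>\<^sup>+\<xi>. ennreal (2 * approx_symbol n \<xi>) \<partial>spectral_measure u) \<le> ennreal C" for n
  proof -
    have "ennreal (t n) * (\<integral>\<^sup>+\<xi>. ennreal (2 * approx_symbol n \<xi>) \<partial>spectral_measure u) \<le> ennreal (t n) * ennreal C"
      using le[of n] C t_pos[of n] unfolding nn_integral_sqdiff_n[OF u] by (simp add: ennreal_mult)
    then show ?thesis using t_pos[of n] by (subst (asm) ennreal_mult_le_mult_iff) auto
  qed
  note le' = this
  have "(\<integral>\<^sup>+z. ennreal (sqdiff u z) \<partial>levy_measure \<alpha>) = (\<integral>\<^sup>+\<xi>. liminf (\<lambda>n. ennreal (2 * approx_symbol n \<xi>)) \<partial>spectral_measure u)"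
    unfolding L.nn_integral_sqdiff[OF u]
  proof (intro nn_integral_cong)
    fix \<xi> :: 'a
    have "(\<lambda>n. ennreal (2 * approx_symbol n \<xi>)) \<longlonglongrightarrow> ennreal (2 * norm \<xi> powr \<alpha>)"
      by (intro tendsto_intros tendsto_ennrealI approx_symbol_lim)
    then show "ennreal (2 * norm \<xi> powr \<alpha>) = liminf (\<lambda>n. ennreal (2 * approx_symbol n \<xi>))"
      by (metis lim_imp_Liminf trivial_limit_sequentially)
  qed
  also have "\<dots> \<le> liminf (\<lambda>n. \<integral>\<^sup>+\<xi>. ennreal (2 * approx_symbol n \<xi>) \<partial>spectral_measure u)"
    by (rule nn_integral_liminf) measurable
  also have "\<dots> \<le> ennreal C"
    using le' by (intro order_trans[OF Liminf_le_Limsup] Limsup_bounded) auto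
  finally show ?thesis .
qed

lemma sqdiff_integrable_n:
  assumes u: "bounded_support_fun u"
  shows "integrable (\<mu> n) (sqdiff u)"
    and "0 < s \<Longrightarrow> integrable (\<mu> n) (\<lambda>z. sqdiff u z * (1 - exp (- s * (norm z)\<^sup>2)))"
proof -
  interpret symmetric_exponent "\<mu> n" "\<lambda>\<xi>. t n * approx_symbol n \<xi>" by (rule exponent_n)
  interpret prob_space "\<mu> n" using law[of n] by (simp add: stable_law_def)
  show 1: "integrable (\<mu> n) (sqdiff u)"
    using sqdiff_bounded[OF u] by (intro integrable_const_bound[where B="4 * autocorr u 0"]) (auto simp: sqdiff_nonneg u)
  assume "0 < s"
  then have "\<bar>sqdiff u z * (1 - exp (- s * (norm z)\<^sup>2))\<bar> \<le> \<bar>sqdiff u z\<bar>" for z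
    by (auto simp: abs_mult intro!: mult_right_le_one_le)
  then show "integrable (\<mu> n) (\<lambda>z. sqdiff u z * (1 - exp (- s * (norm z)\<^sup>2)))"
    using u by (intro Bochner_Integration.integrable_bound[OF 1]) auto
qed

text \<open>
  On the frequency side the limit function dominates the approximations, and it is integrable as soon as the limit
  energy is finite.
\<close>

theorem sqdiff_limit:
  assumes u: "bounded_support_fun u" and fin: "(\<integral>\<^sup>+z. ennreal (sqdiff u z) \<partial>levy_measure \<alpha>) < \<infinity>"
  shows "integrable (levy_measure \<alpha>) (sqdiff u)"
    and "(\<lambda>n. (\<integral>z. sqdiff u z \<partial>\<mu> n) / t n) \<longlonglongrightarrow> (\<integral>z. sqdiff u z \<partial>levy_measure \<alpha>)"
proof -
  interpret L: symmetric_exponent "levy_measure \<alpha>" "\<lambda>\<xi>. norm \<xi> powr \<alpha>" by (rule exponent_levy)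
  note [measurable] = u[THEN bounded_support_fun_measurable]
  have [measurable]: "sqdiff u \<in> borel_measurable borel" using u by measurable
  show int: "integrable (levy_measure \<alpha>) (sqdiff u)"
    using fin by (intro integrableI_nonneg) (auto simp: sqdiff_nonneg)
  have "(\<lambda>n. \<integral>\<^sup>+\<xi>. ennreal (2 * approx_symbol n \<xi>) \<partial>spectral_measure u) \<longlonglongrightarrow> (\<integral>\<^sup>+\<xi>. ennreal (2 * norm \<xi> powr \<alpha>) \<partial>spectral_measure u)"
  proof (rule nn_integral_dominated_convergence[where w="\<lambda>\<xi>. ennreal (2 * norm \<xi> powr \<alpha>)"])
    show "(\<integral>\<^sup>+\<xi>. ennreal (2 * norm \<xi> powr \<alpha>) \<partial>spectral_measure u) < \<infinity>"
      using fin unfolding L.nn_integral_sqdiff[OF u] .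
    show "AE \<xi> in spectral_measure u. (\<lambda>n. ennreal (2 * approx_symbol n \<xi>)) \<longlonglongrightarrow> ennreal (2 * norm \<xi> powr \<alpha>)"
      by (intro AE_I2 tendsto_intros tendsto_ennrealI approx_symbol_lim)
  qed (use approx_symbol_le in \<open>auto intro!: AE_I2 ennreal_leI\<close>)
  then have lim: "(\<lambda>n. \<integral>\<^sup>+\<xi>. ennreal (2 * approx_symbol n \<xi>) \<partial>spectral_measure u) \<longlonglongrightarrow> ennreal (\<integral>z. sqdiff u z \<partial>levy_measure \<alpha>)"
    unfolding L.nn_integral_sqdiff[OF u, symmetric] using int by (simp add: nn_integral_eq_integral sqdiff_nonneg)
  have eq: "(\<integral>\<^sup>+\<xi>. ennreal (2 * approx_symbol n \<xi>) \<partial>spectral_measure u) = ennreal ((\<integral>z. sqdiff u z \<partial>\<mu> n) / t n)" for n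
  proof -
    have "ennreal (t n) * (\<integral>\<^sup>+\<xi>. ennreal (2 * approx_symbol n \<xi>) \<partial>spectral_measure u) = ennreal (t n) * ennreal ((\<integral>z. sqdiff u z \<partial>\<mu> n) / t n)"
      unfolding nn_integral_sqdiff_n[OF u, symmetric] using sqdiff_integrable_n(1)[OF u, of n] t_pos[of n]
      by (simp add: nn_integral_eq_integral sqdiff_nonneg flip: ennreal_mult')
    then show ?thesis using t_pos[of n] by (subst (asm) ennreal_mult_cancel_left) auto
  qed
  show "(\<lambda>n. (\<integral>z. sqdiff u z \<partial>\<mu> n) / t n) \<longlonglongrightarrow> (\<integral>z. sqdiff u z \<partial>levy_measure \<alpha>)"
    using lim unfolding eq
    by (rule tendsto_ennrealD) (auto simp: sqdiff_nonneg t_pos less_imp_le intro!: always_eventually divide_nonneg_nonneg integral_nonneg_AE)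
qed

definition approx_diff :: "nat \<Rightarrow> 'a \<times> 'a \<Rightarrow> real" where
  "approx_diff n p = approx_symbol n (fst p) + approx_symbol n (snd p)
     - approx_symbol n (fst p + snd p) / 2 - approx_symbol n (fst p - snd p) / 2"

lemma approx_diff_bounds: "0 \<le> approx_diff n p" "approx_diff n p \<le> 2 * norm (snd p) powr \<alpha>"
proof -
  interpret N: symmetric_exponent "\<mu> n" "\<lambda>\<xi>. t n * approx_symbol n \<xi>" by (rule exponent_n)
  have eq: "N.second_diff (fst p) (snd p) = t n * approx_diff n p"
    by (simp add: N.second_diff_def approx_diff_def algebra_simps)
  show "0 \<le> approx_diff n p"
    using N.second_diff_integral(2)[of "fst p" "snd p"] t_pos[of n] unfolding eq by (simp add: zero_le_mult_iff)
  have "t n * approx_diff n p \<le> t n * (2 * approx_symbol n (snd p))"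
    using N.second_diff_integral(3)[of "fst p" "snd p"] unfolding eq by (simp add: algebra_simps)
  then have "approx_diff n p \<le> 2 * approx_symbol n (snd p)"
    using t_pos[of n] by (simp only: mult_le_cancel_left_pos)
  then show "approx_diff n p \<le> 2 * norm (snd p) powr \<alpha>"
    using approx_symbol_le[of n "snd p"] by linarith
qed

lemma nn_integral_sqdiff_gauss_n:
  assumes u: "bounded_support_fun u" and s: "0 < s"
  shows "(\<integral>\<^sup>+z. ennreal (sqdiff u z * (1 - exp (- s * (norm z)\<^sup>2))) \<partial>\<mu> n) =
    ennreal (t n) * (\<integral>\<^sup>+p. ennreal (2 * approx_diff n p) \<partial>(spectral_measure u \<Otimes>\<^sub>M gauss_law s))"
proof -
  interpret N: symmetric_exponent "\<mu> n" "\<lambda>\<xi>. t n * approx_symbol n \<xi>" by (rule exponent_n)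
  have eq: "N.second_diff (fst p) (snd p) = t n * approx_diff n p" for p
    by (simp add: N.second_diff_def approx_diff_def algebra_simps)
  have [measurable]: "approx_diff n \<in> borel_measurable (borel \<Otimes>\<^sub>M borel)"
    unfolding approx_diff_def by measurable
  have "(\<integral>\<^sup>+z. ennreal (sqdiff u z * (1 - exp (- s * (norm z)\<^sup>2))) \<partial>\<mu> n) =
     (\<integral>\<^sup>+p. ennreal (t n) * ennreal (2 * approx_diff n p) \<partial>(spectral_measure u \<Otimes>\<^sub>M gauss_law s))"
    unfolding N.nn_integral_sqdiff_gauss[OF u s] eq using t_pos[of n]
    by (intro nn_integral_cong) (simp add: mult_ac flip: ennreal_mult')
  also have "\<dots> = ennreal (t n) * (\<integral>\<^sup>+p. ennreal (2 * approx_diff n p) \<partial>(spectral_measure u \<Otimes>\<^sub>M gauss_law s))"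
    by (rule nn_integral_cmult) measurable
  finally show ?thesis .
qed

text \<open>
  The weight compensates the singularity of the jump measure at the origin. On the frequency side it replaces symbols
  by their second differences, which are at most \<open>2 |\<eta>|\<^sup>\<alpha>\<close>, an integrable function of \<open>\<eta>\<close> under the Gaussian law.
\<close>

theorem sqdiff_gauss_limit:
  assumes u: "bounded_support_fun u" and s: "0 < s"
  shows "integrable (levy_measure \<alpha>) (\<lambda>z. sqdiff u z * (1 - exp (- s * (norm z)\<^sup>2)))" (is "integrable _ ?f")
    and "(\<lambda>n. (\<integral>z. sqdiff u z * (1 - exp (- s * (norm z)\<^sup>2)) \<partial>\<mu> n) / t n)
           \<longlonglongrightarrow> (\<integral>z. sqdiff u z * (1 - exp (- s * (norm z)\<^sup>2)) \<partial>levy_measure \<alpha>)"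
proof -
  interpret L: symmetric_exponent "levy_measure \<alpha>" "\<lambda>\<xi>. norm \<xi> powr \<alpha>" by (rule exponent_levy)
  interpret m: finite_measure "spectral_measure u" by (rule finite_spectral_measure[OF u])
  interpret k: prob_space "gauss_law s :: 'a measure" by (rule prob_space_gauss_law[OF s])
  let ?P = "spectral_measure u \<Otimes>\<^sub>M (gauss_law s :: 'a measure)"
  have [measurable]: "sqdiff u \<in> borel_measurable borel" using u by measurable
  have f0: "0 \<le> ?f z" for z using s by (simp add: sqdiff_nonneg)
  have [measurable]: "approx_diff n \<in> borel_measurable (borel \<Otimes>\<^sub>M borel)" for n
    unfolding approx_diff_def by measurable
  have dom: "(\<integral>\<^sup>+p. ennreal (4 * norm (snd p) powr \<alpha>) \<partial>?P) < \<infinity>"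
  proof -
    have "(\<integral>\<^sup>+p. ennreal (4 * norm (snd p) powr \<alpha>) \<partial>?P) = (\<integral>\<^sup>+\<xi>. \<integral>\<^sup>+\<eta>. ennreal (4 * norm \<eta> powr \<alpha>) \<partial>(gauss_law s :: 'a measure) \<partial>spectral_measure u)"
      by (subst k.nn_integral_fst[symmetric]) auto
    also have "\<dots> = (\<integral>\<^sup>+\<xi>. ennreal 4 * (\<integral>\<^sup>+\<eta>. ennreal (norm \<eta> powr \<alpha>) \<partial>(gauss_law s :: 'a measure)) \<partial>spectral_measure u)"
    proof (intro nn_integral_cong)
      fix \<xi>
      have "(\<integral>\<^sup>+\<eta>. ennreal (4 * norm \<eta> powr \<alpha>) \<partial>(gauss_law s :: 'a measure)) = (\<integral>\<^sup>+\<eta>. ennreal 4 * ennreal (norm \<eta> powr \<alpha>) \<partial>(gauss_law s :: 'a measure))"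
        by (intro nn_integral_cong ennreal_mult') simp
      also have "\<dots> = ennreal 4 * (\<integral>\<^sup>+\<eta>. ennreal (norm \<eta> powr \<alpha>) \<partial>(gauss_law s :: 'a measure))"
        by (rule nn_integral_cmult) measurable
      finally show "(\<integral>\<^sup>+\<eta>. ennreal (4 * norm \<eta> powr \<alpha>) \<partial>(gauss_law s :: 'a measure)) = ennreal 4 * (\<integral>\<^sup>+\<eta>. ennreal (norm \<eta> powr \<alpha>) \<partial>(gauss_law s :: 'a measure))" .
    qed
    also have "\<dots> < \<infinity>"
      using gauss_law_powr_finite[OF s \<alpha>, where 'a='a]
      by (simp add: ennreal_mult_eq_top_iff less_top[symmetric])
    finally show ?thesis .
  qed
  have "(\<lambda>n. \<integral>\<^sup>+p. ennreal (2 * approx_diff n p) \<partial>?P) \<longlonglongrightarrow> (\<integral>\<^sup>+p. ennreal (2 * L.second_diff (fst p) (snd p)) \<partial>?P)"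
  proof (rule nn_integral_dominated_convergence[where w="\<lambda>p. ennreal (4 * norm (snd p) powr \<alpha>)"])
    show "AE p in ?P. ennreal (2 * approx_diff n p) \<le> ennreal (4 * norm (snd p) powr \<alpha>)" for n
      using approx_diff_bounds(2)[of n] by (intro AE_I2 ennreal_leI) (simp add: mult_left_mono[of _ "2 * _" 2, simplified])
    show "AE p in ?P. (\<lambda>n. ennreal (2 * approx_diff n p)) \<longlonglongrightarrow> ennreal (2 * L.second_diff (fst p) (snd p))"
      unfolding approx_diff_def L.second_diff_def
      by (intro AE_I2 tendsto_ennrealI tendsto_intros approx_symbol_lim) auto
  qed (use dom in measurable)
  then have lim: "(\<lambda>n. \<integral>\<^sup>+p. ennreal (2 * approx_diff n p) \<partial>?P) \<longlonglongrightarrow> (\<integral>\<^sup>+z. ennreal (?f z) \<partial>levy_measure \<alpha>)"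
    unfolding L.nn_integral_sqdiff_gauss[OF u s] .
  have "(\<integral>\<^sup>+z. ennreal (?f z) \<partial>levy_measure \<alpha>) \<le> (\<integral>\<^sup>+p. ennreal (4 * norm (snd p) powr \<alpha>) \<partial>?P)"
    unfolding L.nn_integral_sqdiff_gauss[OF u s] using L.second_diff_integral(3) by (intro nn_integral_mono ennreal_leI) (simp add: mult_left_mono[of _ "2 * _" 2, simplified])
  also note dom
  finally show int: "integrable (levy_measure \<alpha>) ?f" using f0 by (intro integrableI_nonneg) auto
  have lim': "(\<lambda>n. \<integral>\<^sup>+p. ennreal (2 * approx_diff n p) \<partial>?P) \<longlonglongrightarrow> ennreal (\<integral>z. ?f z \<partial>levy_measure \<alpha>)"
    using lim int f0 by (simp add: nn_integral_eq_integral)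
  have eq: "(\<integral>\<^sup>+p. ennreal (2 * approx_diff n p) \<partial>?P) = ennreal ((\<integral>z. ?f z \<partial>\<mu> n) / t n)" for n
  proof -
    have "ennreal (t n) * (\<integral>\<^sup>+p. ennreal (2 * approx_diff n p) \<partial>?P) = ennreal (t n) * ennreal ((\<integral>z. ?f z \<partial>\<mu> n) / t n)"
      unfolding nn_integral_sqdiff_gauss_n[OF u s, symmetric] using sqdiff_integrable_n(2)[OF u s, of n] t_pos[of n] f0
      by (simp add: nn_integral_eq_integral flip: ennreal_mult')
    then show ?thesis using t_pos[of n] by (subst (asm) ennreal_mult_cancel_left) auto
  qed
  show "(\<lambda>n. (\<integral>z. ?f z \<partial>\<mu> n) / t n) \<longlonglongrightarrow> (\<integral>z. ?f z \<partial>levy_measure \<alpha>)"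
    using lim' unfolding eq
    by (rule tendsto_ennrealD) (use f0 t_pos in \<open>auto simp: less_imp_le intro!: always_eventually divide_nonneg_nonneg integral_nonneg_AE\<close>)
qed

end

section \<open>Weighted quadratic increments\<close>

text \<open>
  The function \<open>G\<^sub>k\<close> of the introduction.
\<close>

definition weighted_sqdiff :: "('a::euclidean_space \<Rightarrow> real) \<Rightarrow> ('a \<Rightarrow> real) \<Rightarrow> 'a \<Rightarrow> real" where
  "weighted_sqdiff w k z = (\<integral>x. (k x - k (x + z))\<^sup>2 * w x * w (x + z) \<partial>lborel)"

lemma sqdiff_integrable:
  assumes u: "bounded_support_fun u"
  shows "integrable lborel (\<lambda>x. (u x - u (x + z))\<^sup>2)"
  unfolding power2_eq_square
  by (intro bounded_support_fun_integrable bounded_support_fun_mult bounded_support_fun_diff bounded_support_fun_translate u)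

locale bounded_weighted =
  fixes w k :: "'a::euclidean_space \<Rightarrow> real" and B :: real
  assumes w: "bounded_support_fun w"
    and k[measurable]: "k \<in> borel_measurable borel"
    and k_le: "\<bar>k x\<bar> \<le> B"
begin

lemma sq_le: "(k x)\<^sup>2 \<le> B\<^sup>2"
  using power_mono[OF k_le[of x], of 2] by simp

lemma bounded_support_kw: "bounded_support_fun (\<lambda>x. k x * w x)"
  using bounded_support_fun_mult_bounded[OF w k, of B] k_le by (simp add: mult.commute)

lemma bounded_support_kkw: "bounded_support_fun (\<lambda>x. (k x)\<^sup>2 * w x)"
  using bounded_support_fun_mult_bounded[OF w, of "\<lambda>x. (k x)\<^sup>2" "B\<^sup>2"] sq_le by (simp add: mult.commute)

lemmas bounded_support_plus = bounded_support_fun_add[OF bounded_support_kkw w]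
lemmas bounded_support_minus = bounded_support_fun_diff[OF bounded_support_kkw w]

lemma weighted_integrable: "integrable lborel (\<lambda>x. (k x - k (x + z))\<^sup>2 * w x * w (x + z))"
proof -
  have [measurable]: "w \<in> borel_measurable borel" by (rule bounded_support_fun_measurable[OF w])
  have b: "\<bar>k x - k (x + z)\<bar> \<le> 2 * B" for x using k_le[of x] k_le[of "x + z"] by linarith
  have b: "\<bar>(k x - k (x + z))\<^sup>2\<bar> \<le> (2 * B)\<^sup>2" for x using power_mono[OF b[of x], of 2] by simp
  have "bounded_support_fun (\<lambda>x. (w x * w (x + z)) * (k x - k (x + z))\<^sup>2)"
    by (intro bounded_support_fun_mult_bounded[OF bounded_support_fun_mult[OF w bounded_support_fun_translate[OF w]] _ b]) measurable
  from bounded_support_fun_integrable[OF this] show ?thesis by (simp add: mult_ac)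
qed

text \<open>
  Pointwise, \<open>(a - b)\<^sup>2 p q = (a p - b q)\<^sup>2 - (a\<^sup>2 p - b\<^sup>2 q) (p - q)\<close>, and the last product is polarised into
  squares.
\<close>

lemma weighted_sqdiff_eq:
  "weighted_sqdiff w k z = sqdiff (\<lambda>x. k x * w x) z
     - (sqdiff (\<lambda>x. (k x)\<^sup>2 * w x + w x) z - sqdiff (\<lambda>x. (k x)\<^sup>2 * w x - w x) z) / 4"
proof -
  note i = sqdiff_integrable[OF bounded_support_kw, of z] sqdiff_integrable[OF bounded_support_plus, of z]
    sqdiff_integrable[OF bounded_support_minus, of z]
  have "weighted_sqdiff w k z = (\<integral>x. (k x * w x - k (x + z) * w (x + z))\<^sup>2
     - (((k x)\<^sup>2 * w x + w x - ((k (x + z))\<^sup>2 * w (x + z) + w (x + z)))\<^sup>2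
        - ((k x)\<^sup>2 * w x - w x - ((k (x + z))\<^sup>2 * w (x + z) - w (x + z)))\<^sup>2) / 4 \<partial>lborel)"
    unfolding weighted_sqdiff_def
    by (intro Bochner_Integration.integral_cong refl) (simp add: power2_eq_square algebra_simps add_divide_distrib diff_divide_distrib)
  also have "\<dots> = sqdiff (\<lambda>x. k x * w x) z
     - (sqdiff (\<lambda>x. (k x)\<^sup>2 * w x + w x) z - sqdiff (\<lambda>x. (k x)\<^sup>2 * w x - w x) z) / 4"
    unfolding sqdiff_def using i
    by (simp only: Bochner_Integration.integral_diff integral_divide_zero
        Bochner_Integration.integrable_diff integrable_divide_zero)
  finally show ?thesis .
qed

lemma measurable_weighted_sqdiff[measurable]: "weighted_sqdiff w k \<in> borel_measurable borel"
proof -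
  note [measurable] = bounded_support_kw bounded_support_plus bounded_support_minus
  show ?thesis unfolding weighted_sqdiff_eq[abs_def]
    by (intro borel_measurable_diff borel_measurable_divide measurable_sqdiff
      bounded_support_kw bounded_support_plus bounded_support_minus) auto
qed

lemma weighted_sqdiff_nonneg: "(\<And>x. 0 \<le> w x) \<Longrightarrow> 0 \<le> weighted_sqdiff w k z"
  unfolding weighted_sqdiff_def by (intro integral_nonneg_AE AE_I2) simp

text \<open>
  If \<open>w x \<le> w y\<close> then
  \<open>k x * w x - k y * w y = (k x - k y) * w x + k y * (w x - w y)\<close>, and \<open>(w x)\<^sup>2 \<le> w x * w y\<close>. So a bounded function
  of finite weighted energy times \<open>w\<close> has finite energy as soon as \<open>w\<close> has.
\<close>

lemma sqdiff_le_weighted: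
  assumes w0: "\<And>x. 0 \<le> w x"
  shows "sqdiff (\<lambda>x. k x * w x) z \<le> 2 * weighted_sqdiff w k z + 2 * B\<^sup>2 * sqdiff w z"
proof -
  have pt: "(k x * w x - k y * w y)\<^sup>2 \<le> 2 * ((k x - k y)\<^sup>2 * w x * w y) + 2 * B\<^sup>2 * (w x - w y)\<^sup>2" for x y
  proof -
    have sq: "(a + b)\<^sup>2 \<le> 2 * a\<^sup>2 + 2 * b\<^sup>2" for a b :: real
      using zero_le_power2[of "a - b"] by (simp add: power2_eq_square algebra_simps)
    \<comment> \<open>By symmetry it suffices to treat the case where the weight at \<open>x\<close> is the smaller one.\<close>
    have main: "(k x * w x - k y * w y)\<^sup>2 \<le> 2 * ((k x - k y)\<^sup>2 * w x * w y) + 2 * B\<^sup>2 * (w x - w y)\<^sup>2"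
      if le: "w x \<le> w y" for x y
    proof -
      have "(k x * w x - k y * w y)\<^sup>2 = ((k x - k y) * w x + k y * (w x - w y))\<^sup>2"
        by (simp add: algebra_simps)
      also have "\<dots> \<le> 2 * ((k x - k y) * w x)\<^sup>2 + 2 * (k y * (w x - w y))\<^sup>2" by (rule sq)
      also have "((k x - k y) * w x)\<^sup>2 = (k x - k y)\<^sup>2 * w x * w x"
        by (simp add: power2_eq_square algebra_simps)
      also have "(k x - k y)\<^sup>2 * w x * w x \<le> (k x - k y)\<^sup>2 * w x * w y"
        using le w0 by (intro mult_left_mono) auto
      also have "(k y * (w x - w y))\<^sup>2 \<le> B\<^sup>2 * (w x - w y)\<^sup>2"
        unfolding power_mult_distrib using sq_le by (intro mult_right_mono) auto
      finally show ?thesis by simp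
    qed
    show ?thesis
    proof (cases "w x \<le> w y")
      case True then show ?thesis by (rule main)
    next
      case False
      have "(k y * w y - k x * w x)\<^sup>2 \<le> 2 * ((k y - k x)\<^sup>2 * w y * w x) + 2 * B\<^sup>2 * (w y - w x)\<^sup>2"
        using False by (intro main) simp
      then show ?thesis by (simp add: power2_commute[of "k y"] power2_commute[of "w y"] power2_commute[of "k y * w y"] mult_ac)
    qed
  qed
  have "sqdiff (\<lambda>x. k x * w x) z \<le> (\<integral>x. 2 * ((k x - k (x + z))\<^sup>2 * w x * w (x + z)) + 2 * B\<^sup>2 * (w x - w (x + z))\<^sup>2 \<partial>lborel)"
    unfolding sqdiff_def
    by (intro integral_mono sqdiff_integrable[OF bounded_support_kw] pt Bochner_Integration.integrable_add
       integrable_mult_right weighted_integrable sqdiff_integrable[OF w])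
  also have "\<dots> = 2 * weighted_sqdiff w k z + 2 * B\<^sup>2 * sqdiff w z"
    unfolding weighted_sqdiff_def sqdiff_def
    using weighted_integrable sqdiff_integrable[OF w] by simp
  finally show ?thesis .
qed

lemma bounded_weighted_square:
  assumes "\<bar>c\<bar> \<le> 1"
  shows "bounded_weighted w (\<lambda>x. (k x)\<^sup>2 + c) (B\<^sup>2 + 1)"
proof
  show "\<bar>(k x)\<^sup>2 + c\<bar> \<le> B\<^sup>2 + 1" for x
    using sq_le[of x] zero_le_power2[of "k x"] assms by linarith
qed (use w in auto)

text \<open>
  The functions \<open>k\<^sup>2 \<plusminus> 1\<close> occur in the polarised form of \<open>weighted_sqdiff_eq\<close>.
\<close>

lemma weighted_sqdiff_square_le:
  assumes w0: "\<And>x. 0 \<le> w x" and c: "\<bar>c\<bar> \<le> 1"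
  shows "weighted_sqdiff w (\<lambda>x. (k x)\<^sup>2 + c) z \<le> (2 * B)\<^sup>2 * weighted_sqdiff w k z"
proof -
  have pt: "((k x)\<^sup>2 + c - ((k y)\<^sup>2 + c))\<^sup>2 * w x * w y \<le> (2 * B)\<^sup>2 * ((k x - k y)\<^sup>2 * w x * w y)" for x y
  proof -
    have "\<bar>k x + k y\<bar> \<le> 2 * B" using k_le[of x] k_le[of y] by linarith
    then have "(k x + k y)\<^sup>2 \<le> (2 * B)\<^sup>2" using power_mono[of "\<bar>k x + k y\<bar>" "2 * B" 2] by simp
    then have "(k x + k y)\<^sup>2 * ((k x - k y)\<^sup>2 * (w x * w y)) \<le> (2 * B)\<^sup>2 * ((k x - k y)\<^sup>2 * (w x * w y))"
      using w0 by (intro mult_right_mono) auto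
    moreover have "((k x)\<^sup>2 + c - ((k y)\<^sup>2 + c))\<^sup>2 = (k x + k y)\<^sup>2 * (k x - k y)\<^sup>2"
      by (simp add: power_mult_distrib[symmetric]) (simp add: power2_eq_square algebra_simps)
    ultimately show ?thesis by (simp add: mult_ac)
  qed
  interpret S: bounded_weighted w "\<lambda>x. (k x)\<^sup>2 + c" "B\<^sup>2 + 1" by (rule bounded_weighted_square[OF c])
  show ?thesis
    unfolding weighted_sqdiff_def integral_mult_right_zero[symmetric]
    by (intro integral_mono S.weighted_integrable integrable_mult_right weighted_integrable pt)
qed

end

context stable_small_time
begin

theorem weighted_gauss_limit:
  assumes "bounded_weighted w k B" and s: "0 < s"
  shows "integrable (\<mu> n) (\<lambda>z. weighted_sqdiff w k z * (1 - exp (- s * (norm z)\<^sup>2)))" (is ?A)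
    and "integrable (levy_measure \<alpha>) (\<lambda>z. weighted_sqdiff w k z * (1 - exp (- s * (norm z)\<^sup>2)))" (is ?B)
    and "(\<lambda>n. (\<integral>z. weighted_sqdiff w k z * (1 - exp (- s * (norm z)\<^sup>2)) \<partial>\<mu> n) / t n)
           \<longlonglongrightarrow> (\<integral>z. weighted_sqdiff w k z * (1 - exp (- s * (norm z)\<^sup>2)) \<partial>levy_measure \<alpha>)" (is ?C)
proof -
  interpret bounded_weighted w k B by fact
  let ?h = "\<lambda>z. 1 - exp (- s * (norm z)\<^sup>2)"
  have eq: "weighted_sqdiff w k z * ?h z = sqdiff (\<lambda>x. k x * w x) z * ?h z
     - (sqdiff (\<lambda>x. (k x)\<^sup>2 * w x + w x) z * ?h z - sqdiff (\<lambda>x. (k x)\<^sup>2 * w x - w x) z * ?h z) / 4" for z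
    unfolding weighted_sqdiff_eq by (simp add: algebra_simps diff_divide_distrib add_divide_distrib)
  note b = bounded_support_kw bounded_support_plus bounded_support_minus
  note i = sqdiff_integrable_n(2)[OF b(1) s] sqdiff_integrable_n(2)[OF b(2) s] sqdiff_integrable_n(2)[OF b(3) s]
  note j = sqdiff_gauss_limit(1)[OF b(1) s] sqdiff_gauss_limit(1)[OF b(2) s] sqdiff_gauss_limit(1)[OF b(3) s]
  show ?A unfolding eq by (intro Bochner_Integration.integrable_diff integrable_divide_zero i)
  show ?B unfolding eq by (intro Bochner_Integration.integrable_diff integrable_divide_zero j)
  have N: "(\<integral>z. weighted_sqdiff w k z * ?h z \<partial>\<mu> n) / t n = (\<integral>z. sqdiff (\<lambda>x. k x * w x) z * ?h z \<partial>\<mu> n) / t n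
     - ((\<integral>z. sqdiff (\<lambda>x. (k x)\<^sup>2 * w x + w x) z * ?h z \<partial>\<mu> n) / t n - (\<integral>z. sqdiff (\<lambda>x. (k x)\<^sup>2 * w x - w x) z * ?h z \<partial>\<mu> n) / t n) / 4" for n
    unfolding eq using i by (simp only: Bochner_Integration.integral_diff integral_divide_zero
        Bochner_Integration.integrable_diff integrable_divide_zero) (simp add: diff_divide_distrib)
  have L: "(\<integral>z. weighted_sqdiff w k z * ?h z \<partial>levy_measure \<alpha>) = (\<integral>z. sqdiff (\<lambda>x. k x * w x) z * ?h z \<partial>levy_measure \<alpha>)
     - ((\<integral>z. sqdiff (\<lambda>x. (k x)\<^sup>2 * w x + w x) z * ?h z \<partial>levy_measure \<alpha>) - (\<integral>z. sqdiff (\<lambda>x. (k x)\<^sup>2 * w x - w x) z * ?h z \<partial>levy_measure \<alpha>)) / 4"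
    unfolding eq using j by (simp only: Bochner_Integration.integral_diff integral_divide_zero
        Bochner_Integration.integrable_diff integrable_divide_zero)
  show ?C unfolding N L
    by (intro tendsto_intros sqdiff_gauss_limit(2) b s) auto
qed

text \<open>
  The three quadratic increments in \<open>weighted_sqdiff_eq\<close> have finite energy by \<open>sqdiff_le_weighted\<close>, so each
  of them converges by \<open>sqdiff_limit\<close>.
\<close>

theorem weighted_limit:
  assumes "bounded_weighted w k B" and w0: "\<And>x. 0 \<le> w x"
    and fin_w: "(\<integral>\<^sup>+z. ennreal (sqdiff w z) \<partial>levy_measure \<alpha>) < \<infinity>"
    and fin: "(\<integral>\<^sup>+z. ennreal (weighted_sqdiff w k z) \<partial>levy_measure \<alpha>) < \<infinity>"
  shows "integrable (\<mu> n) (weighted_sqdiff w k)" (is ?A)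
    and "integrable (levy_measure \<alpha>) (weighted_sqdiff w k)" (is ?B)
    and "(\<lambda>n. (\<integral>z. weighted_sqdiff w k z \<partial>\<mu> n) / t n) \<longlonglongrightarrow> (\<integral>z. weighted_sqdiff w k z \<partial>levy_measure \<alpha>)" (is ?C)
proof -
  interpret bounded_weighted w k B by fact
  have iw: "integrable (levy_measure \<alpha>) (sqdiff w)"
    by (rule sqdiff_limit(1)[OF w fin_w])
  have ik: "integrable (levy_measure \<alpha>) (weighted_sqdiff w k)"
    using fin by (intro integrableI_nonneg) (auto simp: weighted_sqdiff_nonneg w0)
  have finite: "(\<integral>\<^sup>+z. ennreal (sqdiff (\<lambda>x. l x * w x) z) \<partial>levy_measure \<alpha>) < \<infinity>"
    if l: "bounded_weighted w l B'" and le: "\<And>z. weighted_sqdiff w l z \<le> c * weighted_sqdiff w k z" for l B' c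
  proof -
    interpret l: bounded_weighted w l B' by (rule l)
    have "sqdiff (\<lambda>x. l x * w x) z \<le> 2 * (c * weighted_sqdiff w k z) + 2 * B'\<^sup>2 * sqdiff w z" for z
      using l.sqdiff_le_weighted[OF w0, of z] le[of z] by linarith
    then have "(\<integral>\<^sup>+z. ennreal (sqdiff (\<lambda>x. l x * w x) z) \<partial>levy_measure \<alpha>) \<le>
      (\<integral>\<^sup>+z. ennreal (norm (2 * (c * weighted_sqdiff w k z) + 2 * B'\<^sup>2 * sqdiff w z)) \<partial>levy_measure \<alpha>)"
      by (intro nn_integral_mono ennreal_leI) (auto intro: order_trans[OF _ abs_ge_self])
    also have "\<dots> < \<infinity>"
    proof -
      have "integrable (levy_measure \<alpha>) (\<lambda>z. 2 * (c * weighted_sqdiff w k z) + 2 * B'\<^sup>2 * sqdiff w z)"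
        using ik iw by (intro Bochner_Integration.integrable_add integrable_mult_right)
      then show ?thesis by (simp only: integrable_iff_bounded)
    qed
    finally show ?thesis .
  qed
  have f1: "(\<integral>\<^sup>+z. ennreal (sqdiff (\<lambda>x. k x * w x) z) \<partial>levy_measure \<alpha>) < \<infinity>"
    by (rule finite[of k B 1]) (use assms in auto)
  have f: "(\<integral>\<^sup>+z. ennreal (sqdiff (\<lambda>x. (k x)\<^sup>2 * w x + c * w x) z) \<partial>levy_measure \<alpha>) < \<infinity>" if "\<bar>c\<bar> \<le> 1" for c
  proof -
    have "(\<integral>\<^sup>+z. ennreal (sqdiff (\<lambda>x. ((k x)\<^sup>2 + c) * w x) z) \<partial>levy_measure \<alpha>) < \<infinity>"
      by (rule finite[OF bounded_weighted_square[OF that] weighted_sqdiff_square_le[OF w0 that]])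
    then show ?thesis by (simp add: distrib_right)
  qed
  have f2: "(\<integral>\<^sup>+z. ennreal (sqdiff (\<lambda>x. (k x)\<^sup>2 * w x + w x) z) \<partial>levy_measure \<alpha>) < \<infinity>" using f[of 1] by simp
  have f3: "(\<integral>\<^sup>+z. ennreal (sqdiff (\<lambda>x. (k x)\<^sup>2 * w x - w x) z) \<partial>levy_measure \<alpha>) < \<infinity>" using f[of "-1"] by simp
  note b = bounded_support_kw bounded_support_plus bounded_support_minus
  note i = sqdiff_integrable_n(1)[OF b(1)] sqdiff_integrable_n(1)[OF b(2)] sqdiff_integrable_n(1)[OF b(3)]
  note j = sqdiff_limit(1)[OF b(1) f1] sqdiff_limit(1)[OF b(2) f2] sqdiff_limit(1)[OF b(3) f3]
  show ?B by (rule ik)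
  show ?A unfolding weighted_sqdiff_eq by (intro Bochner_Integration.integrable_diff integrable_divide_zero i)
  have N: "(\<integral>z. weighted_sqdiff w k z \<partial>\<mu> n) / t n = (\<integral>z. sqdiff (\<lambda>x. k x * w x) z \<partial>\<mu> n) / t n
     - ((\<integral>z. sqdiff (\<lambda>x. (k x)\<^sup>2 * w x + w x) z \<partial>\<mu> n) / t n - (\<integral>z. sqdiff (\<lambda>x. (k x)\<^sup>2 * w x - w x) z \<partial>\<mu> n) / t n) / 4" for n
    unfolding weighted_sqdiff_eq using i by (simp only: Bochner_Integration.integral_diff integral_divide_zero
        Bochner_Integration.integrable_diff integrable_divide_zero) (simp add: diff_divide_distrib)
  have L: "(\<integral>z. weighted_sqdiff w k z \<partial>levy_measure \<alpha>) = (\<integral>z. sqdiff (\<lambda>x. k x * w x) z \<partial>levy_measure \<alpha>)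
     - ((\<integral>z. sqdiff (\<lambda>x. (k x)\<^sup>2 * w x + w x) z \<partial>levy_measure \<alpha>) - (\<integral>z. sqdiff (\<lambda>x. (k x)\<^sup>2 * w x - w x) z \<partial>levy_measure \<alpha>)) / 4"
    unfolding weighted_sqdiff_eq using j by (simp only: Bochner_Integration.integral_diff integral_divide_zero
        Bochner_Integration.integrable_diff integrable_divide_zero)
  show ?C unfolding N L
    by (intro tendsto_intros sqdiff_limit(2) b f1 f2 f3) auto
qed

end

section \<open>Leaving the domain costs two large jumps\<close>

context prob_space
begin

text \<open>
  Decompose at the first index \<open>k\<close> with \<open>S k \<in> G\<close>. From there the sum must still move by \<open>r\<close> to reach \<open>H\<close>, and
  that increment is independent of the past.
\<close>

lemma first_entry_bound:
  fixes Y :: "nat \<Rightarrow> 'a \<Rightarrow> 'b::euclidean_space" and n :: nat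
  defines "S \<equiv> \<lambda>k \<omega>. \<Sum>i<k. Y i \<omega>"
  assumes Y: "indep_vars (\<lambda>_. borel) Y {..<n}"
    and G: "G \<in> sets borel" and H: "H \<in> sets borel"
    and sep: "\<And>g h. g \<in> G \<Longrightarrow> h \<in> H \<Longrightarrow> r \<le> norm (h - g)"
    and q: "\<And>k. k \<le> n \<Longrightarrow> prob {\<omega>\<in>space M. r \<le> norm (S n \<omega> - S k \<omega>)} \<le> q"
  shows "prob {\<omega>\<in>space M. (\<exists>k\<le>n. S k \<omega> \<in> G) \<and> S n \<omega> \<in> H} \<le> q * prob {\<omega>\<in>space M. \<exists>k\<le>n. S k \<omega> \<in> G}"
proof -
  have Ym: "Y i \<in> borel_measurable M" if "i < n" for i
    using Y that by (auto simp: indep_vars_def)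
  have Sm[measurable]: "S k \<in> borel_measurable M" if "k \<le> n" for k
    unfolding S_def using that by (intro borel_measurable_sum Ym) auto
  define A where "A k = {\<omega>\<in>space M. S k \<omega> \<in> G \<and> (\<forall>j<k. S j \<omega> \<notin> G)}" for k
  have Am[measurable]: "A k \<in> events" if "k \<le> n" for k
  proof -
    have "A k = (S k -` G \<inter> space M) \<inter> (space M - (\<Union>j<k. S j -` G \<inter> space M))"
      by (auto simp: A_def)
    also have "\<dots> \<in> events"
      using that G by (intro sets.Int sets.Diff sets.finite_UN measurable_sets[OF Sm]) auto
    finally show ?thesis .
  qed
  have disj: "disjoint_family_on A {..n}"
    unfolding disjoint_family_on_def A_def by (auto, metis linorder_neqE_nat)
  have UA: "{\<omega>\<in>space M. \<exists>k\<le>n. S k \<omega> \<in> G} = (\<Union>k\<le>n. A k)"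
  proof safe
    fix \<omega> k assume *: "\<omega> \<in> space M" "k \<le> n" "S k \<omega> \<in> G"
    define l where "l = (LEAST k. S k \<omega> \<in> G)"
    have "S l \<omega> \<in> G" unfolding l_def using *(3) by (rule LeastI)
    moreover have "\<forall>j<l. S j \<omega> \<notin> G" unfolding l_def using not_less_Least by blast
    moreover have "l \<le> k" unfolding l_def using *(3) by (rule Least_le)
    ultimately show "\<omega> \<in> (\<Union>k\<le>n. A k)" using * by (auto simp: A_def intro!: bexI[of _ l])
  qed (auto simp: A_def)
  have ind: "prob (A k \<inter> {\<omega>\<in>space M. r \<le> norm (S n \<omega> - S k \<omega>)}) = prob (A k) * prob {\<omega>\<in>space M. r \<le> norm (S n \<omega> - S k \<omega>)}"
    if k: "k \<le> n" for k
  proof -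
    let ?X1 = "\<lambda>\<omega>. restrict (\<lambda>i. Y i \<omega>) {..<k}" and ?X2 = "\<lambda>\<omega>. restrict (\<lambda>i. Y i \<omega>) {k..<n}"
    let ?M1 = "PiM {..<k} (\<lambda>_. borel :: 'b measure)" and ?M2 = "PiM {k..<n} (\<lambda>_. borel :: 'b measure)"
    have iv: "indep_var ?M1 ?X1 ?M2 ?X2"
      using k by (intro indep_var_restrict[OF Y]) auto
    define B1 where "B1 = {f\<in>space ?M1. (\<Sum>i<k. f i) \<in> G \<and> (\<forall>j<k. (\<Sum>i<j. f i) \<notin> G)}"
    define B2 where "B2 = {f\<in>space ?M2. r \<le> norm (\<Sum>i\<in>{k..<n}. f i)}"
    have sm: "(\<lambda>f. \<Sum>i<j. f i) \<in> borel_measurable ?M1" if "j \<le> k" for j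
      using that by (intro borel_measurable_sum measurable_component_singleton) auto
    have B1: "B1 \<in> sets ?M1"
    proof -
      have "B1 = ((\<lambda>f. \<Sum>i<k. f i) -` G \<inter> space ?M1) \<inter> (space ?M1 - (\<Union>j<k. (\<lambda>f. \<Sum>i<j. f i) -` G \<inter> space ?M1))"
        by (auto simp: B1_def)
      also have "\<dots> \<in> sets ?M1"
        using G by (intro sets.Int sets.Diff sets.finite_UN measurable_sets[OF sm]) auto
      finally show ?thesis .
    qed
    have B2: "B2 \<in> sets ?M2" unfolding B2_def by measurable
    have e1: "A k = ?X1 -` B1 \<inter> space M"
    proof -
      have "(\<Sum>i<j. ?X1 \<omega> i) = S j \<omega>" if "j \<le> k" for j \<omega>
        using that unfolding S_def by (intro sum.cong) auto
      then show ?thesis by (auto simp: A_def B1_def space_PiM)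
    qed
    have e2: "{\<omega>\<in>space M. r \<le> norm (S n \<omega> - S k \<omega>)} = ?X2 -` B2 \<inter> space M"
    proof -
      have "(\<Sum>i\<in>{k..<n}. ?X2 \<omega> i) = S n \<omega> - S k \<omega>" for \<omega>
      proof -
        have "S n \<omega> = S k \<omega> + (\<Sum>i\<in>{k..<n}. Y i \<omega>)"
          unfolding S_def using k by (subst sum.union_disjoint[symmetric]) (auto simp: ivl_disj_un intro!: sum.cong)
        then show ?thesis by simp
      qed
      then show ?thesis by (auto simp: B2_def space_PiM)
    qed
    have "prob ((\<lambda>\<omega>. (?X1 \<omega>, ?X2 \<omega>)) -` (B1 \<times> B2) \<inter> space M) = prob (?X1 -` B1 \<inter> space M) * prob (?X2 -` B2 \<inter> space M)"
      by (rule indep_varD[OF iv B1 B2])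
    also have "(\<lambda>\<omega>. (?X1 \<omega>, ?X2 \<omega>)) -` (B1 \<times> B2) \<inter> space M = A k \<inter> {\<omega>\<in>space M. r \<le> norm (S n \<omega> - S k \<omega>)}"
      unfolding e1 e2 by auto
    finally show ?thesis unfolding e1 e2 .
  qed
  have "{\<omega>\<in>space M. (\<exists>k\<le>n. S k \<omega> \<in> G) \<and> S n \<omega> \<in> H} \<subseteq> (\<Union>k\<le>n. A k \<inter> {\<omega>\<in>space M. r \<le> norm (S n \<omega> - S k \<omega>)})"
  proof
    fix \<omega> assume "\<omega> \<in> {\<omega>\<in>space M. (\<exists>k\<le>n. S k \<omega> \<in> G) \<and> S n \<omega> \<in> H}"
    then have *: "\<omega> \<in> (\<Union>k\<le>n. A k)" "S n \<omega> \<in> H" "\<omega> \<in> space M" using UA by auto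
    then obtain k where "k \<le> n" "\<omega> \<in> A k" by auto
    moreover from this have "r \<le> norm (S n \<omega> - S k \<omega>)" using * by (intro sep) (auto simp: A_def)
    ultimately show "\<omega> \<in> (\<Union>k\<le>n. A k \<inter> {\<omega>\<in>space M. r \<le> norm (S n \<omega> - S k \<omega>)})" using * by auto
  qed
  then have "prob {\<omega>\<in>space M. (\<exists>k\<le>n. S k \<omega> \<in> G) \<and> S n \<omega> \<in> H} \<le> prob (\<Union>k\<le>n. A k \<inter> {\<omega>\<in>space M. r \<le> norm (S n \<omega> - S k \<omega>)})"
    by (intro finite_measure_mono) (auto intro!: sets.finite_UN sets.Int Am)
  also have "\<dots> = (\<Sum>k\<le>n. prob (A k \<inter> {\<omega>\<in>space M. r \<le> norm (S n \<omega> - S k \<omega>)}))"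
    using disj by (intro finite_measure_finite_Union) (auto simp: disjoint_family_on_def intro!: sets.Int Am)
  also have "\<dots> \<le> (\<Sum>k\<le>n. q * prob (A k))"
    using q by (intro sum_mono) (auto simp: ind mult.commute[of q] intro!: mult_left_mono)
  also have "\<dots> = q * prob (\<Union>k\<le>n. A k)"
    unfolding sum_distrib_left[symmetric] using disj by (subst finite_measure_finite_Union) auto
  finally show ?thesis unfolding UA .
qed

end

context symmetric_stable_process
begin

lemma law_X:
  assumes t: "0 \<le> t"
  shows "stable_law \<alpha> t (distr M borel (X t))"
proof -
  have [measurable]: "X t \<in> borel_measurable M" by (rule measurable_X[OF t])
  interpret D: prob_space "distr M borel (X t)" by (rule prob_space_distr) measurable
  have "(\<integral>z. cos (\<xi> \<bullet> z) \<partial>distr M borel (X t)) = exp (- (t * norm \<xi> powr \<alpha>))" for \<xi>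
  proof -
    have i: "complex_integrable M (\<lambda>\<omega>. iexp (\<xi> \<bullet> X t \<omega>))"
      by (rule integrable_const_bound[where B=1]) auto
    have "(\<integral>z. cos (\<xi> \<bullet> z) \<partial>distr M borel (X t)) = (\<integral>\<omega>. Re (iexp (\<xi> \<bullet> X t \<omega>)) \<partial>M)"
      by (subst integral_distr) (auto simp: Re_exp)
    also have "\<dots> = Re (CLINT \<omega>|M. iexp (\<xi> \<bullet> X t \<omega>))" by (rule integral_Re[OF i])
    also have "\<dots> = exp (- (t * norm \<xi> powr \<alpha>))" by (subst char_X[OF t]) simp
    finally show ?thesis .
  qed
  then show ?thesis by (simp add: stable_law_def D.prob_space_axioms)
qed

lemma prob_increment:
  assumes "0 \<le> s" "s \<le> t" and A: "A \<in> sets borel"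
  shows "prob {\<omega>\<in>space M. X t \<omega> - X s \<omega> \<in> A} = measure (distr M borel (X (t - s))) A"
proof -
  have [measurable]: "X t \<in> borel_measurable M" "X s \<in> borel_measurable M"
    using assms by (auto intro: measurable_X)
  have "distr M borel (\<lambda>\<omega>. X (s + (t - s)) \<omega> - X s \<omega>) = distr M borel (X (t - s))"
    using assms by (intro stationary_increments) auto
  then have "measure (distr M borel (X (t - s))) A = measure (distr M borel (\<lambda>\<omega>. X t \<omega> - X s \<omega>)) A"
    by simp
  also have "\<dots> = prob {\<omega>\<in>space M. X t \<omega> - X s \<omega> \<in> A}"
    using A by (subst measure_distr) (auto simp: vimage_def Int_def conj_commute)
  finally show ?thesis by simp
qed

text \<open>
  The paths on the grid of mesh \<open>t / n\<close> that visit \<open>G\<close> and end in \<open>H\<close>. Positions are relative to \<open>X 0\<close>, which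
  vanishes only almost surely.
\<close>

definition visits :: "real \<Rightarrow> nat \<Rightarrow> (real ^ 'd) set \<Rightarrow> (real ^ 'd) set \<Rightarrow> 'w set" where
  "visits t n G H = {\<omega>\<in>space M. (\<exists>k\<le>n. X (real k * t / real n) \<omega> - X 0 \<omega> \<in> G) \<and> X t \<omega> - X 0 \<omega> \<in> H}"

lemma visits_measurable[measurable]:
  assumes t: "0 < t" and [measurable]: "G \<in> sets borel" "H \<in> sets borel"
  shows "visits t n G H \<in> events"
proof -
  have [measurable]: "X (real k * t / real n) \<in> borel_measurable M" for k using t by (intro measurable_X) auto
  have [measurable]: "X t \<in> borel_measurable M" "X 0 \<in> borel_measurable M" using t by (auto intro: measurable_X)
  show ?thesis unfolding visits_def by measurable
qed

lemma grid_bound: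
  assumes t: "0 < t" and n: "0 < n" and G: "G \<in> sets borel" and H: "H \<in> sets borel"
    and sep: "\<And>g h. g \<in> G \<Longrightarrow> h \<in> H \<Longrightarrow> r \<le> norm (h - g)"
    and q: "\<And>s. 0 \<le> s \<Longrightarrow> s \<le> t \<Longrightarrow> measure (distr M borel (X s)) {z. r \<le> norm z} \<le> q"
  shows "prob (visits t n G H) \<le> q * prob (visits t n G UNIV)"
proof -
  define \<tau> where "\<tau> i = real i * t / real n" for i
  define Y where "Y i \<omega> = X (\<tau> (Suc i)) \<omega> - X (\<tau> i) \<omega>" for i \<omega>
  have \<tau>n: "\<tau> n = t" "\<tau> 0 = 0" using n by (auto simp: \<tau>_def)
  have \<tau>: "0 \<le> \<tau> i" for i using t by (simp add: \<tau>_def)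
  have \<tau>le: "\<tau> i \<le> t" if "i \<le> n" for i
    using that t n by (simp add: \<tau>_def field_simps mult_left_mono)
  have mono: "mono \<tau>" using t by (auto simp: mono_def \<tau>_def intro!: divide_right_mono mult_right_mono)
  have ind: "indep_vars (\<lambda>_. borel) Y {..<n}"
    unfolding Y_def using indep_increments[OF \<tau> mono] by simp
  have S: "(\<Sum>i<k. Y i \<omega>) = X (\<tau> k) \<omega> - X 0 \<omega>" for k \<omega>
    unfolding Y_def by (subst sum_lessThan_telescope) (simp add: \<tau>n)
  have "prob {\<omega>\<in>space M. (\<exists>k\<le>n. (\<Sum>i<k. Y i \<omega>) \<in> G) \<and> (\<Sum>i<n. Y i \<omega>) \<in> H} \<le> q * prob {\<omega>\<in>space M. \<exists>k\<le>n. (\<Sum>i<k. Y i \<omega>) \<in> G}"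
  proof (rule first_entry_bound[OF ind G H sep])
    fix k assume k: "k \<le> n"
    have "{\<omega> \<in> space M. r \<le> norm ((\<Sum>i<n. Y i \<omega>) - (\<Sum>i<k. Y i \<omega>))} = {\<omega>\<in>space M. X t \<omega> - X (\<tau> k) \<omega> \<in> {z. r \<le> norm z}}"
      unfolding S by (simp add: \<tau>n)
    also have "prob \<dots> = measure (distr M borel (X (t - \<tau> k))) {z. r \<le> norm z}"
      using \<tau>le[OF k] \<tau> by (intro prob_increment) auto
    also have "\<dots> \<le> q" using \<tau>le[OF k] \<tau> by (intro q) auto
    finally show "prob {\<omega> \<in> space M. r \<le> norm ((\<Sum>i<n. Y i \<omega>) - (\<Sum>i<k. Y i \<omega>))} \<le> q" .
  qed
  then show ?thesis unfolding S visits_def by (simp add: \<tau>n) (simp add: \<tau>_def)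
qed

text \<open>
  Ottaviani's inequality. A walk that has reached distance \<open>2 r\<close> either ends outside the ball of radius \<open>r\<close> or travels
  back by \<open>r\<close>; the second case is controlled by \<open>grid_bound\<close> and absorbed in the left-hand side.
\<close>

lemma maximal_inequality:
  assumes t: "0 < t" and n: "0 < n" and q2: "q \<le> 1 / 2"
    and q: "\<And>s. 0 \<le> s \<Longrightarrow> s \<le> t \<Longrightarrow> measure (distr M borel (X s)) {z. r \<le> norm z} \<le> q"
  shows "prob (visits t n {z. 2 * r \<le> norm z} UNIV) \<le> 2 * q"
proof -
  let ?G = "{z::real^'d. 2 * r \<le> norm z}" and ?H = "{z::real^'d. norm z < r}"
  have G: "?G \<in> sets borel" "?H \<in> sets borel" by auto
  have le: "prob (visits t n ?G ?H) \<le> q * prob (visits t n ?G UNIV)"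
  proof (rule grid_bound[OF t n G _ q])
    fix g h :: "real ^ 'd" assume "g \<in> ?G" "h \<in> ?H"
    then show "r \<le> norm (h - g)" using norm_triangle_ineq2[of g h] by (simp add: norm_minus_commute)
  qed
  have Xm[measurable]: "X t \<in> borel_measurable M" "X 0 \<in> borel_measurable M" using t by (auto intro: measurable_X)
  let ?R = "{\<omega>\<in>space M. X t \<omega> - X 0 \<omega> \<in> {z. r \<le> norm z}}"
  have "prob (visits t n ?G UNIV) \<le> prob (visits t n ?G ?H \<union> ?R)"
    using t by (intro finite_measure_mono sets.Un visits_measurable) (auto simp: visits_def not_less)
  also have "\<dots> \<le> prob (visits t n ?G ?H) + prob ?R"
    using t by (intro measure_Un_le visits_measurable) auto
  also have "prob ?R = measure (distr M borel (X (t - 0))) {z. r \<le> norm z}"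
    using t by (intro prob_increment) auto
  also have "\<dots> \<le> q" using t by (intro q) auto
  also have "prob (visits t n ?G ?H) \<le> (1 / 2) * prob (visits t n ?G UNIV)"
    using le q2 by (meson measure_nonneg mult_right_mono order_trans)
  finally show ?thesis by simp
qed

lemma less_exit_timeD: "ereal t < exit_time D p \<Longrightarrow> 0 \<le> s \<Longrightarrow> s \<le> t \<Longrightarrow> p s \<in> D"
  unfolding exit_time_def by (rule ccontr) (auto simp: not_less dest!: less_INF_D)

text \<open>
  As \<open>D\<close> is open, a right-continuous path that is in \<open>D\<close> at time \<open>t\<close> stays there for a while, so the infimum
  defining the exit time cannot equal \<open>t\<close> unless the path has already left \<open>D\<close>.
\<close>

lemma exit_by_time:
  assumes D: "open D" and t: "0 \<le> t" and rc: "continuous (at_right t) p"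
    and not: "\<not> ereal t < exit_time D p"
  obtains s where "0 \<le> s" "s \<le> t" "p s \<notin> D"
proof -
  have "\<exists>s. 0 \<le> s \<and> s \<le> t \<and> p s \<notin> D"
  proof (rule ccontr)
    assume *: "\<not> ?thesis"
    then have "p t \<in> D" using t by auto
    have "(p \<longlongrightarrow> p t) (at_right t)" using rc by (simp add: continuous_within)
    then have "eventually (\<lambda>s. p s \<in> D) (at_right t)" by (rule topological_tendstoD[OF _ D \<open>p t \<in> D\<close>])
    then obtain b where b: "t < b" "\<And>s. t < s \<Longrightarrow> s < b \<Longrightarrow> p s \<in> D"
      by (auto simp: eventually_at_right_field)
    have "ereal b \<le> exit_time D p"
      unfolding exit_time_def
    proof (rule INF_greatest)
      fix s assume "s \<in> {s. 0 \<le> s \<and> p s \<notin> D}"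
      then show "ereal b \<le> ereal s" using * b(2)[of s] by force
    qed
    moreover have "ereal t < ereal b" using b by simp
    ultimately show False using not by (meson less_le_trans)
  qed
  then show thesis using that by blast
qed

text \<open>
  A path that starts in \<open>K\<close>, has left \<open>D\<close> by time \<open>t\<close> and is in \<open>K\<close> at time \<open>t\<close> visits a point outside \<open>D\<close> in
  between. By right-continuity all sufficiently fine grids then contain a
  time at which the path is far from \<open>K\<close>, and from there it returns to \<open>K\<close>. Reaching such a position and coming back
  each have probability \<open>O(t)\<close>, uniformly in the grid. The event is covered by a measurable set \<open>E\<close>, because it need
  not belong to the sigma-algebra of \<open>M\<close> itself.
\<close>

theorem two_jump_bound:
  fixes K D :: "(real ^ 'd) set"
  assumes \<alpha>: "0 < \<alpha>" "\<alpha> < 2" and D: "open D" and K: "compact K" "K \<subseteq> D"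
  obtains C t0 where "0 \<le> C" "0 < t0"
    "\<And>t x. 0 < t \<Longrightarrow> t \<le> t0 \<Longrightarrow> x \<in> K \<Longrightarrow>
      \<exists>E\<in>events. prob E \<le> C * t\<^sup>2 \<and>
        (AE \<omega> in M. x + X t \<omega> \<in> K \<and> \<not> ereal t < exit_time D (\<lambda>s. x + X s \<omega>) \<longrightarrow> \<omega> \<in> E)"
proof -
  obtain \<delta> where \<delta>: "0 < \<delta>" and KD: "(\<Union>y\<in>K. ball y \<delta>) \<subseteq> D"
    using compact_subset_open_imp_ball_epsilon_subset[OF K(1) D K(2)] by blast
  \<comment> \<open>The exit point has distance at least \<open>\<delta>\<close> from \<open>K\<close>, nearby grid positions at least \<open>\<delta> / 2 = 2 * r\<close>, and
    Ottaviani's inequality bounds displacements by \<open>2 * r\<close> through displacements by \<open>r\<close>.\<close>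
  define r where "r = \<delta> / 4"
  have r: "0 < r" using \<delta> by (simp add: r_def)
  obtain C where C: "0 \<le> C" and tail: "\<And>t (\<mu> :: (real^'d) measure). 0 \<le> t \<Longrightarrow> stable_law \<alpha> t \<mu> \<Longrightarrow> measure \<mu> {z. r \<le> norm z} \<le> C * t"
    using stable_law_tail[OF \<alpha> r, where 'a="real^'d"] by blast
  \<comment> \<open>up to this time the tail probability \<open>C * t\<close> is at most \<open>1/2\<close>, as Ottaviani's inequality requires\<close>
  define t0 where "t0 = 1 / (2 * (C + 1))"
  have t0: "0 < t0" using C by (simp add: t0_def)
  show thesis
  proof (rule that[of "2 * C\<^sup>2" t0])
    fix t x assume t: "0 < t" "t \<le> t0" and x: "x \<in> K"
    have q2: "C * t \<le> 1 / 2"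
    proof -
      have "C * t \<le> C * t0" using C t by (intro mult_left_mono)
      also have "\<dots> \<le> 1 / 2" using C by (simp add: t0_def field_simps)
      finally show ?thesis .
    qed
    have q: "measure (distr M borel (X s)) {z. r \<le> norm z} \<le> C * t" if "0 \<le> s" "s \<le> t" for s
      using tail[OF that(1) law_X[OF that(1)]] mult_left_mono[OF that(2) C] by linarith
    define G where "G = {v. 2 * r \<le> infdist (x + v) K}"
    define H where "H = {v. x + v \<in> K}"
    have Gb: "G \<in> sets borel" unfolding G_def by (intro borel_closed closed_Collect_le continuous_intros)
    have Hb: "H \<in> sets borel"
    proof -
      have "H = (\<lambda>v. x + v) -` K \<inter> space borel" by (auto simp: H_def)
      also have "\<dots> \<in> sets borel" by (rule measurable_sets[OF _ borel_closed[OF compact_imp_closed[OF K(1)]]]) measurable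
      finally show ?thesis .
    qed
    have sep: "r \<le> norm (h - g)" if "g \<in> G" "h \<in> H" for g h
    proof -
      have "infdist (x + g) K \<le> dist (x + g) (x + h)" using that by (intro infdist_le) (auto simp: H_def)
      then show ?thesis using that r by (auto simp: G_def dist_norm norm_minus_commute)
    qed
    define E where "E n = visits t (Suc n) G H" for n
    have En: "E n \<in> events" for n using t Gb Hb by (simp add: E_def)
    have PE: "prob (E n) \<le> 2 * C\<^sup>2 * t\<^sup>2" for n
    proof -
      have "prob (E n) \<le> C * t * prob (visits t (Suc n) G UNIV)"
        unfolding E_def by (rule grid_bound[OF t(1) _ Gb Hb sep q]) auto
      also have "prob (visits t (Suc n) G UNIV) \<le> prob (visits t (Suc n) {z. 2 * r \<le> norm z} UNIV)"
      proof (intro finite_measure_mono visits_measurable t)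
        have "G \<subseteq> {z. 2 * r \<le> norm z}"
        proof
          fix v assume "v \<in> G"
          moreover have "infdist (x + v) K \<le> dist (x + v) x" using x by (rule infdist_le)
          ultimately show "v \<in> {z. 2 * r \<le> norm z}" by (auto simp: G_def dist_norm)
        qed
        then show "visits t (Suc n) G UNIV \<subseteq> visits t (Suc n) {z. 2 * r \<le> norm z} UNIV"
          unfolding visits_def by blast
      qed auto
      also have "\<dots> \<le> 2 * (C * t)" by (rule maximal_inequality[OF t(1) _ q2 q]) auto
      also have "C * t * (2 * (C * t)) = 2 * C\<^sup>2 * t\<^sup>2" by (simp add: power2_eq_square)
      finally show ?thesis using C t by (simp add: mult_left_mono)
    qed
    define F where "F m = (\<Inter>n\<in>{m..}. E n)" for m
    have Fm: "F m \<in> events" for m unfolding F_def using En by (intro sets.countable_INT') auto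
    have inc: "incseq F" unfolding F_def by (intro monoI INF_superset_mono) auto
    have "(\<lambda>m. prob (F m)) \<longlonglongrightarrow> prob (\<Union>m. F m)"
      using Fm inc by (intro finite_Lim_measure_incseq) auto
    moreover have "prob (F m) \<le> 2 * C\<^sup>2 * t\<^sup>2" for m
    proof -
      have "prob (F m) \<le> prob (E m)" by (intro finite_measure_mono En) (auto simp: F_def)
      then show ?thesis using PE[of m] by linarith
    qed
    ultimately have P: "prob (\<Union>m. F m) \<le> 2 * C\<^sup>2 * t\<^sup>2"
      by (intro LIMSEQ_le_const2[where X="\<lambda>m. prob (F m)"]) auto
    have "AE \<omega> in M. x + X t \<omega> \<in> K \<and> \<not> ereal t < exit_time D (\<lambda>s. x + X s \<omega>) \<longrightarrow> \<omega> \<in> (\<Union>m. F m)"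
      using cadlag start_zero AE_space
    proof eventually_elim
      fix \<omega>
      assume cad: "(\<forall>t\<ge>0. continuous (at_right t) (\<lambda>s. X s \<omega>)) \<and> (\<forall>t>0. \<exists>l. ((\<lambda>s. X s \<omega>) \<longlongrightarrow> l) (at_left t))"
        and X0: "X 0 \<omega> = 0" and sp: "\<omega> \<in> space M"
      show "x + X t \<omega> \<in> K \<and> \<not> ereal t < exit_time D (\<lambda>s. x + X s \<omega>) \<longrightarrow> \<omega> \<in> (\<Union>m. F m)"
      proof (safe)
        assume XK: "x + X t \<omega> \<in> K" and not: "\<not> ereal t < exit_time D (\<lambda>s. x + X s \<omega>)"
        have "continuous (at_right t) (\<lambda>s. x + X s \<omega>)" using cad t by (intro continuous_intros) auto
        from exit_by_time[OF D less_imp_le[OF t(1)] this not]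
        obtain s where s: "0 \<le> s" "s \<le> t" "x + X s \<omega> \<notin> D" by blast
        \<comment> \<open>The exit time \<open>s\<close> is rounded up to the grid, because the path is only known to be continuous from the right.\<close>
        define k where "k n = nat \<lceil>s * real (Suc n) / t\<rceil>" for n
        have knn: "0 \<le> \<lceil>s * real (Suc n) / t\<rceil>" for n
        proof -
          have "(0::real) \<le> s * real (Suc n) / t" using s t by (intro divide_nonneg_pos mult_nonneg_nonneg) auto
          then show ?thesis by linarith
        qed
        have k1: "s * real (Suc n) / t \<le> real (k n)" "real (k n) < s * real (Suc n) / t + 1" for n
          unfolding k_def using knn[of n] by linarith+
        have kle: "k n \<le> Suc n" for n
        proof -
          have "s * real (Suc n) / t \<le> real (Suc n)"
            using s t by (simp add: divide_le_eq mult.commute mult_left_mono)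
          then have "real (k n) < real (Suc n) + 1" using k1(2)[of n] by linarith
          then show ?thesis by linarith
        qed
        define \<sigma> where "\<sigma> n = real (k n) * t / real (Suc n)" for n
        have \<sigma>1: "s \<le> \<sigma> n" for n
          using k1(1)[of n] t by (simp add: \<sigma>_def field_simps)
        have \<sigma>2: "\<sigma> n \<le> s + t / real (Suc n)" for n
        proof -
          have "real (k n) * t \<le> (s * real (Suc n) / t + 1) * t" using k1(2)[of n] t by (intro mult_right_mono) auto
          also have "\<dots> = s * real (Suc n) + t" using t by (simp add: distrib_right)
          finally have "\<sigma> n \<le> (s * real (Suc n) + t) / real (Suc n)" unfolding \<sigma>_def by (intro divide_right_mono) auto
          also have "\<dots> = s + t / real (Suc n)" by (simp add: add_divide_distrib)
          finally show ?thesis .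
        qed
        have \<sigma>lim: "\<sigma> \<longlonglongrightarrow> s"
        proof (rule tendsto_sandwich[of "\<lambda>_. s" \<sigma> sequentially "\<lambda>n. s + t / real (Suc n)"])
          have "(\<lambda>n. t / real (Suc n)) \<longlonglongrightarrow> 0" 
            using tendsto_mult_left[OF LIMSEQ_inverse_real_of_nat, of t] by (simp add: divide_inverse)
          then show "(\<lambda>n. s + t / real (Suc n)) \<longlonglongrightarrow> s" using tendsto_add[OF tendsto_const] by fastforce
        qed (use \<sigma>1 \<sigma>2 in auto)
        have "(\<lambda>n. X (\<sigma> n) \<omega>) \<longlonglongrightarrow> X s \<omega>"
        proof -
          have "continuous (at s within {s..}) (\<lambda>s. X s \<omega>)"
            using cad s(1) by (simp add: continuous_within at_within_Ici_at_right)
          then have "((\<lambda>s. X s \<omega>) \<circ> \<sigma>) \<longlonglongrightarrow> X s \<omega>"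
            unfolding continuous_within_sequentially using \<sigma>1 \<sigma>lim by (metis atLeast_iff)
          then show ?thesis by (simp add: comp_def)
        qed
        then have lim: "(\<lambda>n. infdist (x + X (\<sigma> n) \<omega>) K) \<longlonglongrightarrow> infdist (x + X s \<omega>) K"
          by (intro tendsto_intros)
        have "\<delta> \<le> infdist (x + X s \<omega>) K"
          unfolding infdist_def using x
        proof (simp, intro conjI impI cINF_greatest)
          fix y assume "y \<in> K"
          then show "\<delta> \<le> dist (x + X s \<omega>) y" using KD s(3) by (force simp: dist_commute not_le)
        qed auto
        then have "2 * r < infdist (x + X s \<omega>) K" using \<delta> by (simp add: r_def)
        then have "eventually (\<lambda>n. 2 * r < infdist (x + X (\<sigma> n) \<omega>) K) sequentially"
          using lim by (rule order_tendstoD(1)[rotated])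
        then obtain m where m: "\<And>n. m \<le> n \<Longrightarrow> 2 * r < infdist (x + X (\<sigma> n) \<omega>) K"
          by (auto simp: eventually_sequentially)
        have "\<omega> \<in> E n" if "m \<le> n" for n
          unfolding E_def visits_def G_def H_def
          using m[OF that] kle[of n] XK sp X0 by (auto simp: \<sigma>_def intro!: exI[of _ "k n"] less_imp_le)
        then have "\<omega> \<in> F m" by (auto simp: F_def)
        then show "\<omega> \<in> (\<Union>m. F m)" by blast
      qed
    qed
    with P Fm show "\<exists>E\<in>events. prob E \<le> 2 * C\<^sup>2 * t\<^sup>2 \<and>
        (AE \<omega> in M. x + X t \<omega> \<in> K \<and> \<not> ereal t < exit_time D (\<lambda>s. x + X s \<omega>) \<longrightarrow> \<omega> \<in> E)"
      by (intro bexI[of _ "\<Union>m. F m"]) auto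
  qed (use t0 in auto)
qed

end

section \<open>Expansion of the killed semigroup in eigenfunctions\<close>

text \<open>
  The discriminant of the nonnegative quadratic \<open>r \<mapsto> \<integral> (f - r g)\<^sup>2\<close>.
\<close>

lemma integral_Cauchy_Schwarz:
  fixes f g :: "'a \<Rightarrow> real"
  assumes [measurable]: "f \<in> borel_measurable M" "g \<in> borel_measurable M"
    and f: "integrable M (\<lambda>x. (f x)\<^sup>2)" and g: "integrable M (\<lambda>x. (g x)\<^sup>2)"
  shows "integrable M (\<lambda>x. f x * g x)" and "(\<integral>x. f x * g x \<partial>M)\<^sup>2 \<le> (\<integral>x. (f x)\<^sup>2 \<partial>M) * (\<integral>x. (g x)\<^sup>2 \<partial>M)"
proof -
  have le: "\<bar>a * b\<bar> \<le> a\<^sup>2 + b\<^sup>2" for a b :: real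
    using sum_squares_bound[of "\<bar>a\<bar>" "\<bar>b\<bar>"] abs_ge_zero[of "a * b"] unfolding abs_mult power2_abs by linarith
  show fg: "integrable M (\<lambda>x. f x * g x)"
    by (rule Bochner_Integration.integrable_bound[OF Bochner_Integration.integrable_add[OF f g]])
       (use le in \<open>auto intro!: AE_I2\<close>)
  let ?A = "\<integral>x. (f x)\<^sup>2 \<partial>M" and ?B = "\<integral>x. (g x)\<^sup>2 \<partial>M" and ?C = "\<integral>x. f x * g x \<partial>M"
  have quad: "0 \<le> ?A - 2 * r * ?C + r\<^sup>2 * ?B" for r
  proof -
    have "0 \<le> (\<integral>x. (f x - r * g x)\<^sup>2 \<partial>M)" by simp
    also have "\<dots> = (\<integral>x. (f x)\<^sup>2 - 2 * r * (f x * g x) + r\<^sup>2 * (g x)\<^sup>2 \<partial>M)"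
      by (intro Bochner_Integration.integral_cong refl) (simp add: power2_eq_square algebra_simps)
    also have "\<dots> = ?A - 2 * r * ?C + r\<^sup>2 * ?B" using f g fg by simp
    finally show ?thesis .
  qed
  have B0: "0 \<le> ?B" by simp
  show "?C\<^sup>2 \<le> ?A * ?B"
  proof (cases "?B = 0")
    case True
    have "?C = 0"
    proof (rule ccontr)
      assume "?C \<noteq> 0"
      then show False using quad[of "(?A + 1) / (2 * ?C)"] True by (simp add: field_simps)
    qed
    then show ?thesis using True by simp
  next
    case False
    then have B: "0 < ?B" using B0 by linarith
    have "0 \<le> (?A - 2 * (?C / ?B) * ?C + (?C / ?B)\<^sup>2 * ?B) * ?B"
      using quad[of "?C / ?B"] B by (intro mult_nonneg_nonneg) auto
    also have "\<dots> = ?A * ?B - ?C\<^sup>2" using B by (simp add: power2_eq_square field_simps)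
    finally show ?thesis by simp
  qed
qed

lemma L2_limit_inner:
  fixes h f :: "'a \<Rightarrow> real" and s :: "nat \<Rightarrow> 'a \<Rightarrow> real"
  assumes [measurable]: "h \<in> borel_measurable M" "f \<in> borel_measurable M" "\<And>N. s N \<in> borel_measurable M"
    and i: "\<And>N. integrable M (\<lambda>x. (h x - s N x)\<^sup>2)" "integrable M (\<lambda>x. (f x)\<^sup>2)" "integrable M (\<lambda>x. (h x)\<^sup>2)"
    and s: "\<And>N. integrable M (\<lambda>x. s N x * f x)"
    and lim: "(\<lambda>N. \<integral>x. (h x - s N x)\<^sup>2 \<partial>M) \<longlonglongrightarrow> 0"
  shows "(\<lambda>N. \<integral>x. s N x * f x \<partial>M) \<longlonglongrightarrow> (\<integral>x. h x * f x \<partial>M)"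
proof -
  have hf: "integrable M (\<lambda>x. h x * f x)" by (intro integral_Cauchy_Schwarz i) measurable
  have "(\<lambda>N. (\<integral>x. (h x - s N x) * f x \<partial>M)\<^sup>2) \<longlonglongrightarrow> 0"
  proof (rule tendsto_sandwich[where f="\<lambda>_. 0" and h="\<lambda>N. (\<integral>x. (h x - s N x)\<^sup>2 \<partial>M) * (\<integral>x. (f x)\<^sup>2 \<partial>M)"])
    show "(\<lambda>N. (\<integral>x. (h x - s N x)\<^sup>2 \<partial>M) * (\<integral>x. (f x)\<^sup>2 \<partial>M)) \<longlonglongrightarrow> 0"
      using tendsto_mult_right[OF lim] by simp
  qed (auto intro!: always_eventually integral_Cauchy_Schwarz i)
  then have "(\<lambda>N. sqrt ((\<integral>x. (h x - s N x) * f x \<partial>M)\<^sup>2)) \<longlonglongrightarrow> sqrt 0"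
    by (intro tendsto_real_sqrt)
  then have "(\<lambda>N. \<integral>x. (h x - s N x) * f x \<partial>M) \<longlonglongrightarrow> 0"
    by (simp add: tendsto_rabs_zero_iff)
  then have "(\<lambda>N. (\<integral>x. h x * f x \<partial>M) - (\<integral>x. (h x - s N x) * f x \<partial>M)) \<longlonglongrightarrow> (\<integral>x. h x * f x \<partial>M) - 0"
    by (intro tendsto_intros)
  moreover have "(\<integral>x. h x * f x \<partial>M) - (\<integral>x. (h x - s N x) * f x \<partial>M) = (\<integral>x. s N x * f x \<partial>M)" for N
    using hf s by (simp add: left_diff_distrib)
  ultimately show ?thesis by simp
qed

locale killed_spectrum = symmetric_stable_process M X \<alpha>
  for M :: "'w measure" and X :: "real \<Rightarrow> 'w \<Rightarrow> real ^ 'd" and \<alpha> :: real +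
  fixes D :: "(real ^ 'd) set" and lam :: "nat \<Rightarrow> real" and \<phi> :: "nat \<Rightarrow> real ^ 'd \<Rightarrow> real"
  assumes \<alpha>: "0 < \<alpha>" "\<alpha> < 2"
    and D: "open D" "bounded D"
    and basis: "orthonormal_basis_L2 D \<phi>"
    and eigen: "\<And>n t. n \<ge> 1 \<Longrightarrow> t \<ge> 0 \<Longrightarrow>
           AE x in lborel. x \<in> D \<longrightarrow> killed_semigroup M X D t (\<phi> n) x = exp (- lam n * t) * \<phi> n x"
    and lam: "0 < lam 1" "lam 1 < lam 2" "\<And>n. n \<ge> 2 \<Longrightarrow> lam n \<le> lam (Suc n)"
    and \<phi>_cont: "\<And>n. n \<ge> 1 \<Longrightarrow> continuous_on D (\<phi> n)"
    and \<phi>_bounded: "\<And>n. n \<ge> 1 \<Longrightarrow> bounded (\<phi> n ` D)"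
    and \<phi>_pos: "\<And>x. x \<in> D \<Longrightarrow> 0 < \<phi> 1 x"
begin

text \<open>
  Extended by zero, so that all integrals range over the whole space.
\<close>

definition e :: "nat \<Rightarrow> real ^ 'd \<Rightarrow> real" where
  "e n x = indicator D x * \<phi> n x"

text \<open>
  All functions to which the killed semigroup is applied below have this form.
\<close>

definition supported :: "(real ^ 'd \<Rightarrow> real) \<Rightarrow> bool" where
  "supported g \<longleftrightarrow> bounded_support_fun g \<and> (\<forall>x. x \<notin> D \<longrightarrow> g x = 0)"

definition coef :: "(real ^ 'd \<Rightarrow> real) \<Rightarrow> nat \<Rightarrow> real" where
  "coef g n = (\<integral>x. g x * e n x \<partial>lborel)"

definition alive :: "real \<Rightarrow> real ^ 'd \<Rightarrow> 'w set" where
  "alive t x = {\<omega>. ereal t < exit_time D (\<lambda>s. x + X s \<omega>)}"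

abbreviation P :: "real \<Rightarrow> (real ^ 'd \<Rightarrow> real) \<Rightarrow> real ^ 'd \<Rightarrow> real" where
  "P \<equiv> killed_semigroup M X D"

lemma D_sets[measurable]: "D \<in> sets borel"
  using D by auto

lemma lam_mono: "2 \<le> n \<Longrightarrow> lam 2 \<le> lam n"
  by (induction n rule: dec_induct) (auto intro: order_trans lam)

lemma aliveD: "0 \<le> t \<Longrightarrow> \<omega> \<in> alive t x \<Longrightarrow> x + X t \<omega> \<in> D"
  unfolding alive_def using less_exit_timeD[of t D "\<lambda>s. x + X s \<omega>" t] by auto

lemma supported_e: assumes "1 \<le> n" shows "supported (e n)"
proof -
  obtain r where r: "\<And>x. x \<in> D \<Longrightarrow> norm x \<le> r" using D(2) by (auto simp: bounded_iff)
  obtain B where B: "\<And>x. x \<in> D \<Longrightarrow> \<bar>\<phi> n x\<bar> \<le> B" using \<phi>_bounded[OF assms] by (auto simp: bounded_iff)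
  have "\<bar>e n x\<bar> \<le> max B 0" for x using B[of x] by (cases "x \<in> D") (auto simp: e_def)
  moreover have "e n x \<noteq> 0 \<longrightarrow> norm x \<le> r" for x using r[of x] by (cases "x \<in> D") (auto simp: e_def)
  moreover have "e n \<in> borel_measurable borel"
    using basis assms unfolding orthonormal_basis_L2_def L2_on_def set_borel_measurable_def
    by (auto simp: e_def[abs_def])
  ultimately have "bounded_support_fun (e n)" unfolding bounded_support_fun_def by blast
  then show ?thesis by (simp add: supported_def e_def)
qed

lemma supportedD: "supported g \<Longrightarrow> bounded_support_fun g" "supported g \<Longrightarrow> x \<notin> D \<Longrightarrow> g x = 0"
  by (auto simp: supported_def)

lemma supported_measurable: "supported g \<Longrightarrow> g \<in> borel_measurable borel"
  using supportedD(1) bounded_support_fun_measurable by blast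

lemma supported_mult_bounded:
  assumes g: "supported g" and k: "k \<in> borel_measurable borel" "\<And>x. \<bar>k x\<bar> \<le> B"
  shows "supported (\<lambda>x. k x * g x)"
  using bounded_support_fun_mult_bounded[OF supportedD(1)[OF g] k(1), of B] k(2) supportedD(2)[OF g]
  by (simp add: supported_def mult.commute)

lemma supported_diff: "supported f \<Longrightarrow> supported g \<Longrightarrow> supported (\<lambda>x. f x - g x)"
  by (auto simp: supported_def intro: bounded_support_fun_diff)

lemma supported_sum:
  assumes "finite I" "\<And>i. i \<in> I \<Longrightarrow> supported (f i)"
  shows "supported (\<lambda>x. \<Sum>i\<in>I. f i x)"
  using assms
proof (induction I rule: finite_induct)
  case empty
  have "supported (\<lambda>x. 0)" by (auto simp: supported_def bounded_support_fun_def intro: exI[of _ 0])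
  then show ?case by simp
next
  case (insert i I)
  then show ?case by (auto simp: supported_def intro!: bounded_support_fun_add)
qed

lemma supported_scale: "supported g \<Longrightarrow> supported (\<lambda>x. c * g x)"
  by (rule supported_mult_bounded[of g "\<lambda>_. c" "\<bar>c\<bar>"]) auto

lemma supported_integrable:
  assumes "supported f" "supported g"
  shows "integrable lborel (\<lambda>x. f x * g x)" "integrable lborel (\<lambda>x. (f x)\<^sup>2)"
  unfolding power2_eq_square using assms
  by (auto intro!: bounded_support_fun_integrable bounded_support_fun_mult simp: supported_def)

lemma supported_square: "supported g \<Longrightarrow> supported (\<lambda>x. (g x)\<^sup>2)"
  using bounded_support_fun_mult[of g g] by (auto simp: supported_def power2_eq_square)

lemma orthonormal: "1 \<le> m \<Longrightarrow> 1 \<le> n \<Longrightarrow> (\<integral>x. e m x * e n x \<partial>lborel) = (if m = n then 1 else 0)"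
proof -
  assume mn: "1 \<le> m" "1 \<le> n"
  have "(\<integral>x. e m x * e n x \<partial>lborel) = (LBINT x:D. \<phi> m x * \<phi> n x)"
    unfolding set_lebesgue_integral_def by (intro Bochner_Integration.integral_cong refl) (auto simp: e_def indicator_def)
  then show ?thesis using basis mn by (simp add: orthonormal_basis_L2_def)
qed

definition partial :: "(real ^ 'd \<Rightarrow> real) \<Rightarrow> nat \<Rightarrow> real ^ 'd \<Rightarrow> real" where
  "partial g N x = (\<Sum>n=1..N. coef g n * e n x)"

lemma supported_partial: "supported (partial g N)"
  unfolding partial_def[abs_def] by (intro supported_sum supported_scale supported_e) auto

lemma partial_lim:
  assumes g: "supported g"
  shows "(\<lambda>N. \<integral>x. (g x - partial g N x)\<^sup>2 \<partial>lborel) \<longlonglongrightarrow> 0"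
proof -
  have ind: "indicator D x *\<^sub>R g x = g x" for x using supportedD(2)[OF g, of x] by (auto simp: indicator_def)
  have "g \<in> L2_on D (\<lambda>_. 1)"
    using supported_integrable(2)[OF g g] supported_measurable[OF g]
    unfolding L2_on_def set_borel_measurable_def set_integrable_def
    by (auto simp: ind indicator_scaleR_eq_if[symmetric] power2_eq_square ind[unfolded real_scaleR_def] mult.assoc[symmetric])
  then have "(\<lambda>N. LBINT x:D. (g x - (\<Sum>n=1..N. (LBINT y:D. g y * \<phi> n y) * \<phi> n x))\<^sup>2) \<longlonglongrightarrow> 0"
    using basis by (simp add: orthonormal_basis_L2_def)
  moreover have c: "(LBINT y:D. g y * \<phi> n y) = coef g n" for n
    unfolding set_lebesgue_integral_def coef_def e_def by (simp add: mult_ac)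
  moreover have "(LBINT x:D. (g x - (\<Sum>n=1..N. coef g n * \<phi> n x))\<^sup>2) = (\<integral>x. (g x - partial g N x)\<^sup>2 \<partial>lborel)" for N
    unfolding set_lebesgue_integral_def
    by (intro Bochner_Integration.integral_cong refl)
       (use supportedD(2)[OF g] in \<open>auto simp: partial_def e_def indicator_def\<close>)
  ultimately show ?thesis by simp
qed

lemma coef_partial: "1 \<le> m \<Longrightarrow> m \<le> N \<Longrightarrow> (\<integral>x. (\<Sum>n=1..N. c n * e n x) * e m x \<partial>lborel) = c m"
proof -
  assume m: "1 \<le> m" "m \<le> N"
  have "(\<integral>x. (\<Sum>n=1..N. c n * e n x) * e m x \<partial>lborel) = (\<integral>x. (\<Sum>n=1..N. c n * (e n x * e m x)) \<partial>lborel)"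
    by (simp only: sum_distrib_right mult.assoc)
  also have "\<dots> = (\<Sum>n=1..N. \<integral>x. c n * (e n x * e m x) \<partial>lborel)"
    using m by (intro Bochner_Integration.integral_sum integrable_mult_right supported_integrable supported_e) auto
  also have "\<dots> = (\<Sum>n=1..N. if n = m then c n else 0)"
    using m by (intro sum.cong refl) (simp add: orthonormal)
  also have "\<dots> = c m" using m by (simp add: sum.delta)
  finally show ?thesis .
qed

lemma inner_partial:
  assumes g: "supported g"
  shows "(\<integral>x. g x * (\<Sum>n=1..N. c n * e n x) \<partial>lborel) = (\<Sum>n=1..N. c n * coef g n)"
proof -
  have "(\<integral>x. g x * (\<Sum>n=1..N. c n * e n x) \<partial>lborel) = (\<integral>x. (\<Sum>n=1..N. c n * (g x * e n x)) \<partial>lborel)"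
    by (simp add: sum_distrib_left mult_ac)
  also have "\<dots> = (\<Sum>n=1..N. \<integral>x. c n * (g x * e n x) \<partial>lborel)"
    by (intro Bochner_Integration.integral_sum integrable_mult_right supported_integrable supported_e g) auto
  finally show ?thesis by (simp add: coef_def)
qed

lemma bessel:
  assumes g: "supported g"
  shows "(\<Sum>n=1..N. (coef g n)\<^sup>2) \<le> (\<integral>x. (g x)\<^sup>2 \<partial>lborel)"
proof -
  note s = supported_partial[of g N]
  have pp: "(\<integral>x. partial g N x * partial g N x \<partial>lborel) = (\<Sum>n=1..N. (coef g n)\<^sup>2)"
  proof -
    have "(\<integral>x. partial g N x * (\<Sum>n=1..N. coef g n * e n x) \<partial>lborel) = (\<Sum>n=1..N. coef g n * coef (partial g N) n)"
      by (rule inner_partial[OF s])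
    also have "\<dots> = (\<Sum>n=1..N. (coef g n)\<^sup>2)"
      unfolding coef_def[of "partial g N"] partial_def
      by (intro sum.cong refl) (use coef_partial[where c="coef g"] in \<open>auto simp: power2_eq_square\<close>)
    finally show ?thesis by (simp add: partial_def)
  qed
  have gp: "(\<integral>x. g x * partial g N x \<partial>lborel) = (\<Sum>n=1..N. (coef g n)\<^sup>2)"
    using inner_partial[OF g, where c="coef g" and N=N] by (simp add: partial_def power2_eq_square)
  have "0 \<le> (\<integral>x. (g x - partial g N x)\<^sup>2 \<partial>lborel)" by simp
  also have "\<dots> = (\<integral>x. (g x)\<^sup>2 - 2 * (g x * partial g N x) + partial g N x * partial g N x \<partial>lborel)"
    by (intro Bochner_Integration.integral_cong refl) (simp add: power2_eq_square algebra_simps)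
  also have "\<dots> = (\<integral>x. (g x)\<^sup>2 \<partial>lborel) - (\<Sum>n=1..N. (coef g n)\<^sup>2)"
    using supported_integrable[OF g s] supported_integrable(1)[OF s s] by (simp add: pp gp)
  finally show ?thesis by simp
qed

text \<open>
  Measurability of the survival event follows from the eigenvalue equation. The integrand defining
  \<open>P t (\<phi> 1) x\<close> is positive exactly on that event, and it is measurable because otherwise the integral would be zero by
  convention, whereas \<open>exp (- lam 1 * t) * \<phi> 1 x > 0\<close>.
\<close>

lemma AE_alive_measurable:
  assumes t: "0 \<le> t"
  shows "AE x in lborel. x \<in> D \<longrightarrow> alive t x \<inter> space M \<in> sets (completion M)"
proof -
  have "AE x in lborel. x \<in> D \<longrightarrow> P t (\<phi> 1) x = exp (- lam 1 * t) * \<phi> 1 x" using eigen[of 1 t] t by simp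
  then show ?thesis
  proof (eventually_elim, safe)
    fix x assume "x \<in> D" and eq: "P t (\<phi> 1) x = exp (- lam 1 * t) * \<phi> 1 x"
    let ?f = "\<lambda>\<omega>. \<phi> 1 (x + X t \<omega>) * indicator {\<omega>. ereal t < exit_time D (\<lambda>s. x + X s \<omega>)} \<omega>"
    have "integral\<^sup>L (completion M) ?f > 0"
      using \<phi>_pos[OF \<open>x \<in> D\<close>] eq \<open>x \<in> D\<close> by (simp add: killed_semigroup_def)
    then have "integrable (completion M) ?f" using not_integrable_integral_eq by fastforce
    then have [measurable]: "?f \<in> borel_measurable (completion M)" by auto
    have "alive t x \<inter> space M = {\<omega>\<in>space (completion M). 0 < ?f \<omega>}"
      using \<phi>_pos aliveD[OF t, of _ x] by (auto simp: alive_def indicator_def split: if_splits)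
    also have "\<dots> \<in> sets (completion M)" by measurable
    finally show "alive t x \<inter> space M \<in> sets (completion M)" .
  qed
qed

definition survive :: "real \<Rightarrow> real ^ 'd \<Rightarrow> ('w \<Rightarrow> real) \<Rightarrow> real" where
  "survive t x f = (\<integral>\<omega>. f \<omega> * indicator (alive t x) \<omega> \<partial>completion M)"

lemma P_survive: "P t g x = survive t x (\<lambda>\<omega>. g (x + X t \<omega>))"
  by (simp add: killed_semigroup_def survive_def alive_def)

lemma P_eigenfunction: "0 \<le> t \<Longrightarrow> P t (\<phi> n) x = survive t x (\<lambda>\<omega>. e n (x + X t \<omega>))"
  unfolding P_survive survive_def
  by (intro Bochner_Integration.integral_cong refl) (use aliveD[of t _ x] in \<open>auto simp: e_def indicator_def\<close>)

lemma survive_integrable: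
  fixes f :: "'w \<Rightarrow> real"
  assumes A: "alive t x \<inter> space M \<in> sets (completion M)" and f: "integrable M f"
  shows "integrable (completion M) (\<lambda>\<omega>. f \<omega> * indicator (alive t x) \<omega>)"
proof -
  have "integrable (completion M) f" 
    by (rule integrable_completion[THEN iffD2, OF borel_measurable_integrable[OF f] f])
  then have "integrable (completion M) (\<lambda>\<omega>. f \<omega> * indicator (alive t x \<inter> space M) \<omega>)"
    using A by (intro integrable_real_mult_indicator) auto
  also have "?this \<longleftrightarrow> ?thesis"
    by (intro Bochner_Integration.integrable_cong refl) (auto simp: indicator_def)
  finally show ?thesis .
qed

lemma survive_mono:
  assumes A: "alive t x \<inter> space M \<in> sets (completion M)" and f: "integrable M f" and g: "integrable M g"
    and le: "\<And>\<omega>. \<omega> \<in> space M \<Longrightarrow> \<omega> \<in> alive t x \<Longrightarrow> f \<omega> \<le> g \<omega>"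
  shows "survive t x f \<le> survive t x g"
  unfolding survive_def
  by (intro integral_mono survive_integrable A f g) (auto simp: indicator_def le)

lemma survive_le:
  assumes A: "alive t x \<inter> space M \<in> sets (completion M)" and f: "integrable M f" and f0: "\<And>\<omega>. 0 \<le> f \<omega>"
  shows "survive t x f \<le> (\<integral>\<omega>. f \<omega> \<partial>M)"
proof -
  have "survive t x f \<le> (\<integral>\<omega>. f \<omega> \<partial>completion M)"
    unfolding survive_def using f
    by (intro integral_mono survive_integrable A f) (auto simp: indicator_def f0 integrable_completion)
  then show ?thesis using f by (simp add: integral_completion)
qed

lemma X_integrable:
  assumes t: "0 \<le> t" and g: "supported g"
  shows "integrable M (\<lambda>\<omega>. g (x + X t \<omega>))"
proof -
  have [measurable]: "X t \<in> borel_measurable M" by (rule measurable_X[OF t])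
  note [measurable] = supported_measurable[OF g]
  obtain B where "\<And>x. \<bar>g x\<bar> \<le> B" using supportedD(1)[OF g] by (auto simp: bounded_support_fun_def)
  then show ?thesis by (intro integrable_const_bound[where B=B]) auto
qed

end

context killed_spectrum
begin

lemma transition_nn_integral:
  assumes t: "0 \<le> t" and u: "u \<in> borel_measurable borel"
  shows "(\<integral>\<^sup>+x. \<integral>\<^sup>+\<omega>. u (x + X t \<omega>) \<partial>M \<partial>lborel) = (\<integral>\<^sup>+x. u x \<partial>lborel)"
proof -
  have [measurable]: "X t \<in> borel_measurable M" by (rule measurable_X[OF t])
  note [measurable] = u
  interpret pair_sigma_finite M "lborel :: (real ^ 'd) measure" ..
  have "(\<integral>\<^sup>+x. \<integral>\<^sup>+\<omega>. u (x + X t \<omega>) \<partial>M \<partial>lborel) = (\<integral>\<^sup>+\<omega>. \<integral>\<^sup>+x. u (x + X t \<omega>) \<partial>lborel \<partial>M)"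
    by (rule Fubini') measurable
  also have "\<dots> = (\<integral>\<^sup>+x. u x \<partial>lborel)"
    by (simp add: lborel_nn_integral_translate[OF u] emeasure_space_1)
  finally show ?thesis .
qed

lemma transition_integral:
  fixes u :: "real ^ 'd \<Rightarrow> real"
  assumes t: "0 \<le> t" and u: "supported u" "\<And>x. 0 \<le> u x"
  shows "integrable lborel (\<lambda>x. \<integral>\<omega>. u (x + X t \<omega>) \<partial>M)"
    and "(\<integral>x. \<integral>\<omega>. u (x + X t \<omega>) \<partial>M \<partial>lborel) = (\<integral>x. u x \<partial>lborel)"
proof -
  have [measurable]: "X t \<in> borel_measurable M" by (rule measurable_X[OF t])
  note [measurable] = supported_measurable[OF u(1)]
  have iu: "integrable lborel u" using supportedD(1)[OF u(1)] by (rule bounded_support_fun_integrable)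
  have "(\<integral>\<^sup>+x. ennreal (\<integral>\<omega>. u (x + X t \<omega>) \<partial>M) \<partial>lborel) = (\<integral>\<^sup>+x. \<integral>\<^sup>+\<omega>. ennreal (u (x + X t \<omega>)) \<partial>M \<partial>lborel)"
    by (intro nn_integral_cong nn_integral_eq_integral[symmetric] X_integrable t u) (auto simp: u)
  also have "\<dots> = (\<integral>\<^sup>+x. ennreal (u x) \<partial>lborel)"
    using transition_nn_integral[OF t, of "\<lambda>x. ennreal (u x)"] by simp
  also have "\<dots> = ennreal (\<integral>x. u x \<partial>lborel)"
    using iu u by (intro nn_integral_eq_integral) auto
  finally have nn: "(\<integral>\<^sup>+x. ennreal (\<integral>\<omega>. u (x + X t \<omega>) \<partial>M) \<partial>lborel) = ennreal (\<integral>x. u x \<partial>lborel)" .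
  show "integrable lborel (\<lambda>x. \<integral>\<omega>. u (x + X t \<omega>) \<partial>M)"
    by (rule integrableI_nn_integral_finite[OF _ _ nn]) (auto intro!: integral_nonneg_AE u)
  show "(\<integral>x. \<integral>\<omega>. u (x + X t \<omega>) \<partial>M \<partial>lborel) = (\<integral>x. u x \<partial>lborel)"
    using nn by (subst integral_eq_nn_integral) (auto intro!: integral_nonneg_AE enn2real_ennreal u)
qed

text \<open>
  Cauchy--Schwarz with the indicator of the survival event.
\<close>

lemma survive_square_le:
  assumes A: "alive t x \<inter> space M \<in> sets (completion M)" and t: "0 \<le> t" and d: "supported d"
  shows "(survive t x (\<lambda>\<omega>. d (x + X t \<omega>)))\<^sup>2 \<le> (\<integral>\<omega>. (d (x + X t \<omega>))\<^sup>2 \<partial>M)"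
proof -
  have Xm[measurable]: "X t \<in> borel_measurable M" by (rule measurable_X[OF t])
  note [measurable] = supported_measurable[OF d]
  note dd = supported_square[OF d]
  let ?f = "\<lambda>\<omega>. d (x + X t \<omega>)" and ?A = "alive t x \<inter> space M"
  have fm: "?f \<in> borel_measurable (completion M)" by (rule measurable_completion) measurable
  have fm2: "(\<lambda>\<omega>. (?f \<omega>)\<^sup>2) \<in> borel_measurable M" by measurable
  have i: "integrable (completion M) (\<lambda>\<omega>. (?f \<omega>)\<^sup>2)"
    by (rule integrable_completion[THEN iffD2, OF fm2 X_integrable[OF t dd]])
  have em: "emeasure (completion M) (space M) = 1" by (simp add: emeasure_space_1)
  have le1: "emeasure (completion M) ?A \<le> 1"
    using emeasure_mono[of ?A "space M" "completion M"] em by simp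
  have iA: "integrable (completion M) (indicator ?A :: 'w \<Rightarrow> real)"
    using A le1 by (intro integrable_real_indicator) (auto intro: le_less_trans)
  have iA2: "(indicator ?A \<omega> :: real)\<^sup>2 = indicator ?A \<omega>" for \<omega> by (simp add: indicator_def)
  have "survive t x ?f = (\<integral>\<omega>. ?f \<omega> * indicator ?A \<omega> \<partial>completion M)"
    unfolding survive_def by (intro Bochner_Integration.integral_cong refl) (auto simp: indicator_def)
  then have "(survive t x ?f)\<^sup>2 \<le> (\<integral>\<omega>. (?f \<omega>)\<^sup>2 \<partial>completion M) * (\<integral>\<omega>. (indicator ?A \<omega>)\<^sup>2 \<partial>completion M)"
    using integral_Cauchy_Schwarz(2)[OF fm borel_measurable_integrable[OF iA] i] iA by (simp add: iA2)
  also have "(\<integral>\<omega>. (indicator ?A \<omega> :: real)\<^sup>2 \<partial>completion M) \<le> 1"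
    unfolding iA2 using A le1 by (simp add: measure_def enn2real_leI Int_absorb2 Int_assoc)
  then have "(\<integral>\<omega>. (?f \<omega>)\<^sup>2 \<partial>completion M) * (\<integral>\<omega>. (indicator ?A \<omega> :: real)\<^sup>2 \<partial>completion M) \<le> (\<integral>\<omega>. (?f \<omega>)\<^sup>2 \<partial>completion M) * 1"
    by (intro mult_left_mono) auto
  also have "(\<integral>\<omega>. (?f \<omega>)\<^sup>2 \<partial>completion M) = (\<integral>\<omega>. (?f \<omega>)\<^sup>2 \<partial>M)" by (rule integral_completion[OF fm2])
  finally show ?thesis by simp
qed

lemma P_partial:
  assumes A: "alive t x \<inter> space M \<in> sets (completion M)" and t: "0 \<le> t" and g: "supported g" and x: "x \<in> D"
    and eig: "\<And>n. 1 \<le> n \<Longrightarrow> P t (\<phi> n) x = exp (- lam n * t) * \<phi> n x"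
  shows "survive t x (\<lambda>\<omega>. g (x + X t \<omega>) - partial g N (x + X t \<omega>)) =
     P t g x - (\<Sum>n=1..N. exp (- lam n * t) * coef g n * e n x)"
proof -
  let ?I = "\<lambda>\<omega>. indicator (alive t x) \<omega> :: real"
  have ie: "integrable (completion M) (\<lambda>\<omega>. e n (x + X t \<omega>) * ?I \<omega>)" if "1 \<le> n" for n
    by (intro survive_integrable A X_integrable t supported_e that)
  have ig: "integrable (completion M) (\<lambda>\<omega>. g (x + X t \<omega>) * ?I \<omega>)"
    by (intro survive_integrable A X_integrable t g)
  have Pe: "(\<integral>\<omega>. e n (x + X t \<omega>) * ?I \<omega> \<partial>completion M) = exp (- lam n * t) * e n x" if "1 \<le> n" for n
    using eig[OF that] x P_eigenfunction[OF t, of n x] by (simp add: e_def survive_def)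
  have isum: "integrable (completion M) (\<lambda>\<omega>. \<Sum>n=1..N. coef g n * (e n (x + X t \<omega>) * ?I \<omega>))"
    by (intro Bochner_Integration.integrable_sum integrable_mult_right ie) auto
  have "survive t x (\<lambda>\<omega>. g (x + X t \<omega>) - partial g N (x + X t \<omega>)) =
    (\<integral>\<omega>. g (x + X t \<omega>) * ?I \<omega> - (\<Sum>n=1..N. coef g n * (e n (x + X t \<omega>) * ?I \<omega>)) \<partial>completion M)"
    unfolding survive_def partial_def
    by (intro Bochner_Integration.integral_cong refl) (simp add: left_diff_distrib sum_distrib_right mult.assoc)
  also have "\<dots> = P t g x - (\<integral>\<omega>. (\<Sum>n=1..N. coef g n * (e n (x + X t \<omega>) * ?I \<omega>)) \<partial>completion M)"
    unfolding P_survive survive_def by (rule Bochner_Integration.integral_diff[OF ig isum])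
  also have "(\<integral>\<omega>. (\<Sum>n=1..N. coef g n * (e n (x + X t \<omega>) * ?I \<omega>)) \<partial>completion M) = (\<Sum>n=1..N. coef g n * (exp (- lam n * t) * e n x))"
    by (subst Bochner_Integration.integral_sum) (auto intro!: integrable_mult_right ie sum.cong simp: Pe)
  finally show ?thesis by (simp add: mult_ac)
qed

text \<open>
  The function \<open>P t g\<close> is not known to be measurable, so a Borel version \<open>h\<close> is constructed. By \<open>survive_square_le\<close>
  the error \<open>(P t g - P t (partial g N))\<^sup>2\<close> is at most the free expectation of \<open>(g - partial g N)\<^sup>2\<close>, whose integral
  tends to zero. Along a subsequence \<open>P t (partial g N)\<close>, an explicit combination of eigenfunctions, therefore
  converges almost everywhere to \<open>P t g\<close>; the limit is \<open>h\<close>, and the inner products pass to the limit in \<open>L\<^sup>2\<close>.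
\<close>

lemma killed_spectral:
  assumes t: "0 \<le> t" and g: "supported g"
  obtains h where "h \<in> borel_measurable borel" "integrable lborel (\<lambda>x. (h x)\<^sup>2)" "\<And>x. x \<notin> D \<Longrightarrow> h x = 0"
    "AE x in lborel. x \<in> D \<longrightarrow> P t g x = h x"
    "\<And>m. 1 \<le> m \<Longrightarrow> (\<integral>x. h x * e m x \<partial>lborel) = exp (- lam m * t) * coef g m"
    "(\<lambda>N. \<Sum>n=1..N. exp (- lam n * t) * (coef g n)\<^sup>2) \<longlonglongrightarrow> (\<integral>x. h x * g x \<partial>lborel)"
proof -
  define d where "d N x = g x - partial g N x" for N x
  have d: "supported (d N)" for N unfolding d_def[abs_def] by (intro supported_diff g supported_partial)
  note dd = supported_square[OF d]
  define r where "r N x = (\<integral>\<omega>. (d N (x + X t \<omega>))\<^sup>2 \<partial>M)" for N x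
  have r: "integrable lborel (r N)" "(\<integral>x. r N x \<partial>lborel) = (\<integral>x. (d N x)\<^sup>2 \<partial>lborel)" for N
    unfolding r_def[abs_def] using transition_integral[OF t dd] by auto
  have r0: "0 \<le> r N x" for N x by (simp add: r_def)
  have rlim: "(\<lambda>N. \<integral>x. r N x \<partial>lborel) \<longlonglongrightarrow> 0" unfolding r(2) d_def by (rule partial_lim[OF g])
  obtain \<rho> :: "nat \<Rightarrow> nat" where \<rho>: "strict_mono \<rho>" "AE x in lborel. (\<lambda>k. r (\<rho> k) x) \<longlonglongrightarrow> 0"
    using tendsto_L1_AE_subseq[of lborel r] r(1) rlim r0 by auto
  define s where "s N x = (\<Sum>n=1..N. (exp (- lam n * t) * coef g n) * e n x)" for N x
  have s: "supported (s N)" for N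
    unfolding s_def[abs_def] by (intro supported_sum supported_scale supported_e) auto
  note [measurable] = supported_measurable[OF s] supported_measurable[OF g]
  \<comment> \<open>off \<open>D\<close> all terms vanish, so this limit is \<open>0\<close> there\<close>
  define h where "h x = lim (\<lambda>k. s (\<rho> k) x)" for x
  have hm[measurable]: "h \<in> borel_measurable borel" unfolding h_def by measurable
  have h0: "h x = 0" if "x \<notin> D" for x using supportedD(2)[OF s that] by (simp add: h_def)
  have "AE x in lborel. \<forall>n. 1 \<le> n \<longrightarrow> x \<in> D \<longrightarrow> P t (\<phi> n) x = exp (- lam n * t) * \<phi> n x"
    unfolding AE_all_countable using eigen t by (auto intro!: allI) 
  then have key: "AE x in lborel. (x \<in> D \<longrightarrow> P t g x = h x) \<and> (\<forall>N. (h x - s N x)\<^sup>2 \<le> r N x)"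
    using AE_alive_measurable[OF t] \<rho>(2)
  proof eventually_elim
    fix x assume eig: "\<forall>n. 1 \<le> n \<longrightarrow> x \<in> D \<longrightarrow> P t (\<phi> n) x = exp (- lam n * t) * \<phi> n x"
      and A: "x \<in> D \<longrightarrow> alive t x \<inter> space M \<in> sets (completion M)"
      and lim: "(\<lambda>k. r (\<rho> k) x) \<longlonglongrightarrow> 0"
    show "(x \<in> D \<longrightarrow> P t g x = h x) \<and> (\<forall>N. (h x - s N x)\<^sup>2 \<le> r N x)"
    proof (cases "x \<in> D")
      case False
      then show ?thesis using h0 supportedD(2)[OF s] r0 by simp
    next
      case True
      have le: "(P t g x - s N x)\<^sup>2 \<le> r N x" for N
        using survive_square_le[OF _ t d, of x N] P_partial[OF _ t g True, of N] A eig True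
        by (simp add: d_def r_def s_def)
      have "(\<lambda>k. (P t g x - s (\<rho> k) x)\<^sup>2) \<longlonglongrightarrow> 0"
        by (rule tendsto_sandwich[OF _ _ tendsto_const lim]) (auto simp: le intro!: always_eventually)
      then have "(\<lambda>k. sqrt ((P t g x - s (\<rho> k) x)\<^sup>2)) \<longlonglongrightarrow> sqrt 0" by (intro tendsto_real_sqrt)
      then have "(\<lambda>k. P t g x - s (\<rho> k) x) \<longlonglongrightarrow> 0" by (simp add: tendsto_rabs_zero_iff)
      then have "(\<lambda>k. P t g x - (P t g x - s (\<rho> k) x)) \<longlonglongrightarrow> P t g x - 0" by (intro tendsto_intros)
      then have "h x = P t g x" unfolding h_def by (intro limI) simp
      then show ?thesis using le by simp
    qed
  qed
  have key_le: "AE x in lborel. (h x - s N x)\<^sup>2 \<le> r N x" for N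
    by (rule eventually_mono[OF key]) blast
  have hs: "integrable lborel (\<lambda>x. (h x - s N x)\<^sup>2)" for N
    by (rule Bochner_Integration.integrable_bound[OF r(1)[of N]])
       (use key_le[of N] in \<open>simp_all add: r0\<close>)
  have h2: "integrable lborel (\<lambda>x. (h x)\<^sup>2)" using hs[of 0] by (simp add: s_def)
  have hs_lim: "(\<lambda>N. \<integral>x. (h x - s N x)\<^sup>2 \<partial>lborel) \<longlonglongrightarrow> 0"
  proof (rule tendsto_sandwich[OF _ _ tendsto_const rlim])
    show "\<forall>\<^sub>F N in sequentially. (\<integral>x. (h x - s N x)\<^sup>2 \<partial>lborel) \<le> (\<integral>x. r N x \<partial>lborel)"
      by (intro always_eventually allI integral_mono_AE hs r(1) key_le)
  qed (auto intro!: always_eventually)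
  have inner: "(\<lambda>N. \<integral>x. s N x * f x \<partial>lborel) \<longlonglongrightarrow> (\<integral>x. h x * f x \<partial>lborel)" if f: "supported f" for f
    by (intro L2_limit_inner hs h2 hs_lim supported_integrable[OF f f] supported_integrable(1)[OF s f])
       (simp_all add: supported_measurable f s)
  show thesis
  proof (rule that[of h, OF hm h2 h0])
    show "AE x in lborel. x \<in> D \<longrightarrow> P t g x = h x" by (rule eventually_mono[OF key]) blast
    show "(\<integral>x. h x * e m x \<partial>lborel) = exp (- lam m * t) * coef g m" if m: "1 \<le> m" for m
    proof (rule LIMSEQ_unique[OF inner[OF supported_e[OF m]]])
      have "eventually (\<lambda>N. exp (- lam m * t) * coef g m = (\<integral>x. s N x * e m x \<partial>lborel)) sequentially"
        using eventually_ge_at_top[of m]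
      proof eventually_elim
        case (elim N)
        then show ?case unfolding s_def using coef_partial[OF m elim, of "\<lambda>n. exp (- lam n * t) * coef g n"] by simp
      qed
      then show "(\<lambda>N. \<integral>x. s N x * e m x \<partial>lborel) \<longlonglongrightarrow> exp (- lam m * t) * coef g m"
        by (rule Lim_transform_eventually[OF tendsto_const])
    qed
    have "(\<integral>x. s N x * g x \<partial>lborel) = (\<Sum>n=1..N. exp (- lam n * t) * (coef g n)\<^sup>2)" for N
      using inner_partial[OF g, where c="\<lambda>n. exp (- lam n * t) * coef g n" and N=N]
      by (simp add: s_def mult.commute[of _ "g _"] power2_eq_square mult.assoc)
    with inner[OF g] show "(\<lambda>N. \<Sum>n=1..N. exp (- lam n * t) * (coef g n)\<^sup>2) \<longlonglongrightarrow> (\<integral>x. h x * g x \<partial>lborel)"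
      by simp
  qed
qed

lemma spectral_upper:
  assumes t: "0 \<le> t" and g: "supported g"
    and lim: "(\<lambda>N. \<Sum>n=1..N. exp (- lam n * t) * (coef g n)\<^sup>2) \<longlonglongrightarrow> I"
  shows "I \<le> exp (- lam 1 * t) * (coef g 1)\<^sup>2 + exp (- lam 2 * t) * ((\<integral>x. (g x)\<^sup>2 \<partial>lborel) - (coef g 1)\<^sup>2)"
proof (rule LIMSEQ_le_const2[OF lim], intro exI[of _ 1] allI impI)
  fix N :: nat assume N: "1 \<le> N"
  have split: "{1..N} = insert 1 {2..N}" using N by auto
  have "(\<Sum>n=1..N. exp (- lam n * t) * (coef g n)\<^sup>2) = exp (- lam 1 * t) * (coef g 1)\<^sup>2 + (\<Sum>n=2..N. exp (- lam n * t) * (coef g n)\<^sup>2)"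
    unfolding split by (subst sum.insert) auto
  also have "(\<Sum>n=2..N. exp (- lam n * t) * (coef g n)\<^sup>2) \<le> (\<Sum>n=2..N. exp (- lam 2 * t) * (coef g n)\<^sup>2)"
    using t lam_mono by (intro sum_mono mult_right_mono) (auto intro!: mult_right_mono)
  also have "\<dots> = exp (- lam 2 * t) * (\<Sum>n=2..N. (coef g n)\<^sup>2)" by (simp add: sum_distrib_left)
  also have "(\<Sum>n=2..N. (coef g n)\<^sup>2) = (\<Sum>n=1..N. (coef g n)\<^sup>2) - (coef g 1)\<^sup>2"
    unfolding split by (subst sum.insert) auto
  also have "exp (- lam 2 * t) * ((\<Sum>n=1..N. (coef g n)\<^sup>2) - (coef g 1)\<^sup>2) \<le> exp (- lam 2 * t) * ((\<integral>x. (g x)\<^sup>2 \<partial>lborel) - (coef g 1)\<^sup>2)"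
    using bessel[OF g, of N] by (intro mult_left_mono) auto
  finally show "(\<Sum>n=1..N. exp (- lam n * t) * (coef g n)\<^sup>2) \<le> exp (- lam 1 * t) * (coef g 1)\<^sup>2 + exp (- lam 2 * t) * ((\<integral>x. (g x)\<^sup>2 \<partial>lborel) - (coef g 1)\<^sup>2)"
    by simp
qed

lemma spectral_lower:
  assumes lim: "(\<lambda>N. \<Sum>n=1..N. exp (- lam n * t) * (coef g n)\<^sup>2) \<longlonglongrightarrow> I"
  shows "exp (- lam 2 * t) * (coef g 2)\<^sup>2 \<le> I"
proof (rule LIMSEQ_le_const[OF lim], intro exI[of _ 2] allI impI)
  fix N :: nat assume N: "2 \<le> N"
  show "exp (- lam 2 * t) * (coef g 2)\<^sup>2 \<le> (\<Sum>n=1..N. exp (- lam n * t) * (coef g n)\<^sup>2)"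
    using N by (intro member_le_sum[where i=2]) auto
qed

text \<open>
  Expanding the square, almost everywhere the expectation is
  \<open>k\<^sup>2 w P\<^sub>t w - 2 k w P\<^sub>t(k w) + w P\<^sub>t(k\<^sup>2 w)\<close> with \<open>w = e 1\<close>. The first and last terms have the same integral
  \<open>exp(-\<lambda>\<^sub>1 t) \<integral> g\<^sup>2\<close>, the last one because \<open>P\<^sub>t\<close> multiplies the first coefficient by \<open>exp(-\<lambda>\<^sub>1 t)\<close>. The middle term is
  estimated by the eigenfunction expansion.
\<close>

lemma killed_energy:
  fixes k :: "real ^ 'd \<Rightarrow> real"
  assumes t: "0 \<le> t" and k: "k \<in> borel_measurable borel" "\<And>x. \<bar>k x\<bar> \<le> B"
  defines "g \<equiv> \<lambda>x. k x * e 1 x"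
  obtains j where "integrable lborel j" "\<And>x. x \<notin> D \<Longrightarrow> j x = 0"
    "AE x in lborel. x \<in> D \<longrightarrow> alive t x \<inter> space M \<in> sets (completion M) \<and>
       survive t x (\<lambda>\<omega>. (k x - k (x + X t \<omega>))\<^sup>2 * e 1 x * e 1 (x + X t \<omega>)) = j x"
    "2 * (exp (- lam 1 * t) - exp (- lam 2 * t)) * ((\<integral>x. (g x)\<^sup>2 \<partial>lborel) - (coef g 1)\<^sup>2) \<le> (\<integral>x. j x \<partial>lborel)"
    "(\<integral>x. j x \<partial>lborel) \<le> 2 * exp (- lam 1 * t) * (\<integral>x. (g x)\<^sup>2 \<partial>lborel) - 2 * exp (- lam 2 * t) * (coef g 2)\<^sup>2"
proof -
  let ?w = "e 1"
  have w: "supported ?w" by (rule supported_e) simp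
  have g: "supported g" unfolding g_def by (rule supported_mult_bounded[OF w k])
  have kk: "\<bar>(k x)\<^sup>2\<bar> \<le> B\<^sup>2" for x using power_mono[OF k(2)[of x], of 2] by simp
  define q where "q x = (k x)\<^sup>2 * ?w x" for x
  have q: "supported q" unfolding q_def[abs_def] by (rule supported_mult_bounded[OF w _ kk]) (use k in measurable)
  obtain h where h: "h \<in> borel_measurable borel" "integrable lborel (\<lambda>x. (h x)\<^sup>2)" "\<And>x. x \<notin> D \<Longrightarrow> h x = 0"
    "AE x in lborel. x \<in> D \<longrightarrow> P t g x = h x"
    "\<And>m. 1 \<le> m \<Longrightarrow> (\<integral>x. h x * e m x \<partial>lborel) = exp (- lam m * t) * coef g m"
    "(\<lambda>N. \<Sum>n=1..N. exp (- lam n * t) * (coef g n)\<^sup>2) \<longlonglongrightarrow> (\<integral>x. h x * g x \<partial>lborel)"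
    by (rule killed_spectral[OF t g]) (rule that)
  obtain h' where h': "h' \<in> borel_measurable borel" "integrable lborel (\<lambda>x. (h' x)\<^sup>2)" "\<And>x. x \<notin> D \<Longrightarrow> h' x = 0"
    "AE x in lborel. x \<in> D \<longrightarrow> P t q x = h' x"
    "\<And>m. 1 \<le> m \<Longrightarrow> (\<integral>x. h' x * e m x \<partial>lborel) = exp (- lam m * t) * coef q m"
    "(\<lambda>N. \<Sum>n=1..N. exp (- lam n * t) * (coef q n)\<^sup>2) \<longlonglongrightarrow> (\<integral>x. h' x * q x \<partial>lborel)"
    by (rule killed_spectral[OF t q]) (rule that)
  define j where "j x = exp (- lam 1 * t) * (q x * ?w x) - 2 * (h x * g x) + h' x * ?w x" for x
  have i1: "integrable lborel (\<lambda>x. q x * ?w x)" by (rule supported_integrable(1)[OF q w])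
  have i2: "integrable lborel (\<lambda>x. h x * g x)"
    by (intro integral_Cauchy_Schwarz(1) h supported_integrable(2)[OF g g]) (use h supported_measurable[OF g] in auto)
  have i3: "integrable lborel (\<lambda>x. h' x * ?w x)"
    by (intro integral_Cauchy_Schwarz(1) h' supported_integrable(2)[OF w w]) (use h' supported_measurable[OF w] in auto)
  have qw: "(\<integral>x. q x * ?w x \<partial>lborel) = (\<integral>x. (g x)\<^sup>2 \<partial>lborel)"
    by (intro Bochner_Integration.integral_cong refl) (simp add: q_def g_def power2_eq_square mult_ac)
  have ij: "integrable lborel j"
    unfolding j_def[abs_def] by (intro Bochner_Integration.integrable_add Bochner_Integration.integrable_diff integrable_mult_right i1 i2 i3)
  have vj: "(\<integral>x. j x \<partial>lborel) = 2 * exp (- lam 1 * t) * (\<integral>x. (g x)\<^sup>2 \<partial>lborel) - 2 * (\<integral>x. h x * g x \<partial>lborel)"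
  proof -
    have "(\<integral>x. j x \<partial>lborel) = exp (- lam 1 * t) * (\<integral>x. q x * ?w x \<partial>lborel) - 2 * (\<integral>x. h x * g x \<partial>lborel) + (\<integral>x. h' x * ?w x \<partial>lborel)"
      unfolding j_def using i1 i2 i3 by simp
    also have "(\<integral>x. h' x * ?w x \<partial>lborel) = exp (- lam 1 * t) * (\<integral>x. q x * ?w x \<partial>lborel)"
      using h'(5)[of 1] by (simp add: coef_def)
    finally show ?thesis unfolding qw by simp
  qed
  show thesis
  proof (rule that[OF ij])
    show "j x = 0" if "x \<notin> D" for x using that h(3) h'(3) supportedD(2)[OF w that] by (simp add: j_def g_def)
    have "AE x in lborel. x \<in> D \<longrightarrow> P t (\<phi> 1) x = exp (- lam 1 * t) * \<phi> 1 x" using eigen[of 1 t] t by simp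
    then show "AE x in lborel. x \<in> D \<longrightarrow> alive t x \<inter> space M \<in> sets (completion M) \<and>
       survive t x (\<lambda>\<omega>. (k x - k (x + X t \<omega>))\<^sup>2 * ?w x * ?w (x + X t \<omega>)) = j x"
      using AE_alive_measurable[OF t] h(4) h'(4)
    proof (eventually_elim, safe)
      fix x assume x: "x \<in> D" and A: "alive t x \<inter> space M \<in> sets (completion M)"
        and eqs: "P t (\<phi> 1) x = exp (- lam 1 * t) * \<phi> 1 x" "P t g x = h x" "P t q x = h' x"
      let ?I = "\<lambda>\<omega>. indicator (alive t x) \<omega> :: real"
      note i = survive_integrable[OF A X_integrable[OF t w]] survive_integrable[OF A X_integrable[OF t g]] survive_integrable[OF A X_integrable[OF t q]]
      have Pw: "survive t x (\<lambda>\<omega>. ?w (x + X t \<omega>)) = exp (- lam 1 * t) * ?w x"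
        using eqs x P_eigenfunction[OF t, of 1 x] by (simp add: e_def)
      have "survive t x (\<lambda>\<omega>. (k x - k (x + X t \<omega>))\<^sup>2 * ?w x * ?w (x + X t \<omega>)) =
        (\<integral>\<omega>. q x * (?w (x + X t \<omega>) * ?I \<omega>) - 2 * g x * (g (x + X t \<omega>) * ?I \<omega>) + ?w x * (q (x + X t \<omega>) * ?I \<omega>) \<partial>completion M)"
        unfolding survive_def
        by (intro Bochner_Integration.integral_cong refl) (simp add: q_def g_def power2_eq_square algebra_simps)
      also have "\<dots> = q x * survive t x (\<lambda>\<omega>. ?w (x + X t \<omega>)) - 2 * g x * P t g x + ?w x * P t q x"
        unfolding P_survive survive_def using i by simp
      also have "\<dots> = j x" unfolding Pw eqs j_def by (simp add: mult_ac)
      finally show "survive t x (\<lambda>\<omega>. (k x - k (x + X t \<omega>))\<^sup>2 * ?w x * ?w (x + X t \<omega>)) = j x" .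
    qed
    show "2 * (exp (- lam 1 * t) - exp (- lam 2 * t)) * ((\<integral>x. (g x)\<^sup>2 \<partial>lborel) - (coef g 1)\<^sup>2) \<le> (\<integral>x. j x \<partial>lborel)"
      using spectral_upper[OF t g h(6)] unfolding vj by (simp add: algebra_simps)
    show "(\<integral>x. j x \<partial>lborel) \<le> 2 * exp (- lam 1 * t) * (\<integral>x. (g x)\<^sup>2 \<partial>lborel) - 2 * exp (- lam 2 * t) * (coef g 2)\<^sup>2"
      using spectral_lower[OF h(6)] unfolding vj by simp
  qed
qed

end

section \<open>The lower bound for the energy\<close>

text \<open>
  The double integral in the energy without its constant and over the whole space; the weight \<open>w\<close> carries the
  restriction to \<open>D\<close>.
\<close>

definition double_integral :: "real \<Rightarrow> ('a::euclidean_space \<Rightarrow> real) \<Rightarrow> ('a \<Rightarrow> real) \<Rightarrow> ennreal" where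
  "double_integral \<alpha> w k =
     (\<integral>\<^sup>+x. \<integral>\<^sup>+y. ennreal ((k x - k y)\<^sup>2 / norm (x - y) powr (real DIM('a) + \<alpha>) * w x * w y) \<partial>lborel \<partial>lborel)"

lemma energy_eq_double_integral:
  fixes k w :: "real ^ 'd \<Rightarrow> real"
  assumes eq: "\<And>x. x \<in> D \<Longrightarrow> k x = f x" "\<And>x. x \<in> D \<Longrightarrow> w x = u x" "\<And>x. x \<notin> D \<Longrightarrow> w x = 0"
  shows "energy \<alpha> D u f = ennreal (riesz_const CARD('d) (- \<alpha>) / 2) * double_integral \<alpha> w k"
proof -
  let ?G = "\<lambda>f u x y. ennreal ((f x - f y)\<^sup>2 / norm (x - y) powr (real CARD('d) + \<alpha>) * u x * u y)"
  have "(\<integral>\<^sup>+y. ?G f u x y * indicator D y \<partial>lborel) * indicator D x = (\<integral>\<^sup>+y. ?G k w x y \<partial>lborel)" for x :: "real ^ 'd"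
  proof (cases "x \<in> D")
    case True
    have "?G f u x y * indicator D y = ?G k w x y" for y
      using eq True by (cases "y \<in> D") auto
    then show ?thesis using True by simp
  qed (simp add: eq)
  then show ?thesis by (simp add: energy_def double_integral_def)
qed

text \<open>
  Tonelli and the substitution \<open>y = x + z\<close>.
\<close>

lemma nn_integral_weighted_levy:
  fixes w k :: "'a::euclidean_space \<Rightarrow> real"
  assumes bw: "bounded_weighted w k B" and w0: "\<And>x. 0 \<le> w x" and \<alpha>: "0 < \<alpha>"
  shows "(\<integral>\<^sup>+z. ennreal (weighted_sqdiff w k z) \<partial>levy_measure \<alpha>) = ennreal (riesz_const DIM('a) (- \<alpha>)) * double_integral \<alpha> w k"
proof -
  interpret bounded_weighted w k B by (rule bw)
  note [measurable] = bounded_support_fun_measurable[OF w]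
  let ?p = "real DIM('a) + \<alpha>" and ?A = "riesz_const DIM('a) (- \<alpha>)"
  have A: "0 \<le> ?A" by (rule riesz_const_nonneg[OF \<alpha>])
  let ?H = "\<lambda>x z. ennreal (?A / norm z powr ?p) * ennreal ((k x - k (x + z))\<^sup>2 * w x * w (x + z))"
  have "(\<integral>\<^sup>+z. ennreal (weighted_sqdiff w k z) \<partial>levy_measure \<alpha>) = (\<integral>\<^sup>+z. ennreal (?A / norm z powr ?p) * ennreal (weighted_sqdiff w k z) \<partial>lborel)"
    unfolding levy_measure_def by (subst nn_integral_density) auto
  also have "\<dots> = (\<integral>\<^sup>+z. \<integral>\<^sup>+x. ?H x z \<partial>lborel \<partial>lborel)"
  proof (intro nn_integral_cong)
    fix z :: 'a
    have "ennreal (weighted_sqdiff w k z) = (\<integral>\<^sup>+x. ennreal ((k x - k (x + z))\<^sup>2 * w x * w (x + z)) \<partial>lborel)"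
      unfolding weighted_sqdiff_def by (intro nn_integral_eq_integral[symmetric] weighted_integrable) (auto simp: w0)
    then show "ennreal (?A / norm z powr ?p) * ennreal (weighted_sqdiff w k z) = (\<integral>\<^sup>+x. ?H x z \<partial>lborel)"
      by (simp add: nn_integral_cmult)
  qed
  also have "\<dots> = (\<integral>\<^sup>+x. \<integral>\<^sup>+z. ?H x z \<partial>lborel \<partial>lborel)"
    by (rule lborel_pair.Fubini') measurable
  also have "\<dots> = (\<integral>\<^sup>+x. ennreal ?A * (\<integral>\<^sup>+y. ennreal ((k x - k y)\<^sup>2 / norm (x - y) powr ?p * w x * w y) \<partial>lborel) \<partial>lborel)"
  proof (intro nn_integral_cong)
    fix x :: 'a
    have "(\<integral>\<^sup>+z. ?H x z \<partial>lborel) = (\<integral>\<^sup>+y. ?H x (y + - x) \<partial>lborel)"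
      by (rule lborel_nn_integral_translate[symmetric]) measurable
    also have "\<dots> = (\<integral>\<^sup>+y. ennreal ?A * ennreal ((k x - k y)\<^sup>2 / norm (x - y) powr ?p * w x * w y) \<partial>lborel)"
      using A w0 by (intro nn_integral_cong) (simp add: norm_minus_commute flip: ennreal_mult)
    also have "\<dots> = ennreal ?A * (\<integral>\<^sup>+y. ennreal ((k x - k y)\<^sup>2 / norm (x - y) powr ?p * w x * w y) \<partial>lborel)"
      by (rule nn_integral_cmult) measurable
    finally show "(\<integral>\<^sup>+z. ?H x z \<partial>lborel) = ennreal ?A * (\<integral>\<^sup>+y. ennreal ((k x - k y)\<^sup>2 / norm (x - y) powr ?p * w x * w y) \<partial>lborel)" .
  qed
  also have "\<dots> = ennreal ?A * double_integral \<alpha> w k"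
    unfolding double_integral_def by (rule nn_integral_cmult) measurable
  finally show ?thesis .
qed

lemma exp_diff_quotient_limit:
  fixes a b :: real
  shows "(\<lambda>n. (exp (- a * (1 / real (Suc n))) - exp (- b * (1 / real (Suc n)))) / (1 / real (Suc n))) \<longlonglongrightarrow> b - a"
proof -
  have "((\<lambda>s. exp (- a * s) - exp (- b * s)) has_real_derivative b - a) (at 0)"
    by (auto intro!: derivative_eq_intros)
  then have *: "((\<lambda>h. (exp (- a * h) - exp (- b * h)) / h) \<longlongrightarrow> b - a) (at 0)"
    by (simp add: DERIV_def)
  have "(\<lambda>n. 1 / real (Suc n)) \<longlonglongrightarrow> 0" by (rule LIMSEQ_inverse_real_of_nat[unfolded inverse_eq_divide])
  then have "filterlim (\<lambda>n. 1 / real (Suc n)) (at 0) sequentially"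
    by (auto simp: filterlim_at)
  from filterlim_compose[OF * this] show ?thesis .
qed

definition truncate :: "nat \<Rightarrow> ('a \<Rightarrow> real) \<Rightarrow> 'a \<Rightarrow> real" where
  "truncate m g x = max (- real m) (min (real m) (g x))"

lemma measurable_truncate[measurable]: "g \<in> borel_measurable M \<Longrightarrow> truncate m g \<in> borel_measurable M"
  unfolding truncate_def[abs_def] by (intro borel_measurable_max borel_measurable_min borel_measurable_const)

lemma truncate_bound: "\<bar>truncate m g x\<bar> \<le> real m" "\<bar>truncate m g x\<bar> \<le> \<bar>g x\<bar>"
  by (auto simp: truncate_def max_def min_def)

lemma truncate_eq: "\<bar>g x\<bar> \<le> real m \<Longrightarrow> truncate m g x = g x"
  by (auto simp: truncate_def max_def min_def abs_if split: if_splits)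

text \<open>
  Truncation does not increase the energy.
\<close>

lemma truncate_contraction: "(truncate m g x - truncate m g y)\<^sup>2 \<le> (g x - g y)\<^sup>2"
proof -
  have "\<bar>truncate m g x - truncate m g y\<bar> \<le> \<bar>g x - g y\<bar>" by (auto simp: truncate_def max_def min_def)
  then show ?thesis by (simp add: abs_le_square_iff)
qed

lemma truncate_lim: "(\<lambda>m. truncate m g x) \<longlonglongrightarrow> g x"
proof (rule Lim_transform_eventually[OF tendsto_const])
  show "\<forall>\<^sub>F m in sequentially. g x = truncate m g x"
    using eventually_ge_at_top[of "nat \<lceil>\<bar>g x\<bar>\<rceil>"]
  proof eventually_elim
    case (elim m)
    then have "\<bar>g x\<bar> \<le> real m" by linarith
    then show ?case by (simp add: truncate_eq)
  qed
qed

context killed_spectrum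
begin

definition \<tau> :: "nat \<Rightarrow> real" where "\<tau> n = 1 / real (Suc n)"

lemma \<tau>_pos: "0 < \<tau> n" by (simp add: \<tau>_def)

lemma \<tau>_lim: "\<tau> \<longlonglongrightarrow> 0"
  unfolding \<tau>_def by (rule LIMSEQ_inverse_real_of_nat[unfolded inverse_eq_divide])

sublocale small: stable_small_time \<alpha> \<tau> "\<lambda>n. distr M borel (X (\<tau> n))"
  by standard (auto intro!: \<alpha> \<tau>_pos \<tau>_lim law_X less_imp_le)

lemma w_nonneg: "0 \<le> e 1 x"
  using \<phi>_pos[of x] by (cases "x \<in> D") (auto simp: e_def)

lemma shift_nn_integral:
  fixes F :: "real ^ 'd \<Rightarrow> real ^ 'd \<Rightarrow> ennreal"
  assumes t: "0 \<le> t" and F[measurable]: "(\<lambda>(x, y). F x y) \<in> borel_measurable (borel \<Otimes>\<^sub>M borel)"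
  shows "(\<integral>\<^sup>+z. \<integral>\<^sup>+x. F x (x + z) \<partial>lborel \<partial>distr M borel (X t)) = (\<integral>\<^sup>+x. \<integral>\<^sup>+\<omega>. F x (x + X t \<omega>) \<partial>M \<partial>lborel)"
proof -
  have [measurable]: "X t \<in> borel_measurable M" by (rule measurable_X[OF t])
  interpret pair_sigma_finite M "lborel :: (real ^ 'd) measure" ..
  have "(\<integral>\<^sup>+z. \<integral>\<^sup>+x. F x (x + z) \<partial>lborel \<partial>distr M borel (X t)) = (\<integral>\<^sup>+\<omega>. \<integral>\<^sup>+x. F x (x + X t \<omega>) \<partial>lborel \<partial>M)"
    by (rule nn_integral_distr) measurable
  also have "\<dots> = (\<integral>\<^sup>+x. \<integral>\<^sup>+\<omega>. F x (x + X t \<omega>) \<partial>M \<partial>lborel)"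
    by (rule Fubini'[symmetric]) measurable
  finally show ?thesis .
qed

lemma weighted_law:
  assumes bw: "bounded_weighted w k B" and w0: "\<And>x. 0 \<le> w x" and t: "0 \<le> t"
  shows "(\<integral>\<^sup>+z. ennreal (weighted_sqdiff w k z) \<partial>distr M borel (X t)) =
     (\<integral>\<^sup>+x. \<integral>\<^sup>+\<omega>. ennreal ((k x - k (x + X t \<omega>))\<^sup>2 * w x * w (x + X t \<omega>)) \<partial>M \<partial>lborel)"
proof -
  interpret bounded_weighted w k B by (rule bw)
  note [measurable] = bounded_support_fun_measurable[OF w]
  have "(\<integral>\<^sup>+z. ennreal (weighted_sqdiff w k z) \<partial>distr M borel (X t)) =
     (\<integral>\<^sup>+z. \<integral>\<^sup>+x. ennreal ((k x - k (x + z))\<^sup>2 * w x * w (x + z)) \<partial>lborel \<partial>distr M borel (X t))"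
    unfolding weighted_sqdiff_def by (intro nn_integral_cong nn_integral_eq_integral[symmetric] weighted_integrable) (auto simp: w0)
  also have "\<dots> = (\<integral>\<^sup>+x. \<integral>\<^sup>+\<omega>. ennreal ((k x - k (x + X t \<omega>))\<^sup>2 * w x * w (x + X t \<omega>)) \<partial>M \<partial>lborel)"
    by (rule shift_nn_integral[OF t]) measurable
  finally show ?thesis .
qed

lemma integrand_integrable:
  assumes bw: "bounded_weighted w k B" and t: "0 \<le> t"
  shows "integrable M (\<lambda>\<omega>. (k x - k (x + X t \<omega>))\<^sup>2 * w x * w (x + X t \<omega>))"
proof -
  interpret bounded_weighted w k B by (rule bw)
  note [measurable] = bounded_support_fun_measurable[OF w] measurable_X[OF t]
  obtain C where C: "\<And>x. \<bar>w x\<bar> \<le> C" using w by (auto simp: bounded_support_fun_def)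
  have "\<bar>(k x - k y)\<^sup>2 * w x * w y\<bar> \<le> (2 * B)\<^sup>2 * C * C" for y
  proof -
    have "\<bar>k x - k y\<bar> \<le> 2 * B" using k_le[of x] k_le[of y] by linarith
    then have "(k x - k y)\<^sup>2 \<le> (2 * B)\<^sup>2" using power_mono[of "\<bar>k x - k y\<bar>" "2 * B" 2] by simp
    moreover have "0 \<le> C" using C[of x] by linarith
    ultimately show ?thesis unfolding abs_mult using C by (intro mult_mono) auto
  qed
  then show ?thesis by (intro integrable_const_bound[where B="(2 * B)\<^sup>2 * C * C"]) auto
qed

text \<open>
  Since the killed process is dominated by the free one,
  \<open>\<integral> (w(x) - w(x+z))\<^sup>2 \<mu>\<^sub>t(dz) dx = 2 - 2 \<langle>w, Q\<^sub>t w\<rangle> \<le> 2 - 2 \<langle>w, P\<^sub>t w\<rangle> = 2 (1 - exp(-\<lambda>\<^sub>1 t)) \<le> 2 \<lambda>\<^sub>1 t\<close> for the free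
  semigroup \<open>Q\<^sub>t\<close> and \<open>w = e 1 \<ge> 0\<close>.
\<close>

lemma ground_state_energy:
  "(\<integral>\<^sup>+z. ennreal (sqdiff (e 1) z) \<partial>levy_measure \<alpha>) < \<infinity>"
proof -
  have w: "supported (e 1)" by (rule supported_e) simp
  note [measurable] = supported_measurable[OF w]
  note ww = supported_square[OF w]
  have "(\<integral>\<^sup>+z. ennreal (sqdiff (e 1) z) \<partial>distr M borel (X (\<tau> n))) \<le> ennreal (\<tau> n * (2 * lam 1))" for n
  proof -
    let ?t = "\<tau> n"
    have t: "0 \<le> ?t" using \<tau>_pos[of n] by simp
    define r where "r x = (\<integral>\<omega>. (e 1 (x + X ?t \<omega>))\<^sup>2 \<partial>M)" for x
    have r: "integrable lborel r" "(\<integral>x. r x \<partial>lborel) = (\<integral>x. (e 1 x)\<^sup>2 \<partial>lborel)"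
      unfolding r_def[abs_def] using transition_integral[OF t ww] by auto
    have one: "(\<integral>x. (e 1 x)\<^sup>2 \<partial>lborel) = 1" using orthonormal[of 1 1] by (simp add: power2_eq_square)
    have iw: "integrable lborel (\<lambda>x. (e 1 x)\<^sup>2)" by (rule supported_integrable(2)[OF w w])
    let ?b = "\<lambda>x. (e 1 x)\<^sup>2 - 2 * exp (- lam 1 * ?t) * (e 1 x)\<^sup>2 + r x"
    have "(\<integral>\<^sup>+z. ennreal (sqdiff (e 1) z) \<partial>distr M borel (X ?t)) =
      (\<integral>\<^sup>+z. \<integral>\<^sup>+x. ennreal ((e 1 x - e 1 (x + z))\<^sup>2) \<partial>lborel \<partial>distr M borel (X ?t))"
      unfolding sqdiff_def by (intro nn_integral_cong nn_integral_eq_integral[symmetric] sqdiff_integrable supportedD(1)[OF w]) auto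
    also have "\<dots> = (\<integral>\<^sup>+x. \<integral>\<^sup>+\<omega>. ennreal ((e 1 x - e 1 (x + X ?t \<omega>))\<^sup>2) \<partial>M \<partial>lborel)"
      by (rule shift_nn_integral[OF t]) measurable
    finally have lhs: "(\<integral>\<^sup>+z. ennreal (sqdiff (e 1) z) \<partial>distr M borel (X ?t)) =
      (\<integral>\<^sup>+x. \<integral>\<^sup>+\<omega>. ennreal ((e 1 x - e 1 (x + X ?t \<omega>))\<^sup>2) \<partial>M \<partial>lborel)" .
    have key: "AE x in lborel. 0 \<le> ?b x \<and> (\<integral>\<^sup>+\<omega>. ennreal ((e 1 x - e 1 (x + X ?t \<omega>))\<^sup>2) \<partial>M) \<le> ennreal (?b x)"
    proof -
      have "AE x in lborel. x \<in> D \<longrightarrow> P ?t (\<phi> 1) x = exp (- lam 1 * ?t) * \<phi> 1 x" using eigen[of 1 ?t] t by simp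
      then show ?thesis
        using AE_alive_measurable[OF t]
      proof eventually_elim
        fix x assume eig: "x \<in> D \<longrightarrow> P ?t (\<phi> 1) x = exp (- lam 1 * ?t) * \<phi> 1 x"
          and A: "x \<in> D \<longrightarrow> alive ?t x \<inter> space M \<in> sets (completion M)"
        note i = X_integrable[OF t w, of x] X_integrable[OF t ww, of x]
        have eq: "(e 1 x - e 1 (x + X ?t \<omega>))\<^sup>2 = (e 1 x)\<^sup>2 - 2 * e 1 x * e 1 (x + X ?t \<omega>) + (e 1 (x + X ?t \<omega>))\<^sup>2" for \<omega>
          by (simp add: power2_eq_square algebra_simps)
        have ieq: "integrable M (\<lambda>\<omega>. (e 1 x - e 1 (x + X ?t \<omega>))\<^sup>2)" unfolding eq using i by simp
        have 1: "(\<integral>\<^sup>+\<omega>. ennreal ((e 1 x - e 1 (x + X ?t \<omega>))\<^sup>2) \<partial>M) = ennreal (\<integral>\<omega>. (e 1 x - e 1 (x + X ?t \<omega>))\<^sup>2 \<partial>M)"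
          by (rule nn_integral_eq_integral[OF ieq]) simp
        have "(\<integral>\<omega>. (e 1 x - e 1 (x + X ?t \<omega>))\<^sup>2 \<partial>M) = (e 1 x)\<^sup>2 - 2 * (e 1 x * (\<integral>\<omega>. e 1 (x + X ?t \<omega>) \<partial>M)) + r x"
          unfolding eq r_def using i by (simp add: prob_space)
        also have "\<dots> \<le> ?b x"
        proof (cases "x \<in> D")
          case True
          have "exp (- lam 1 * ?t) * e 1 x = P ?t (\<phi> 1) x" using eig True by (simp add: e_def)
          also have "\<dots> = survive ?t x (\<lambda>\<omega>. e 1 (x + X ?t \<omega>))" by (rule P_eigenfunction[OF t])
          also have "\<dots> \<le> (\<integral>\<omega>. e 1 (x + X ?t \<omega>) \<partial>M)"
            using A True by (intro survive_le i w_nonneg) auto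
          finally have "e 1 x * (exp (- lam 1 * ?t) * e 1 x) \<le> e 1 x * (\<integral>\<omega>. e 1 (x + X ?t \<omega>) \<partial>M)"
            by (intro mult_left_mono w_nonneg)
          then show ?thesis by (simp add: power2_eq_square mult_ac)
        qed (simp add: e_def)
        finally have le: "(\<integral>\<omega>. (e 1 x - e 1 (x + X ?t \<omega>))\<^sup>2 \<partial>M) \<le> ?b x" .
        have "0 \<le> (\<integral>\<omega>. (e 1 x - e 1 (x + X ?t \<omega>))\<^sup>2 \<partial>M)" by simp
        with le show "0 \<le> ?b x \<and> (\<integral>\<^sup>+\<omega>. ennreal ((e 1 x - e 1 (x + X ?t \<omega>))\<^sup>2) \<partial>M) \<le> ennreal (?b x)"
          unfolding 1 by (intro conjI ennreal_leI) linarith+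
      qed
    qed
    have "(\<integral>\<^sup>+z. ennreal (sqdiff (e 1) z) \<partial>distr M borel (X ?t)) \<le> (\<integral>\<^sup>+x. ennreal (?b x) \<partial>lborel)"
      unfolding lhs by (rule nn_integral_mono_AE) (rule eventually_mono[OF key], blast)
    also have "\<dots> = ennreal (\<integral>x. ?b x \<partial>lborel)"
    proof (rule nn_integral_eq_integral)
      show "integrable lborel ?b" using iw r by simp
      show "AE x in lborel. 0 \<le> ?b x" by (rule eventually_mono[OF key]) blast
    qed
    also have "(\<integral>x. ?b x \<partial>lborel) = 2 * (1 - exp (- lam 1 * ?t))"
      using iw r by (simp add: one[unfolded One_nat_def])
    also have "\<dots> \<le> ?t * (2 * lam 1)"
      using exp_ge_add_one_self[of "- lam 1 * ?t"] by (simp add: algebra_simps)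
    finally show ?thesis by (simp add: ennreal_leI)
  qed
  then have "(\<integral>\<^sup>+z. ennreal (sqdiff (e 1) z) \<partial>levy_measure \<alpha>) \<le> ennreal (2 * lam 1)"
    using lam by (intro small.sqdiff_levy_le supportedD(1)[OF w]) auto
  then show ?thesis by (rule le_less_trans) simp
qed

end

context killed_spectrum
begin

lemma bounded_weighted_e1:
  assumes "k \<in> borel_measurable borel" "\<And>x. \<bar>k x\<bar> \<le> B"
  shows "bounded_weighted (e 1) k B"
  using assms supportedD(1)[OF supported_e[of 1]] by unfold_locales auto

text \<open>
  The integrand is nonnegative, so dropping the restriction to living paths can only increase the expectation.
\<close>

lemma killed_le_free:
  fixes k :: "real ^ 'd \<Rightarrow> real"
  assumes t: "0 \<le> t" and k: "k \<in> borel_measurable borel" "\<And>x. \<bar>k x\<bar> \<le> B"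
  shows "ennreal (2 * (exp (- lam 1 * t) - exp (- lam 2 * t)) *
      ((\<integral>x. (k x * e 1 x)\<^sup>2 \<partial>lborel) - (coef (\<lambda>x. k x * e 1 x) 1)\<^sup>2)) \<le>
    (\<integral>\<^sup>+z. ennreal (weighted_sqdiff (e 1) k z) \<partial>distr M borel (X t))" (is "ennreal ?c \<le> _")
proof -
  note bw = bounded_weighted_e1[OF k]
  obtain j where j: "integrable lborel j" "\<And>x. x \<notin> D \<Longrightarrow> j x = 0"
    "AE x in lborel. x \<in> D \<longrightarrow> alive t x \<inter> space M \<in> sets (completion M) \<and>
       survive t x (\<lambda>\<omega>. (k x - k (x + X t \<omega>))\<^sup>2 * e 1 x * e 1 (x + X t \<omega>)) = j x"
    "?c \<le> (\<integral>x. j x \<partial>lborel)"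
    by (rule killed_energy[OF t k]) (rule that)
  let ?F = "\<lambda>x \<omega>. (k x - k (x + X t \<omega>))\<^sup>2 * e 1 x * e 1 (x + X t \<omega>)"
  have key: "AE x in lborel. 0 \<le> j x \<and> ennreal (j x) \<le> (\<integral>\<^sup>+\<omega>. ennreal (?F x \<omega>) \<partial>M)"
    using j(3)
  proof eventually_elim
    fix x assume *: "x \<in> D \<longrightarrow> alive t x \<inter> space M \<in> sets (completion M) \<and> survive t x (?F x) = j x"
    have F0: "0 \<le> ?F x \<omega>" for \<omega> by (intro mult_nonneg_nonneg w_nonneg) auto
    have iF: "integrable M (?F x)" by (rule integrand_integrable[OF bw t])
    show "0 \<le> j x \<and> ennreal (j x) \<le> (\<integral>\<^sup>+\<omega>. ennreal (?F x \<omega>) \<partial>M)"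
    proof (cases "x \<in> D")
      case True
      have "0 \<le> survive t x (?F x)" unfolding survive_def by (intro integral_nonneg_AE AE_I2 mult_nonneg_nonneg F0) auto
      moreover have "survive t x (?F x) \<le> (\<integral>\<omega>. ?F x \<omega> \<partial>M)"
        using * True by (intro survive_le iF F0) auto
      moreover have "(\<integral>\<^sup>+\<omega>. ennreal (?F x \<omega>) \<partial>M) = ennreal (\<integral>\<omega>. ?F x \<omega> \<partial>M)"
        by (intro nn_integral_eq_integral iF AE_I2 F0)
      ultimately show ?thesis using * True by (auto intro: ennreal_leI)
    qed (use j(2) in simp)
  qed
  have "ennreal ?c \<le> ennreal (\<integral>x. j x \<partial>lborel)" using j(4) by (rule ennreal_leI)
  also have "\<dots> = (\<integral>\<^sup>+x. ennreal (j x) \<partial>lborel)"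
    by (rule nn_integral_eq_integral[symmetric, OF j(1)]) (rule eventually_mono[OF key], blast)
  also have "\<dots> \<le> (\<integral>\<^sup>+x. \<integral>\<^sup>+\<omega>. ennreal (?F x \<omega>) \<partial>M \<partial>lborel)"
    by (rule nn_integral_mono_AE) (rule eventually_mono[OF key], blast)
  also have "\<dots> = (\<integral>\<^sup>+z. ennreal (weighted_sqdiff (e 1) k z) \<partial>distr M borel (X t))"
    by (rule weighted_law[OF bw w_nonneg t, symmetric])
  finally show ?thesis .
qed

lemma bounded_lower_bound:
  fixes k :: "real ^ 'd \<Rightarrow> real"
  assumes k: "k \<in> borel_measurable borel" "\<And>x. \<bar>k x\<bar> \<le> B"
    and fin: "(\<integral>\<^sup>+z. ennreal (weighted_sqdiff (e 1) k z) \<partial>levy_measure \<alpha>) < \<infinity>"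
  shows "2 * (lam 2 - lam 1) * ((\<integral>x. (k x * e 1 x)\<^sup>2 \<partial>lborel) - (coef (\<lambda>x. k x * e 1 x) 1)\<^sup>2) \<le>
    (\<integral>z. weighted_sqdiff (e 1) k z \<partial>levy_measure \<alpha>)" (is "2 * (lam 2 - lam 1) * ?c \<le> _")
proof -
  note bw = bounded_weighted_e1[OF k] and k' = k
  interpret bounded_weighted "e 1" k B by (rule bw)
  note lim = small.weighted_limit[OF bw w_nonneg ground_state_energy fin]
  have "(\<lambda>n. 2 * ((exp (- lam 1 * \<tau> n) - exp (- lam 2 * \<tau> n)) / \<tau> n) * ?c) \<longlonglongrightarrow> 2 * (lam 2 - lam 1) * ?c"
    unfolding \<tau>_def by (intro tendsto_intros exp_diff_quotient_limit)
  then show ?thesis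
  proof (rule LIMSEQ_le[OF _ lim(3)], intro exI allI impI)
    fix n
    have W0: "0 \<le> (\<integral>z. weighted_sqdiff (e 1) k z \<partial>distr M borel (X (\<tau> n)))"
      by (intro integral_nonneg_AE AE_I2 weighted_sqdiff_nonneg w_nonneg)
    have "(\<integral>\<^sup>+z. ennreal (weighted_sqdiff (e 1) k z) \<partial>distr M borel (X (\<tau> n))) = ennreal (\<integral>z. weighted_sqdiff (e 1) k z \<partial>distr M borel (X (\<tau> n)))"
      by (intro nn_integral_eq_integral lim(1) AE_I2 weighted_sqdiff_nonneg w_nonneg)
    then have "2 * (exp (- lam 1 * \<tau> n) - exp (- lam 2 * \<tau> n)) * ?c \<le> (\<integral>z. weighted_sqdiff (e 1) k z \<partial>distr M borel (X (\<tau> n)))"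
      using killed_le_free[OF less_imp_le[OF \<tau>_pos[of n]] k'] W0 by (simp add: ennreal_le_iff)
    then have "2 * (exp (- lam 1 * \<tau> n) - exp (- lam 2 * \<tau> n)) * ?c / \<tau> n \<le> (\<integral>z. weighted_sqdiff (e 1) k z \<partial>distr M borel (X (\<tau> n))) / \<tau> n"
      using \<tau>_pos[of n] by (intro divide_right_mono) auto
    then show "2 * ((exp (- lam 1 * \<tau> n) - exp (- lam 2 * \<tau> n)) / \<tau> n) * ?c \<le> (\<integral>z. weighted_sqdiff (e 1) k z \<partial>distr M borel (X (\<tau> n))) / \<tau> n"
      by simp
  qed
qed

text \<open>
  The bound for the truncations of \<open>f\<close> involves their norm and mean, which tend to \<open>1\<close> and \<open>0\<close> by dominated
  convergence.
\<close>

theorem energy_lower_bound: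
  assumes f: "f \<in> admissible D (\<phi> 1)"
  shows "ennreal (lam 2 - lam 1) \<le> energy \<alpha> D (\<phi> 1) f"
proof (cases "energy \<alpha> D (\<phi> 1) f")
  case (real E)
  let ?w = "e 1" and ?A = "riesz_const CARD('d) (- \<alpha>)"
  have w: "supported ?w" by (rule supported_e) simp
  note [measurable] = supported_measurable[OF w]
  define g where "g x = indicator D x * f x" for x
  have g[measurable]: "g \<in> borel_measurable borel"
    using f unfolding admissible_def L2_on_def set_borel_measurable_def by (auto simp: g_def[abs_def])
  have eqs: "indicator D x *\<^sub>R ((f x)\<^sup>2 * (\<phi> 1 x)\<^sup>2) = (g x * ?w x)\<^sup>2" "indicator D x *\<^sub>R (f x * (\<phi> 1 x)\<^sup>2) = g x * ?w x * ?w x" for x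
    by (auto simp: g_def e_def indicator_def power2_eq_square)
  have f': "set_integrable lborel D (\<lambda>x. (f x)\<^sup>2 * (\<phi> 1 x)\<^sup>2)"
    "(LBINT x:D. (f x)\<^sup>2 * (\<phi> 1 x)\<^sup>2) = 1" "(LBINT x:D. f x * (\<phi> 1 x)\<^sup>2) = 0"
    using f by (auto simp: admissible_def L2_on_def)
  have ig: "integrable lborel (\<lambda>x. (g x * ?w x)\<^sup>2)"
    using f'(1) by (simp only: set_integrable_def eqs)
  have g1: "(\<integral>x. (g x * ?w x)\<^sup>2 \<partial>lborel) = 1" "(\<integral>x. g x * ?w x * ?w x \<partial>lborel) = 0"
    using f'(2,3) by (simp_all only: set_lebesgue_integral_def eqs)
  have A: "0 \<le> ?A" by (rule riesz_const_nonneg[OF \<alpha>(1)])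
  define k where "k m = truncate m g" for m
  have km[measurable]: "k m \<in> borel_measurable borel" for m unfolding k_def by measurable
  have kB: "\<bar>k m x\<bar> \<le> real m" and kg: "\<bar>k m x\<bar> \<le> \<bar>g x\<bar>" for m x
    by (simp_all add: k_def truncate_bound)
  have klim: "(\<lambda>m. k m x) \<longlonglongrightarrow> g x" for x by (simp add: k_def truncate_lim)
  have en: "ennreal E = ennreal (?A / 2) * double_integral \<alpha> ?w g"
    unfolding real(2)[symmetric] by (rule energy_eq_double_integral) (auto simp: g_def e_def)
  have bound: "2 * (lam 2 - lam 1) * ((\<integral>x. (k m x * ?w x)\<^sup>2 \<partial>lborel) - (coef (\<lambda>x. k m x * ?w x) 1)\<^sup>2) \<le> 2 * E" for m
  proof -
    note bw = bounded_weighted_e1[OF km kB, of m]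
    interpret bounded_weighted ?w "k m" "real m" by (rule bw)
    have "(\<integral>\<^sup>+z. ennreal (weighted_sqdiff ?w (k m) z) \<partial>levy_measure \<alpha>) = ennreal ?A * double_integral \<alpha> ?w (k m)"
      using nn_integral_weighted_levy[OF bw w_nonneg \<alpha>(1)] by simp
    also have "\<dots> \<le> ennreal ?A * double_integral \<alpha> ?w g"
      unfolding double_integral_def
    proof (intro mult_left_mono nn_integral_mono ennreal_leI mult_right_mono divide_right_mono w_nonneg)
      show "(k m x - k m y)\<^sup>2 \<le> (g x - g y)\<^sup>2" for x y
        unfolding k_def by (rule truncate_contraction)
    qed auto
    also have "\<dots> = 2 * ennreal E"
    proof -
      have "ennreal ?A = 2 * ennreal (?A / 2)" using A by (simp add: ennreal_numeral[symmetric] ennreal_mult'[symmetric] del: ennreal_numeral)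
      then show ?thesis unfolding en by (simp add: mult.assoc)
    qed
    also have "\<dots> = ennreal (2 * E)" using real(1) by (simp add: ennreal_mult')
    finally have le: "(\<integral>\<^sup>+z. ennreal (weighted_sqdiff ?w (k m) z) \<partial>levy_measure \<alpha>) \<le> ennreal (2 * E)" .
    then have fin: "(\<integral>\<^sup>+z. ennreal (weighted_sqdiff ?w (k m) z) \<partial>levy_measure \<alpha>) < \<infinity>" by (rule le_less_trans) simp
    have int: "integrable (levy_measure \<alpha>) (weighted_sqdiff ?w (k m))"
      by (rule small.weighted_limit(2)[OF bw w_nonneg ground_state_energy fin])
    have "(\<integral>\<^sup>+z. ennreal (weighted_sqdiff ?w (k m) z) \<partial>levy_measure \<alpha>) = ennreal (\<integral>z. weighted_sqdiff ?w (k m) z \<partial>levy_measure \<alpha>)"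
      by (intro nn_integral_eq_integral int AE_I2 weighted_sqdiff_nonneg w_nonneg)
    then have "(\<integral>z. weighted_sqdiff ?w (k m) z \<partial>levy_measure \<alpha>) \<le> 2 * E"
      using le real(1) by (simp add: ennreal_le_iff)
    with bounded_lower_bound[OF km kB fin] show ?thesis by linarith
  qed
  have lim1: "(\<lambda>m. \<integral>x. (k m x * ?w x)\<^sup>2 \<partial>lborel) \<longlonglongrightarrow> 1"
    unfolding g1(1)[symmetric]
  proof (rule integral_dominated_convergence[OF _ _ ig])
    show "AE x in lborel. (\<lambda>m. (k m x * ?w x)\<^sup>2) \<longlonglongrightarrow> (g x * ?w x)\<^sup>2"
      by (intro AE_I2 tendsto_intros klim)
    show "AE x in lborel. norm ((k m x * ?w x)\<^sup>2) \<le> (g x * ?w x)\<^sup>2" for m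
    proof (intro AE_I2)
      fix x
      have "(k m x)\<^sup>2 \<le> (g x)\<^sup>2" using kg[of m x] by (simp add: abs_le_square_iff)
      then show "norm ((k m x * ?w x)\<^sup>2) \<le> (g x * ?w x)\<^sup>2"
        by (simp add: power_mult_distrib mult_right_mono)
    qed
  qed measurable
  have lim2: "(\<lambda>m. coef (\<lambda>x. k m x * ?w x) 1) \<longlonglongrightarrow> 0"
    unfolding g1(2)[symmetric] coef_def
  proof (rule integral_dominated_convergence[where w="\<lambda>x. (g x * ?w x)\<^sup>2 + (?w x)\<^sup>2"])
    show "integrable lborel (\<lambda>x. (g x * ?w x)\<^sup>2 + (?w x)\<^sup>2)"
      using ig supported_integrable(2)[OF w w] by (rule Bochner_Integration.integrable_add)
    show "AE x in lborel. (\<lambda>m. k m x * ?w x * ?w x) \<longlonglongrightarrow> g x * ?w x * ?w x"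
      by (intro AE_I2 tendsto_intros klim)
    show "AE x in lborel. norm (k m x * ?w x * ?w x) \<le> (g x * ?w x)\<^sup>2 + (?w x)\<^sup>2" for m
    proof (intro AE_I2)
      fix x
      have "norm (k m x * ?w x * ?w x) \<le> \<bar>g x * ?w x\<bar> * \<bar>?w x\<bar>"
        using kg[of m x] unfolding real_norm_def abs_mult by (intro mult_right_mono) auto
      also have "2 * (\<bar>g x * ?w x\<bar> * \<bar>?w x\<bar>) \<le> (g x * ?w x)\<^sup>2 + (?w x)\<^sup>2"
        using sum_squares_bound[of "\<bar>g x * ?w x\<bar>" "\<bar>?w x\<bar>"] by (simp only: power2_abs mult.assoc)
      then have "\<bar>g x * ?w x\<bar> * \<bar>?w x\<bar> \<le> (g x * ?w x)\<^sup>2 + (?w x)\<^sup>2"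
        using mult_nonneg_nonneg[OF abs_ge_zero abs_ge_zero, of "g x * ?w x" "?w x"] by linarith
      finally show "norm (k m x * ?w x * ?w x) \<le> (g x * ?w x)\<^sup>2 + (?w x)\<^sup>2" .
    qed
  qed measurable
  have "(\<lambda>m. 2 * (lam 2 - lam 1) * ((\<integral>x. (k m x * ?w x)\<^sup>2 \<partial>lborel) - (coef (\<lambda>x. k m x * ?w x) 1)\<^sup>2)) \<longlonglongrightarrow> 2 * (lam 2 - lam 1) * (1 - 0\<^sup>2)"
    by (intro tendsto_intros lim1 lim2)
  then have "2 * (lam 2 - lam 1) * (1 - 0\<^sup>2) \<le> 2 * E"
    by (rule LIMSEQ_le_const2) (use bound in auto)
  then show ?thesis unfolding real(2) by (intro ennreal_leI) simp
qed simp

end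

section \<open>The quotient of the first two eigenfunctions\<close>

context killed_spectrum
begin

definition ratio :: "real ^ 'd \<Rightarrow> real" where
  "ratio x = e 2 x / e 1 x"

lemma ratio_eq: "x \<in> D \<Longrightarrow> ratio x = \<phi> 2 x / \<phi> 1 x"
  by (simp add: ratio_def e_def)

lemma measurable_e12[measurable]: "e 1 \<in> borel_measurable borel" "e 2 \<in> borel_measurable borel"
  by (auto intro!: supported_measurable supported_e)

lemma measurable_ratio[measurable]: "ratio \<in> borel_measurable borel"
  unfolding ratio_def[abs_def] by measurable

lemma ratio_mult: "ratio x * e 1 x = e 2 x"
  using \<phi>_pos[of x] by (cases "x \<in> D") (auto simp: ratio_def e_def)

abbreviation cut :: "nat \<Rightarrow> real ^ 'd \<Rightarrow> real" where
  "cut m \<equiv> truncate m ratio"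

lemma cut_limits:
  shows "(\<lambda>m. \<integral>x. (cut m x * e 1 x)\<^sup>2 \<partial>lborel) \<longlonglongrightarrow> 1"
    and "(\<lambda>m. coef (\<lambda>x. cut m x * e 1 x) 2) \<longlonglongrightarrow> 1"
proof -
  have i: "integrable lborel (\<lambda>x. (e 2 x)\<^sup>2)"
    by (rule supported_integrable(2)[OF supported_e supported_e]) auto
  have one: "(\<integral>x. (e 2 x)\<^sup>2 \<partial>lborel) = 1" using orthonormal[of 2 2] by (simp add: power2_eq_square)
  have le: "\<bar>cut m x * e 1 x\<bar> \<le> \<bar>e 2 x\<bar>" for m x
    unfolding ratio_mult[symmetric] abs_mult by (intro mult_right_mono truncate_bound) auto
  have lim: "(\<lambda>m. cut m x * e 1 x) \<longlonglongrightarrow> e 2 x" for x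
    unfolding ratio_mult[symmetric] by (intro tendsto_intros truncate_lim)
  have "(\<lambda>m. \<integral>x. (cut m x * e 1 x)\<^sup>2 \<partial>lborel) \<longlonglongrightarrow> (\<integral>x. (e 2 x)\<^sup>2 \<partial>lborel)"
  proof (rule integral_dominated_convergence[OF _ _ i])
    show "AE x in lborel. (\<lambda>m. (cut m x * e 1 x)\<^sup>2) \<longlonglongrightarrow> (e 2 x)\<^sup>2"
      by (intro AE_I2 tendsto_power lim)
    show "AE x in lborel. norm ((cut m x * e 1 x)\<^sup>2) \<le> (e 2 x)\<^sup>2" for m
      using le[of m] by (intro AE_I2) (simp add: abs_le_square_iff[symmetric])
  qed measurable
  then show "(\<lambda>m. \<integral>x. (cut m x * e 1 x)\<^sup>2 \<partial>lborel) \<longlonglongrightarrow> 1" by (simp add: one)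
  have "(\<lambda>m. coef (\<lambda>x. cut m x * e 1 x) 2) \<longlonglongrightarrow> (\<integral>x. e 2 x * e 2 x \<partial>lborel)"
    unfolding coef_def
  proof (rule integral_dominated_convergence[OF _ _ i])
    show "AE x in lborel. (\<lambda>m. cut m x * e 1 x * e 2 x) \<longlonglongrightarrow> e 2 x * e 2 x"
      by (intro AE_I2 tendsto_mult_right lim)
    show "AE x in lborel. norm (cut m x * e 1 x * e 2 x) \<le> (e 2 x)\<^sup>2" for m
    proof (intro AE_I2)
      fix x
      have "\<bar>cut m x * e 1 x\<bar> * \<bar>e 2 x\<bar> \<le> \<bar>e 2 x\<bar> * \<bar>e 2 x\<bar>" using le by (intro mult_right_mono) auto
      then show "norm (cut m x * e 1 x * e 2 x) \<le> (e 2 x)\<^sup>2" by (simp add: abs_mult[of "_ * _" "e 2 x"] power2_eq_square)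
    qed
  qed measurable
  then show "(\<lambda>m. coef (\<lambda>x. cut m x * e 1 x) 2) \<longlonglongrightarrow> 1" using one by (simp add: power2_eq_square)
qed

lemma ratio_admissible: "(\<lambda>x. \<phi> 2 x / \<phi> 1 x) \<in> admissible D (\<phi> 1)"
proof -
  have eqs: "indicator D x *\<^sub>R ((\<phi> 2 x / \<phi> 1 x)\<^sup>2 * (\<phi> 1 x)\<^sup>2) = e 2 x * e 2 x"
    "indicator D x *\<^sub>R (\<phi> 2 x / \<phi> 1 x * (\<phi> 1 x)\<^sup>2) = e 1 x * e 2 x"
    "indicator D x *\<^sub>R (\<phi> 2 x / \<phi> 1 x) = ratio x" for x
    using \<phi>_pos[of x] by (cases "x \<in> D"; simp add: e_def ratio_def power2_eq_square)+
  have "integrable lborel (\<lambda>x. e 2 x * e 2 x)"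
    by (rule supported_integrable(1)[OF supported_e supported_e]) auto
  then show ?thesis
    using orthonormal[of 2 2] orthonormal[of 1 2]
    unfolding admissible_def L2_on_def set_borel_measurable_def set_integrable_def set_lebesgue_integral_def
      mem_Collect_eq eqs by simp
qed

lemma compact_part_bounded:
  assumes K: "compact K" "K \<subseteq> D"
  obtains B where "0 \<le> B" "\<And>x. x \<in> K \<Longrightarrow> \<bar>ratio x\<bar> \<le> B"
    "bounded_weighted (\<lambda>x. indicator K x * e 1 x) (\<lambda>x. indicator K x * ratio x) B"
proof -
  have "continuous_on K (\<lambda>x. \<phi> 2 x / \<phi> 1 x)"
    using \<phi>_cont[of 1] \<phi>_cont[of 2] K \<phi>_pos by (intro continuous_on_divide continuous_on_subset[of D _ K]) force+
  then have "bounded ((\<lambda>x. \<phi> 2 x / \<phi> 1 x) ` K)"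
    using K(1) by (intro compact_imp_bounded compact_continuous_image)
  then obtain B where B: "\<And>x. x \<in> K \<Longrightarrow> \<bar>\<phi> 2 x / \<phi> 1 x\<bar> \<le> B" by (auto simp: bounded_iff)
  have B': "\<bar>ratio x\<bar> \<le> max B 0" if "x \<in> K" for x
    using B[OF that] ratio_eq[of x] K(2) that by auto
  have [measurable]: "K \<in> sets borel" using K(1) by (intro borel_closed compact_imp_closed)
  show thesis
  proof (rule that[of "max B 0"])
    show "bounded_weighted (\<lambda>x. indicator K x * e 1 x) (\<lambda>x. indicator K x * ratio x) (max B 0)"
    proof
      show "bounded_support_fun (\<lambda>x. indicator K x * e 1 x)"
        using bounded_support_fun_mult_bounded[OF supportedD(1)[OF supported_e[of 1]], of "indicator K" 1]
        by (simp add: mult.commute indicator_def)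
      show "\<bar>indicator K x * ratio x\<bar> \<le> max B 0" for x using B'[of x] by (cases "x \<in> K") auto
    qed measurable
  qed (use B' in auto)
qed

text \<open>
  On \<open>K\<close> the quotient agrees with its truncations at high levels. The expectation over living paths is
  therefore bounded by that of a bounded function, to which \<open>killed_energy\<close> applies, and the paths that have died
  contribute \<open>O(t\<^sup>2)\<close> by \<open>two_jump_bound\<close>. Then the truncation level tends to infinity.
\<close>

lemma compact_part_upper:
  assumes K: "compact K" "K \<subseteq> D"
  defines "v \<equiv> \<lambda>x. indicator K x * e 1 x" and "l \<equiv> \<lambda>x. indicator K x * ratio x"
  obtains C t0 where "0 \<le> C" "0 < t0"
    "\<And>t. 0 < t \<Longrightarrow> t \<le> t0 \<Longrightarrow> (\<integral>\<^sup>+z. ennreal (weighted_sqdiff v l z) \<partial>distr M borel (X t)) \<le>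
        ennreal (2 * exp (- lam 1 * t) - 2 * exp (- lam 2 * t) + C * t\<^sup>2)"
proof -
  obtain B where B: "0 \<le> B" "\<And>x. x \<in> K \<Longrightarrow> \<bar>ratio x\<bar> \<le> B" and bw: "bounded_weighted v l B"
    unfolding v_def l_def using compact_part_bounded[OF K] by blast
  obtain C t0 where C: "0 \<le> C" "0 < t0" and jump: "\<And>t x. 0 < t \<Longrightarrow> t \<le> t0 \<Longrightarrow> x \<in> K \<Longrightarrow>
      \<exists>E\<in>events. prob E \<le> C * t\<^sup>2 \<and>
        (AE \<omega> in M. x + X t \<omega> \<in> K \<and> \<not> ereal t < exit_time D (\<lambda>s. x + X s \<omega>) \<longrightarrow> \<omega> \<in> E)"
    using two_jump_bound[OF \<alpha> D(1) K] by blast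
  obtain W where W: "\<And>x. \<bar>e 1 x\<bar> \<le> W"
    using supportedD(1)[OF supported_e[of 1]] by (auto simp: bounded_support_fun_def)
  have W0: "0 \<le> W" using W[of undefined] by linarith
  \<comment> \<open>a bound for the integrand, used on the paths that have died\<close>
  define c where "c = (2 * B)\<^sup>2 * W * W"
  have c0: "0 \<le> c" using W0 by (simp add: c_def)
  have v0: "0 \<le> v x" for x using w_nonneg[of x] by (simp add: v_def)
  have vW: "v x \<le> W" for x using W[of x] W0 by (cases "x \<in> K") (auto simp: v_def)
  define F where "F x y = (l x - l y)\<^sup>2 * v x * v y" for x y
  have F0: "0 \<le> F x y" for x y unfolding F_def by (intro mult_nonneg_nonneg v0) auto
  have FK: "F x y = 0" if "x \<notin> K \<or> y \<notin> K" for x y using that by (auto simp: F_def v_def)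
  have Fc: "F x y \<le> c" for x y
  proof -
    interpret bounded_weighted v l B by (rule bw)
    have "\<bar>l x - l y\<bar> \<le> 2 * B" using k_le[of x] k_le[of y] by linarith
    then have "(l x - l y)\<^sup>2 \<le> (2 * B)\<^sup>2" using power_mono[of "\<bar>l x - l y\<bar>" "2 * B" 2] by simp
    then show ?thesis unfolding F_def c_def using v0 vW W0 by (intro mult_mono mult_nonneg_nonneg) auto
  qed
  have Kb[measurable]: "K \<in> sets borel" using K(1) by (intro borel_closed compact_imp_closed)
  have Kfin: "emeasure lborel K < \<infinity>" using K(1) by (rule emeasure_compact_finite)
  define C' where "C' = c * C * measure lborel K"
  show thesis
  proof (rule that[of C' t0])
    show "0 \<le> C'" using c0 C by (simp add: C'_def)
    show "0 < t0" by (rule C)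
    fix t assume t: "0 < t" "t \<le> t0"
    then have t': "0 \<le> t" by simp
    have bound: "(\<integral>\<^sup>+z. ennreal (weighted_sqdiff v l z) \<partial>distr M borel (X t)) \<le>
      ennreal (2 * exp (- lam 1 * t) * (\<integral>x. (cut m x * e 1 x)\<^sup>2 \<partial>lborel) - 2 * exp (- lam 2 * t) * (coef (\<lambda>x. cut m x * e 1 x) 2)\<^sup>2 + C' * t\<^sup>2)"
      if m: "B \<le> real m" for m
    proof -
      obtain j where j: "integrable lborel j" "\<And>x. x \<notin> D \<Longrightarrow> j x = 0"
        "AE x in lborel. x \<in> D \<longrightarrow> alive t x \<inter> space M \<in> sets (completion M) \<and>
           survive t x (\<lambda>\<omega>. (cut m x - cut m (x + X t \<omega>))\<^sup>2 * e 1 x * e 1 (x + X t \<omega>)) = j x"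
        "(\<integral>x. j x \<partial>lborel) \<le> 2 * exp (- lam 1 * t) * (\<integral>x. (cut m x * e 1 x)\<^sup>2 \<partial>lborel) - 2 * exp (- lam 2 * t) * (coef (\<lambda>x. cut m x * e 1 x) 2)\<^sup>2"
        by (rule killed_energy[OF t' measurable_truncate[OF measurable_ratio] truncate_bound(1)]) (rule that)
      let ?J = "\<lambda>x. j x + c * (C * t\<^sup>2) * indicator K x"
      have key: "AE x in lborel. 0 \<le> ?J x \<and> (\<integral>\<^sup>+\<omega>. ennreal (F x (x + X t \<omega>)) \<partial>M) \<le> ennreal (?J x)"
        using j(3)
      proof eventually_elim
        fix x
        let ?S = "survive t x (\<lambda>\<omega>. (cut m x - cut m (x + X t \<omega>))\<^sup>2 * e 1 x * e 1 (x + X t \<omega>))"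
        assume *: "x \<in> D \<longrightarrow> alive t x \<inter> space M \<in> sets (completion M) \<and> ?S = j x"
        have "0 \<le> ?S"
          unfolding survive_def by (intro integral_nonneg_AE AE_I2 mult_nonneg_nonneg w_nonneg) auto
        then have j0: "0 \<le> j x" using * j(2)[of x] by (cases "x \<in> D") auto
        then have J0: "0 \<le> ?J x" using c0 C by (intro add_nonneg_nonneg mult_nonneg_nonneg) auto
        show "0 \<le> ?J x \<and> (\<integral>\<^sup>+\<omega>. ennreal (F x (x + X t \<omega>)) \<partial>M) \<le> ennreal (?J x)"
        proof (cases "x \<in> K")
          case False
          then show ?thesis using J0 FK by simp
        next
          case True
          then have xD: "x \<in> D" using K by auto
          have A: "alive t x \<inter> space M \<in> sets (completion M)" and S: "?S = j x" using * xD by auto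
          obtain E where E: "E \<in> events" "prob E \<le> C * t\<^sup>2"
            "AE \<omega> in M. x + X t \<omega> \<in> K \<and> \<not> ereal t < exit_time D (\<lambda>s. x + X s \<omega>) \<longrightarrow> \<omega> \<in> E"
            using jump[OF t True] by blast
          have iF: "integrable M (\<lambda>\<omega>. F x (x + X t \<omega>))"
            unfolding F_def by (rule integrand_integrable[OF bw t'])
          have iFc: "integrable (completion M) (\<lambda>\<omega>. F x (x + X t \<omega>))"
            by (rule integrable_completion[THEN iffD2, OF borel_measurable_integrable[OF iF] iF])
          have i1: "integrable (completion M) (\<lambda>\<omega>. F x (x + X t \<omega>) * indicator (alive t x) \<omega>)"
            by (rule survive_integrable[OF A iF])
          have iE: "integrable M (indicator E :: 'w \<Rightarrow> real)" using E(1) by (intro integrable_real_indicator) (auto simp: emeasure_eq_measure)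
          have iEc: "integrable (completion M) (\<lambda>\<omega>. c * indicator E \<omega> :: real)"
            by (intro integrable_mult_right integrable_completion[THEN iffD2, OF borel_measurable_integrable[OF iE] iE])
          have "(\<integral>\<omega>. F x (x + X t \<omega>) \<partial>M) = (\<integral>\<omega>. F x (x + X t \<omega>) \<partial>completion M)"
            by (rule integral_completion[OF borel_measurable_integrable[OF iF], symmetric])
          also have "\<dots> \<le> (\<integral>\<omega>. F x (x + X t \<omega>) * indicator (alive t x) \<omega> + c * indicator E \<omega> \<partial>completion M)"
          proof (rule integral_mono_AE[OF iFc Bochner_Integration.integrable_add[OF i1 iEc]])
            have "AE \<omega> in completion M. x + X t \<omega> \<in> K \<and> \<not> ereal t < exit_time D (\<lambda>s. x + X s \<omega>) \<longrightarrow> \<omega> \<in> E"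
              by (rule AE_completion[OF E(3)])
            then show "AE \<omega> in completion M. F x (x + X t \<omega>) \<le> F x (x + X t \<omega>) * indicator (alive t x) \<omega> + c * indicator E \<omega>"
            proof eventually_elim
              case (elim \<omega>)
              show ?case
              proof (cases "\<omega> \<in> alive t x")
                case True then show ?thesis using c0 by simp
              next
                case False
                then show ?thesis using elim Fc[of x "x + X t \<omega>"] FK[of x "x + X t \<omega>"] c0
                  by (cases "x + X t \<omega> \<in> K") (auto simp: alive_def)
              qed
            qed
          qed
          also have "\<dots> = survive t x (\<lambda>\<omega>. F x (x + X t \<omega>)) + c * prob E"
            unfolding Bochner_Integration.integral_add[OF i1 iEc] survive_def
            using integral_completion[OF borel_measurable_integrable[OF iE]] E(1) by (simp add: emeasure_eq_measure Int_absorb2 sets.sets_into_space)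
          also have "survive t x (\<lambda>\<omega>. F x (x + X t \<omega>)) \<le> ?S"
          proof (rule survive_mono[OF A iF integrand_integrable[OF bounded_weighted_e1[OF measurable_truncate[OF measurable_ratio] truncate_bound(1)] t']])
            fix \<omega>
            show "F x (x + X t \<omega>) \<le> (cut m x - cut m (x + X t \<omega>))\<^sup>2 * e 1 x * e 1 (x + X t \<omega>)"
            proof (cases "x + X t \<omega> \<in> K")
              case y: True
              have "cut m x = ratio x" "cut m (x + X t \<omega>) = ratio (x + X t \<omega>)"
                using B(2)[OF True] B(2)[OF y] m by (auto intro!: truncate_eq)
              then show ?thesis using True y by (simp add: F_def l_def v_def)
            next
              case False
              then have "F x (x + X t \<omega>) = 0" by (simp add: FK)
              also have "0 \<le> (cut m x - cut m (x + X t \<omega>))\<^sup>2 * e 1 x * e 1 (x + X t \<omega>)"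
                by (intro mult_nonneg_nonneg w_nonneg) auto
              finally show ?thesis .
            qed
          qed
          also have "c * prob E \<le> c * (C * t\<^sup>2)" using E(2) c0 by (rule mult_left_mono)
          finally have "(\<integral>\<omega>. F x (x + X t \<omega>) \<partial>M) \<le> ?J x" using S True by simp
          moreover have "(\<integral>\<^sup>+\<omega>. ennreal (F x (x + X t \<omega>)) \<partial>M) = ennreal (\<integral>\<omega>. F x (x + X t \<omega>) \<partial>M)"
            by (intro nn_integral_eq_integral iF AE_I2 F0)
          ultimately show ?thesis using J0 by (simp add: ennreal_leI)
        qed
      qed
      have iJ: "integrable lborel ?J"
        using j(1) Kfin by (intro Bochner_Integration.integrable_add integrable_mult_right integrable_real_indicator) auto
      have "(\<integral>\<^sup>+z. ennreal (weighted_sqdiff v l z) \<partial>distr M borel (X t)) = (\<integral>\<^sup>+x. \<integral>\<^sup>+\<omega>. ennreal (F x (x + X t \<omega>)) \<partial>M \<partial>lborel)"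
        unfolding F_def by (rule weighted_law[OF bw v0 t'])
      also have "\<dots> \<le> (\<integral>\<^sup>+x. ennreal (?J x) \<partial>lborel)"
        by (rule nn_integral_mono_AE) (rule eventually_mono[OF key], blast)
      also have "\<dots> = ennreal (\<integral>x. ?J x \<partial>lborel)"
        by (rule nn_integral_eq_integral[OF iJ]) (rule eventually_mono[OF key], blast)
      also have "(\<integral>x. ?J x \<partial>lborel) = (\<integral>x. j x \<partial>lborel) + C' * t\<^sup>2"
        using j(1) Kfin by (simp add: C'_def)
      also have "ennreal \<dots> \<le> ennreal (2 * exp (- lam 1 * t) * (\<integral>x. (cut m x * e 1 x)\<^sup>2 \<partial>lborel) - 2 * exp (- lam 2 * t) * (coef (\<lambda>x. cut m x * e 1 x) 2)\<^sup>2 + C' * t\<^sup>2)"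
        using j(4) by (intro ennreal_leI) linarith
      finally show ?thesis .
    qed
    have "(\<lambda>m. ennreal (2 * exp (- lam 1 * t) * (\<integral>x. (cut m x * e 1 x)\<^sup>2 \<partial>lborel) - 2 * exp (- lam 2 * t) * (coef (\<lambda>x. cut m x * e 1 x) 2)\<^sup>2 + C' * t\<^sup>2))
       \<longlonglongrightarrow> ennreal (2 * exp (- lam 1 * t) * 1 - 2 * exp (- lam 2 * t) * 1\<^sup>2 + C' * t\<^sup>2)"
      by (intro tendsto_ennrealI tendsto_intros cut_limits)
    then have "(\<integral>\<^sup>+z. ennreal (weighted_sqdiff v l z) \<partial>distr M borel (X t)) \<le> ennreal (2 * exp (- lam 1 * t) * 1 - 2 * exp (- lam 2 * t) * 1\<^sup>2 + C' * t\<^sup>2)"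
    proof (rule LIMSEQ_le_const, intro exI allI impI)
      fix m assume "nat \<lceil>B\<rceil> \<le> m"
      then have "B \<le> real m" by linarith
      then show "(\<integral>\<^sup>+z. ennreal (weighted_sqdiff v l z) \<partial>distr M borel (X t)) \<le>
        ennreal (2 * exp (- lam 1 * t) * (\<integral>x. (cut m x * e 1 x)\<^sup>2 \<partial>lborel) - 2 * exp (- lam 2 * t) * (coef (\<lambda>x. cut m x * e 1 x) 2)\<^sup>2 + C' * t\<^sup>2)"
        by (rule bound)
    qed
    then show "(\<integral>\<^sup>+z. ennreal (weighted_sqdiff v l z) \<partial>distr M borel (X t)) \<le>
        ennreal (2 * exp (- lam 1 * t) - 2 * exp (- lam 2 * t) + C' * t\<^sup>2)" by simp
  qed
qed

text \<open>
  The bound of \<open>compact_part_upper\<close> divided by \<open>t\<close>, first for the weight \<open>1 - exp (- s |z|\<^sup>2)\<close>, for which the limit \<open>t \<rightarrow> 0\<close>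
  exists unconditionally, then without it by Fatou's lemma as \<open>s \<rightarrow> \<infinity>\<close>.
\<close>

lemma compact_part_levy:
  assumes K: "compact K" "K \<subseteq> D"
  shows "(\<integral>\<^sup>+z. ennreal (weighted_sqdiff (\<lambda>x. indicator K x * e 1 x) (\<lambda>x. indicator K x * ratio x) z) \<partial>levy_measure \<alpha>)
    \<le> ennreal (2 * (lam 2 - lam 1))"
proof -
  let ?v = "\<lambda>x. indicator K x * e 1 x" and ?l = "\<lambda>x. indicator K x * ratio x"
  obtain B where bw: "bounded_weighted ?v ?l B" using compact_part_bounded[OF K] by blast
  obtain C t0 where C: "0 \<le> C" "0 < t0" and le: "\<And>t. 0 < t \<Longrightarrow> t \<le> t0 \<Longrightarrow>
      (\<integral>\<^sup>+z. ennreal (weighted_sqdiff ?v ?l z) \<partial>distr M borel (X t)) \<le> ennreal (2 * exp (- lam 1 * t) - 2 * exp (- lam 2 * t) + C * t\<^sup>2)"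
    using compact_part_upper[OF K] by blast
  interpret bounded_weighted ?v ?l B by (rule bw)
  have v0: "0 \<le> ?v x" for x using w_nonneg[of x] by simp
  note W0 = weighted_sqdiff_nonneg[OF v0]
  let ?f = "\<lambda>s z. weighted_sqdiff ?v ?l z * (1 - exp (- s * (norm z)\<^sup>2))"
  have f0: "0 \<le> ?f s z" if "0 < s" for s z using that W0[of z] by (intro mult_nonneg_nonneg) auto
  have ev: "eventually (\<lambda>n. \<tau> n < t0) sequentially" using \<tau>_lim C(2) by (rule order_tendstoD)
  have part: "(\<integral>z. ?f s z \<partial>levy_measure \<alpha>) \<le> 2 * (lam 2 - lam 1)" if s: "0 < s" for s
  proof (rule tendsto_le[OF _ _ small.weighted_gauss_limit(3)[OF bw s]])
    have "(\<lambda>n. 2 * ((exp (- lam 1 * \<tau> n) - exp (- lam 2 * \<tau> n)) / \<tau> n) + C * \<tau> n) \<longlonglongrightarrow> 2 * (lam 2 - lam 1) + C * 0"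
      by (intro tendsto_intros \<tau>_lim) (unfold \<tau>_def, rule exp_diff_quotient_limit)
    then show "(\<lambda>n. 2 * ((exp (- lam 1 * \<tau> n) - exp (- lam 2 * \<tau> n)) / \<tau> n) + C * \<tau> n) \<longlonglongrightarrow> 2 * (lam 2 - lam 1)" by simp
    show "\<forall>\<^sub>F n in sequentially. (\<integral>z. ?f s z \<partial>distr M borel (X (\<tau> n))) / \<tau> n \<le> 2 * ((exp (- lam 1 * \<tau> n) - exp (- lam 2 * \<tau> n)) / \<tau> n) + C * \<tau> n"
      using ev
    proof eventually_elim
      case (elim n)
      let ?b = "2 * exp (- lam 1 * \<tau> n) - 2 * exp (- lam 2 * \<tau> n) + C * (\<tau> n)\<^sup>2"
      have b0: "0 \<le> ?b"
      proof -
        have "exp (- lam 2 * \<tau> n) \<le> exp (- lam 1 * \<tau> n)" using lam(2) \<tau>_pos[of n] by simp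
        moreover have "0 \<le> C * (\<tau> n)\<^sup>2" using C by simp
        ultimately show ?thesis by linarith
      qed
      have "ennreal (\<integral>z. ?f s z \<partial>distr M borel (X (\<tau> n))) = (\<integral>\<^sup>+z. ennreal (?f s z) \<partial>distr M borel (X (\<tau> n)))"
        by (intro nn_integral_eq_integral[symmetric] small.weighted_gauss_limit(1)[OF bw s] AE_I2 f0 s)
      also have "\<dots> \<le> (\<integral>\<^sup>+z. ennreal (weighted_sqdiff ?v ?l z) \<partial>distr M borel (X (\<tau> n)))"
        using W0 s by (intro nn_integral_mono ennreal_leI mult_right_le_one_le) auto
      also have "\<dots> \<le> ennreal ?b" using elim \<tau>_pos[of n] by (intro le) auto
      finally have "(\<integral>z. ?f s z \<partial>distr M borel (X (\<tau> n))) \<le> ?b" using b0 by (simp add: ennreal_le_iff)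
      then have "(\<integral>z. ?f s z \<partial>distr M borel (X (\<tau> n))) / \<tau> n \<le> ?b / \<tau> n"
        using \<tau>_pos[of n] by (intro divide_right_mono) auto
      also have "?b / \<tau> n = 2 * ((exp (- lam 1 * \<tau> n) - exp (- lam 2 * \<tau> n)) / \<tau> n) + C * \<tau> n"
        using \<tau>_pos[of n] by (simp add: field_simps power2_eq_square)
      finally show ?case .
    qed
  qed simp
  have "(\<integral>\<^sup>+z. ennreal (weighted_sqdiff ?v ?l z) \<partial>levy_measure \<alpha>) = (\<integral>\<^sup>+z. liminf (\<lambda>n. ennreal (?f (real (Suc n)) z)) \<partial>levy_measure \<alpha>)"
  proof (intro nn_integral_cong)
    fix z :: "real ^ 'd"
    have "(\<lambda>n. ?f (real (Suc n)) z) \<longlonglongrightarrow> weighted_sqdiff ?v ?l z"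
    proof (cases "z = 0")
      case True
      then show ?thesis by (simp add: weighted_sqdiff_def)
    next
      case False
      have "(\<lambda>n. exp (- real (Suc n) * (norm z)\<^sup>2)) \<longlonglongrightarrow> 0"
      proof -
        have "(\<lambda>n. exp (- (norm z)\<^sup>2) ^ Suc n) \<longlonglongrightarrow> 0"
          using False by (intro LIMSEQ_Suc LIMSEQ_realpow_zero) auto
        moreover have "exp (- (norm z)\<^sup>2) ^ Suc n = exp (- real (Suc n) * (norm z)\<^sup>2)" for n
          unfolding exp_of_nat_mult[symmetric] by (simp only: mult_minus_left mult_minus_right)
        ultimately show ?thesis by (simp only:)
      qed
      then have "(\<lambda>n. ?f (real (Suc n)) z) \<longlonglongrightarrow> weighted_sqdiff ?v ?l z * (1 - 0)" by (intro tendsto_intros)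
      then show ?thesis by simp
    qed
    then have "(\<lambda>n. ennreal (?f (real (Suc n)) z)) \<longlonglongrightarrow> ennreal (weighted_sqdiff ?v ?l z)" by (rule tendsto_ennrealI)
    then show "ennreal (weighted_sqdiff ?v ?l z) = liminf (\<lambda>n. ennreal (?f (real (Suc n)) z))"
      by (rule lim_imp_Liminf[OF trivial_limit_sequentially, symmetric])
  qed
  also have "\<dots> \<le> liminf (\<lambda>n. \<integral>\<^sup>+z. ennreal (?f (real (Suc n)) z) \<partial>levy_measure \<alpha>)"
    by (rule nn_integral_liminf) measurable
  also have "\<dots> \<le> ennreal (2 * (lam 2 - lam 1))"
  proof (intro order_trans[OF Liminf_le_Limsup Limsup_bounded] always_eventually allI)
    fix n
    have "(\<integral>\<^sup>+z. ennreal (?f (real (Suc n)) z) \<partial>levy_measure \<alpha>) = ennreal (\<integral>z. ?f (real (Suc n)) z \<partial>levy_measure \<alpha>)"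
      by (intro nn_integral_eq_integral small.weighted_gauss_limit(2)[OF bw] AE_I2 f0) auto
    also have "\<dots> \<le> ennreal (2 * (lam 2 - lam 1))" by (intro ennreal_leI part) auto
    finally show "(\<integral>\<^sup>+z. ennreal (?f (real (Suc n)) z) \<partial>levy_measure \<alpha>) \<le> ennreal (2 * (lam 2 - lam 1))" .
  qed simp
  finally show ?thesis .
qed

text \<open>
  The compact sets of points at distance at least \<open>1 / (j + 1)\<close> from the complement exhaust \<open>D\<close>; Fatou's lemma in
  both variables passes the bound to the limit.
\<close>

theorem energy_ratio_le: "energy \<alpha> D (\<phi> 1) (\<lambda>x. \<phi> 2 x / \<phi> 1 x) \<le> ennreal (lam 2 - lam 1)"
proof -
  let ?A = "riesz_const CARD('d) (- \<alpha>)"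
  have A: "0 \<le> ?A" by (rule riesz_const_nonneg[OF \<alpha>(1)])
  have ne: "- D \<noteq> {}"
  proof
    assume "- D = {}"
    then have "D = UNIV" by auto
    then show False using D(2) not_bounded_UNIV[where 'a="real^'d"] by simp
  qed
  define K where "K j = {x. 1 / real (Suc j) \<le> infdist x (- D)}" for j
  have KD: "K j \<subseteq> D" for j
  proof
    fix x assume "x \<in> K j"
    then have "0 < infdist x (- D)" unfolding K_def by (smt (verit) mem_Collect_eq of_nat_0_less_iff zero_less_Suc zero_less_divide_1_iff)
    then show "x \<in> D" using infdist_zero[of x "- D"] by (cases "x \<in> D") auto
  qed
  have Kc: "compact (K j)" for j
  proof -
    have "closed (K j)" unfolding K_def by (intro closed_Collect_le continuous_intros)
    moreover have "bounded (K j)" using D(2) KD by (rule bounded_subset)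
    ultimately show ?thesis by (simp add: compact_eq_bounded_closed)
  qed
  have Kev: "eventually (\<lambda>j. x \<in> K j) sequentially" if "x \<in> D" for x
  proof -
    have "infdist x (- D) \<noteq> 0" using that D(1) ne by (subst in_closed_iff_infdist_zero[symmetric]) auto
    then have "0 < infdist x (- D)" using infdist_nonneg[of x "- D"] by linarith
    then have "eventually (\<lambda>j. 1 / real (Suc j) < infdist x (- D)) sequentially"
      using \<tau>_lim unfolding \<tau>_def by (intro order_tendstoD)
    then show ?thesis by eventually_elim (simp add: K_def)
  qed
  define G where "G j x y = ennreal ((indicator (K j) x * ratio x - indicator (K j) y * ratio y)\<^sup>2 / norm (x - y) powr (real CARD('d) + \<alpha>)
     * (indicator (K j) x * e 1 x) * (indicator (K j) y * e 1 y))" for j x y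
  have Kb[measurable]: "K j \<in> sets borel" for j using Kc by (intro borel_closed compact_imp_closed)
  have Gm[measurable]: "(\<lambda>(x, y). G j x y) \<in> borel_measurable (borel \<Otimes>\<^sub>M borel)" for j
    unfolding G_def by measurable
  let ?DI = "\<lambda>j. double_integral \<alpha> (\<lambda>x. indicator (K j) x * e 1 x) (\<lambda>x. indicator (K j) x * ratio x)"
  have DI: "?DI j = (\<integral>\<^sup>+x. \<integral>\<^sup>+y. G j x y \<partial>lborel \<partial>lborel)" for j
    by (simp add: double_integral_def G_def)
  have part: "ennreal (?A / 2) * ?DI j \<le> ennreal (lam 2 - lam 1)" for j
  proof -
    obtain B where bw: "bounded_weighted (\<lambda>x. indicator (K j) x * e 1 x) (\<lambda>x. indicator (K j) x * ratio x) B"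
      using compact_part_bounded[OF Kc KD] by blast
    have "ennreal ?A * ?DI j \<le> ennreal (2 * (lam 2 - lam 1))"
      using compact_part_levy[OF Kc KD, of j] nn_integral_weighted_levy[OF bw _ \<alpha>(1)] w_nonneg by simp
    then have "ennreal (1 / 2) * (ennreal ?A * ?DI j) \<le> ennreal (1 / 2) * ennreal (2 * (lam 2 - lam 1))"
      by (intro mult_left_mono) auto
    also have "ennreal (1 / 2) * (ennreal ?A * ?DI j) = ennreal (1 / 2 * ?A) * ?DI j"
      by (simp only: ennreal_mult'[of "1 / 2"] mult.assoc)
    also have "1 / 2 * ?A = ?A / 2" by simp
    also have "ennreal (1 / 2) * ennreal (2 * (lam 2 - lam 1)) = ennreal (1 / 2 * (2 * (lam 2 - lam 1)))"
      by (rule ennreal_mult'[symmetric]) simp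
    also have "1 / 2 * (2 * (lam 2 - lam 1)) = lam 2 - lam 1" by simp
    finally show ?thesis .
  qed
  have lim: "ennreal ((ratio x - ratio y)\<^sup>2 / norm (x - y) powr (real CARD('d) + \<alpha>) * e 1 x * e 1 y) = liminf (\<lambda>j. G j x y)" for x y
  proof -
    have "eventually (\<lambda>j. ennreal ((ratio x - ratio y)\<^sup>2 / norm (x - y) powr (real CARD('d) + \<alpha>) * e 1 x * e 1 y) = G j x y) sequentially"
    proof (cases "x \<in> D \<and> y \<in> D")
      case True
      then have "eventually (\<lambda>j. x \<in> K j) sequentially" "eventually (\<lambda>j. y \<in> K j) sequentially" using Kev by auto
      then show ?thesis by eventually_elim (simp add: G_def)
    next
      case False
      then have "e 1 x = 0 \<or> e 1 y = 0" by (auto simp: e_def)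
      then show ?thesis by (auto simp: G_def)
    qed
    then have "(\<lambda>j. G j x y) \<longlonglongrightarrow> ennreal ((ratio x - ratio y)\<^sup>2 / norm (x - y) powr (real CARD('d) + \<alpha>) * e 1 x * e 1 y)"
      by (rule Lim_transform_eventually[OF tendsto_const])
    then show ?thesis by (rule lim_imp_Liminf[OF trivial_limit_sequentially, symmetric])
  qed
  have "double_integral \<alpha> (e 1) ratio = (\<integral>\<^sup>+x. \<integral>\<^sup>+y. liminf (\<lambda>j. G j x y) \<partial>lborel \<partial>lborel)"
    unfolding lim[symmetric] double_integral_def by simp
  also have "\<dots> \<le> (\<integral>\<^sup>+x. liminf (\<lambda>j. \<integral>\<^sup>+y. G j x y \<partial>lborel) \<partial>lborel)"
    by (intro nn_integral_mono nn_integral_liminf) measurable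
  also have "\<dots> \<le> liminf (\<lambda>j. \<integral>\<^sup>+x. \<integral>\<^sup>+y. G j x y \<partial>lborel \<partial>lborel)"
    by (intro nn_integral_liminf) measurable
  also have "\<dots> \<le> (SUP j. ?DI j)"
    unfolding DI by (intro order_trans[OF Liminf_le_Limsup Limsup_bounded] always_eventually allI SUP_upper) auto
  finally have "ennreal (?A / 2) * double_integral \<alpha> (e 1) ratio \<le> ennreal (?A / 2) * (SUP j. ?DI j)"
    by (rule mult_left_mono) simp
  also have "\<dots> = (SUP j. ennreal (?A / 2) * ?DI j)" by (rule SUP_mult_left_ennreal)
  also have "\<dots> \<le> ennreal (lam 2 - lam 1)" using part by (intro SUP_least)
  also have "ennreal (?A / 2) * double_integral \<alpha> (e 1) ratio = energy \<alpha> D (\<phi> 1) (\<lambda>x. \<phi> 2 x / \<phi> 1 x)"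
    by (rule energy_eq_double_integral[symmetric]) (auto simp: ratio_eq e_def)
  finally show ?thesis .
qed

end

section \<open>The spectral gap\<close>

theorem theorem1p1:
  fixes M :: "'w measure" and X :: "real \<Rightarrow> 'w \<Rightarrow> real ^ 'd" and \<alpha> :: real
    and D :: "(real ^ 'd) set"
    and lam :: "nat \<Rightarrow> real" and \<phi> :: "nat \<Rightarrow> real ^ 'd \<Rightarrow> real"
  assumes "0 < \<alpha>" and "\<alpha> < 2"
    and "symmetric_stable_process M X \<alpha>"
    and "open D" and "connected D" and "bounded D"
    and "orthonormal_basis_L2 D \<phi>"
    and "\<And>n t. n \<ge> 1 \<Longrightarrow> t \<ge> 0 \<Longrightarrow>
           AE x in lborel. x \<in> D \<longrightarrow> killed_semigroup M X D t (\<phi> n) x = exp (- lam n * t) * \<phi> n x"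
    and "0 < lam 1" and "lam 1 < lam 2" and "\<And>n. n \<ge> 2 \<Longrightarrow> lam n \<le> lam (Suc n)"
    and "filterlim lam at_top sequentially"
    and "\<And>n. n \<ge> 1 \<Longrightarrow> continuous_on D (\<phi> n)"
    and "\<And>n. n \<ge> 1 \<Longrightarrow> bounded (\<phi> n ` D)"
    and "\<And>x. x \<in> D \<Longrightarrow> 0 < \<phi> 1 x"
  shows "ennreal (lam 2 - lam 1) = (INF f\<in>admissible D (\<phi> 1). energy \<alpha> D (\<phi> 1) f) \<and>
    (\<lambda>x. \<phi> 2 x / \<phi> 1 x) \<in> admissible D (\<phi> 1) \<and>
    energy \<alpha> D (\<phi> 1) (\<lambda>x. \<phi> 2 x / \<phi> 1 x) =
      (INF f\<in>admissible D (\<phi> 1). energy \<alpha> D (\<phi> 1) f)"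
proof -
  interpret symmetric_stable_process M X \<alpha> by fact
  interpret killed_spectrum M X \<alpha> D lam \<phi>
    by unfold_locales fact+
  let ?f = "\<lambda>x. \<phi> 2 x / \<phi> 1 x" and ?inf = "INF f\<in>admissible D (\<phi> 1). energy \<alpha> D (\<phi> 1) f"
  have 1: "?inf \<le> energy \<alpha> D (\<phi> 1) ?f" by (rule INF_lower[OF ratio_admissible])
  have 2: "ennreal (lam 2 - lam 1) \<le> ?inf" by (rule INF_greatest) (rule energy_lower_bound)
  show ?thesis
    using order_trans[OF 1 energy_ratio_le] order_trans[OF 2 1] energy_ratio_le 1 2 ratio_admissible
    by (auto intro: antisym)
qed

end
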